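(* Let $n$ be a positive integer and let $\Lambda$ be an $n$-Auslander algebra. Then $\Lambda$ is representation-finite if and only if the number of isomorphism classes of indecomposable $\Lambda$-modules with projective dimension $n+1$ is finite.
   Context: All algebras are finite dimensional algebras over an algebraically closed field $k$, and all modules are finitely generated left modules. An algebra is representation-finite if it has only finitely many isomorphism classes of indecomposable modules. The dominant dimension of an algebra $\Gamma$ is the largest integer $d\ge 0$ (or $\infty$) such that the terms $I_0,I_1,\dots,I_{d-1}$ in the minimal injective resolution $0\to\Gamma\to I_0\to I_1\to\cdots$ of $\Gamma$ are projective. An algebra is called an $n$-Auslander algebra if its global dimension is at most $n+1$ and its dominant dimension is at least $n+1$. *)

theory Defs
  imports "HOL-Algebra.Algebra" "HOL-Library.Extended_Nat"
begin

section \<open>Left modules over a not necessarily commutative ring\<close>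

text \<open>
  The library locale \<open>module\<close> requires a commutative ring of scalars; the
  axioms below are the same ones without commutativity. The library locale \<open>submodule\<close> does
  not require commutativity and is used as it is. As usual in \<open>HOL-Algebra\<close>, the
  fields \<open>mult\<close> and \<open>one\<close> of a module record are irrelevant.
\<close>

locale left_module = R?: ring R + M?: abelian_group M
  for R :: "('a, 'b) ring_scheme" (structure) and M :: "('a, 'c, 'd) module_scheme" (structure) +
  assumes smult_closed [simp, intro]:
      "\<lbrakk>a \<in> carrier R; x \<in> carrier M\<rbrakk> \<Longrightarrow> a \<odot>\<^bsub>M\<^esub> x \<in> carrier M"
    and smult_l_distr:
      "\<lbrakk>a \<in> carrier R; b \<in> carrier R; x \<in> carrier M\<rbrakk> \<Longrightarrow>
        (a \<oplus> b) \<odot>\<^bsub>M\<^esub> x = a \<odot>\<^bsub>M\<^esub> x \<oplus>\<^bsub>M\<^esub> b \<odot>\<^bsub>M\<^esub> x"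
    and smult_r_distr:
      "\<lbrakk>a \<in> carrier R; x \<in> carrier M; y \<in> carrier M\<rbrakk> \<Longrightarrow>
        a \<odot>\<^bsub>M\<^esub> (x \<oplus>\<^bsub>M\<^esub> y) = a \<odot>\<^bsub>M\<^esub> x \<oplus>\<^bsub>M\<^esub> a \<odot>\<^bsub>M\<^esub> y"
    and smult_assoc1:
      "\<lbrakk>a \<in> carrier R; b \<in> carrier R; x \<in> carrier M\<rbrakk> \<Longrightarrow>
        (a \<otimes> b) \<odot>\<^bsub>M\<^esub> x = a \<odot>\<^bsub>M\<^esub> (b \<odot>\<^bsub>M\<^esub> x)"
    and smult_one [simp]:
      "x \<in> carrier M \<Longrightarrow> \<one> \<odot>\<^bsub>M\<^esub> x = x"

definition mod_span :: "('a, 'c) ring_scheme \<Rightarrow> ('a, 'm, 'd) module_scheme \<Rightarrow> 'm set \<Rightarrow> 'm set"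
  where "mod_span R M S = \<Inter>{N. submodule N R M \<and> S \<subseteq> N}"

definition finitely_generated :: "('a, 'c) ring_scheme \<Rightarrow> ('a, 'm, 'd) module_scheme \<Rightarrow> bool"
  where "finitely_generated R M \<longleftrightarrow>
    (\<exists>S. finite S \<and> S \<subseteq> carrier M \<and> mod_span R M S = carrier M)"

definition fg_module :: "('a, 'c) ring_scheme \<Rightarrow> ('a, 'm, 'd) module_scheme \<Rightarrow> bool"
  where "fg_module R M \<longleftrightarrow> left_module R M \<and> finitely_generated R M"

definition mod_hom ::
  "('a, 'c) ring_scheme \<Rightarrow> ('a, 'm, 'd) module_scheme \<Rightarrow> ('a, 'n, 'e) module_scheme \<Rightarrow> ('m \<Rightarrow> 'n) set"
  where "mod_hom R M N = {f \<in> carrier M \<rightarrow> carrier N.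
    (\<forall>x\<in>carrier M. \<forall>y\<in>carrier M. f (x \<oplus>\<^bsub>M\<^esub> y) = f x \<oplus>\<^bsub>N\<^esub> f y) \<and>
    (\<forall>a\<in>carrier R. \<forall>x\<in>carrier M. f (a \<odot>\<^bsub>M\<^esub> x) = a \<odot>\<^bsub>N\<^esub> f x)}"

definition mod_isomorphic ::
  "('a, 'c) ring_scheme \<Rightarrow> ('a, 'm, 'd) module_scheme \<Rightarrow> ('a, 'n, 'e) module_scheme \<Rightarrow> bool"
  where "mod_isomorphic R M N \<longleftrightarrow> (\<exists>f\<in>mod_hom R M N. bij_betw f (carrier M) (carrier N))"

definition indecomposable_module :: "('a, 'c) ring_scheme \<Rightarrow> ('a, 'm, 'd) module_scheme \<Rightarrow> bool"
  where "indecomposable_module R M \<longleftrightarrow> carrier M \<noteq> {\<zero>\<^bsub>M\<^esub>} \<and>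
    (\<forall>U V. submodule U R M \<and> submodule V R M \<and>
        U \<inter> V = {\<zero>\<^bsub>M\<^esub>} \<and> U <+>\<^bsub>M\<^esub> V = carrier M \<longrightarrow>
      U = {\<zero>\<^bsub>M\<^esub>} \<or> V = {\<zero>\<^bsub>M\<^esub>})"

definition essential_submodule ::
  "('a, 'c) ring_scheme \<Rightarrow> 'm set \<Rightarrow> ('a, 'm, 'd) module_scheme \<Rightarrow> bool"
  where "essential_submodule R E M \<longleftrightarrow> submodule E R M \<and>
    (\<forall>U. submodule U R M \<and> U \<inter> E = {\<zero>\<^bsub>M\<^esub>} \<longrightarrow> U = {\<zero>\<^bsub>M\<^esub>})"


section \<open>Finite dimensional algebras and their finitely generated modules\<close>

text \<open>
  An algebra is a record carrying both its ring structure and the scalar multiplication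
  by \<open>K\<close>. Being finite dimensional means being finitely generated as a \<open>K\<close>-module.
\<close>

locale fin_dim_algebra = K?: algebraically_closed K + A?: ring A + KA?: module K A
  for K :: "'k ring" (structure) and A :: "('k, 'a) module" (structure) +
  assumes smult_mult_left:
      "\<lbrakk>c \<in> carrier K; x \<in> carrier A; y \<in> carrier A\<rbrakk> \<Longrightarrow>
        (c \<odot>\<^bsub>A\<^esub> x) \<otimes>\<^bsub>A\<^esub> y = c \<odot>\<^bsub>A\<^esub> (x \<otimes>\<^bsub>A\<^esub> y)"
    and smult_mult_right:
      "\<lbrakk>c \<in> carrier K; x \<in> carrier A; y \<in> carrier A\<rbrakk> \<Longrightarrow>
        x \<otimes>\<^bsub>A\<^esub> (c \<odot>\<^bsub>A\<^esub> y) = c \<odot>\<^bsub>A\<^esub> (x \<otimes>\<^bsub>A\<^esub> y)"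
    and finite_dimensional: "finitely_generated K A"

text \<open>
  HOL cannot quantify over types inside a formula, so finitely generated
  \<open>A\<close>-modules are taken with carrier a subset of the type \<open>nat \<Rightarrow> 'k\<close>. Up to
  isomorphism these are all finitely generated \<open>A\<close>-modules, on whatever carrier type: see
  \<open>ex_isomorphic_std_module\<close> below.
\<close>

type_synonym ('k, 'a) std_module = "('a, nat \<Rightarrow> 'k) module"

definition regular_module :: "('k, 'a) module \<Rightarrow> ('a, 'a) module"
  where "regular_module A = \<lparr>carrier = carrier A, monoid.mult = monoid.mult A, one = \<one>\<^bsub>A\<^esub>,
    ring.zero = \<zero>\<^bsub>A\<^esub>, add = add A, smult = monoid.mult A\<rparr>"

definition projective_module :: "('k, 'a) module \<Rightarrow> ('k, 'a) std_module \<Rightarrow> bool"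
  where "projective_module A P \<longleftrightarrow> fg_module A P \<and>
    (\<forall>(M :: ('k, 'a) std_module) (N :: ('k, 'a) std_module).
      \<forall>g\<in>mod_hom A M N. \<forall>f\<in>mod_hom A P N.
        fg_module A M \<and> fg_module A N \<and> g ` carrier M = carrier N \<longrightarrow>
        (\<exists>h\<in>mod_hom A P M. \<forall>x\<in>carrier P. g (h x) = f x))"

definition injective_module :: "('k, 'a) module \<Rightarrow> ('k, 'a) std_module \<Rightarrow> bool"
  where "injective_module A J \<longleftrightarrow> fg_module A J \<and>
    (\<forall>(M :: ('k, 'a) std_module) (N :: ('k, 'a) std_module).
      \<forall>g\<in>mod_hom A M N. \<forall>f\<in>mod_hom A M J.
        fg_module A M \<and> fg_module A N \<and> inj_on g (carrier M) \<longrightarrow>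
        (\<exists>h\<in>mod_hom A N J. \<forall>x\<in>carrier M. h (g x) = f x))"


section \<open>Homological dimensions\<close>

text \<open>\<open>\<cdots> \<rightarrow> P 1 \<rightarrow> P 0 \<rightarrow> M \<rightarrow> 0\<close> with maps \<open>d i : P (Suc i) \<rightarrow> P i\<close> and \<open>e : P 0 \<rightarrow> M\<close>\<close>

definition projective_resolution ::
  "('k, 'a) module \<Rightarrow> ('a, 'm) module \<Rightarrow> (nat \<Rightarrow> ('k, 'a) std_module) \<Rightarrow>
    ((nat \<Rightarrow> 'k) \<Rightarrow> 'm) \<Rightarrow> (nat \<Rightarrow> (nat \<Rightarrow> 'k) \<Rightarrow> (nat \<Rightarrow> 'k)) \<Rightarrow> bool"
  where "projective_resolution A M P e d \<longleftrightarrow>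
    (\<forall>i. projective_module A (P i)) \<and>
    e \<in> mod_hom A (P 0) M \<and> (\<forall>i. d i \<in> mod_hom A (P (Suc i)) (P i)) \<and>
    e ` carrier (P 0) = carrier M \<and>
    d 0 ` carrier (P (Suc 0)) = a_kernel (P 0) M e \<and>
    (\<forall>i. d (Suc i) ` carrier (P (Suc (Suc i))) = a_kernel (P (Suc i)) (P i) (d i))"

text \<open>The infimum of the empty set is \<open>\<infinity>\<close>. The zero module gets projective dimension 0.\<close>

definition proj_dim :: "('k, 'a) module \<Rightarrow> ('a, 'm) module \<Rightarrow> enat"
  where "proj_dim A M = Inf {enat l | l. \<exists>P e d. projective_resolution A M P e d \<and>
    (\<forall>i>l. carrier (P i) = {\<zero>\<^bsub>P i\<^esub>})}"

definition gl_dim :: "('k, 'a) module \<Rightarrow> enat"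
  where "gl_dim A = Sup {proj_dim A M | M :: ('k, 'a) std_module. fg_module A M}"

text \<open>
  \<open>0 \<rightarrow> M \<rightarrow> J 0 \<rightarrow> J 1 \<rightarrow> \<cdots>\<close> with maps \<open>e : M \<rightarrow> J 0\<close> and \<open>d i : J i \<rightarrow> J (Suc i)\<close>.
  Minimality says that \<open>J 0\<close> and \<open>J (Suc i)\<close> are injective envelopes of \<open>M\<close> and of
  the image of \<open>d i\<close>, respectively.
\<close>

definition minimal_injective_resolution ::
  "('k, 'a) module \<Rightarrow> ('a, 'm) module \<Rightarrow> (nat \<Rightarrow> ('k, 'a) std_module) \<Rightarrow>
    ('m \<Rightarrow> (nat \<Rightarrow> 'k)) \<Rightarrow> (nat \<Rightarrow> (nat \<Rightarrow> 'k) \<Rightarrow> (nat \<Rightarrow> 'k)) \<Rightarrow> bool"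
  where "minimal_injective_resolution A M J e d \<longleftrightarrow>
    (\<forall>i. injective_module A (J i)) \<and>
    e \<in> mod_hom A M (J 0) \<and> (\<forall>i. d i \<in> mod_hom A (J i) (J (Suc i))) \<and>
    inj_on e (carrier M) \<and>
    e ` carrier M = a_kernel (J 0) (J (Suc 0)) (d 0) \<and>
    (\<forall>i. d i ` carrier (J i) = a_kernel (J (Suc i)) (J (Suc (Suc i))) (d (Suc i))) \<and>
    essential_submodule A (e ` carrier M) (J 0) \<and>
    (\<forall>i. essential_submodule A (d i ` carrier (J i)) (J (Suc i)))"

text \<open>
  Minimal injective resolutions are unique up to isomorphism, so it does not matter which one is
  taken. The set below contains 0 and is downward closed, so its supremum is its largest
  element, or \<open>\<infinity>\<close>.
\<close>

definition dom_dim :: "('k, 'a) module \<Rightarrow> enat"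
  where "dom_dim A = Sup {enat l | l. \<exists>J e d.
    minimal_injective_resolution A (regular_module A) J e d \<and>
    (\<forall>i<l. projective_module A (J i))}"

definition n_Auslander_algebra :: "nat \<Rightarrow> 'k ring \<Rightarrow> ('k, 'a) module \<Rightarrow> bool"
  where "n_Auslander_algebra n K A \<longleftrightarrow> fin_dim_algebra K A \<and>
    gl_dim A \<le> enat (n + 1) \<and> dom_dim A \<ge> enat (n + 1)"


section \<open>Isomorphism classes of indecomposable modules\<close>

definition indec_modules :: "('k, 'a) module \<Rightarrow> ('k, 'a) std_module set"
  where "indec_modules A = {M. fg_module A M \<and> indecomposable_module A M}"

definition mod_iso_rel :: "('k, 'a) module \<Rightarrow> ('k, 'a) std_module rel"
  where "mod_iso_rel A = {(M, N). fg_module A M \<and> fg_module A N \<and> mod_isomorphic A M N}"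

definition representation_finite :: "('k, 'a) module \<Rightarrow> bool"
  where "representation_finite A \<longleftrightarrow> finite (indec_modules A // mod_iso_rel A)"


section \<open>Adequacy of the choice of carrier type\<close>

lemma (in left_module) smult_l_null: "x \<in> carrier M \<Longrightarrow> \<zero> \<odot>\<^bsub>M\<^esub> x = \<zero>\<^bsub>M\<^esub>"
  by (metis M.add.r_cancel_one' R.l_zero R.zero_closed smult_closed smult_l_distr)

lemma (in left_module) smult_r_null: "a \<in> carrier R \<Longrightarrow> a \<odot>\<^bsub>M\<^esub> \<zero>\<^bsub>M\<^esub> = \<zero>\<^bsub>M\<^esub>"
  by (metis M.add.r_cancel_one' M.l_zero M.zero_closed smult_closed smult_r_distr)

lemma (in left_module) smult_l_minus:
  assumes "a \<in> carrier R" "x \<in> carrier M" shows "(\<ominus> a) \<odot>\<^bsub>M\<^esub> x = \<ominus>\<^bsub>M\<^esub> (a \<odot>\<^bsub>M\<^esub> x)"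
proof -
  have "(\<ominus> a) \<odot>\<^bsub>M\<^esub> x \<oplus>\<^bsub>M\<^esub> a \<odot>\<^bsub>M\<^esub> x = \<zero>\<^bsub>M\<^esub>"
    using smult_l_distr[of "\<ominus> a" a x] assms by (simp add: R.l_neg smult_l_null)
  then show ?thesis using assms by (simp add: M.minus_equality)
qed

lemma (in left_module) submodule_leftI:
  assumes "H \<subseteq> carrier M" "\<zero>\<^bsub>M\<^esub> \<in> H" "\<And>x y. x \<in> H \<Longrightarrow> y \<in> H \<Longrightarrow> x \<oplus>\<^bsub>M\<^esub> y \<in> H"
    and sm: "\<And>a x. a \<in> carrier R \<Longrightarrow> x \<in> H \<Longrightarrow> a \<odot>\<^bsub>M\<^esub> x \<in> H"
  shows "submodule H R M"
proof -
  have "\<ominus>\<^bsub>M\<^esub> x \<in> H" if "x \<in> H" for x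
    using sm[of "\<ominus> \<one>" x] smult_l_minus[of \<one> x] that assms(1) by auto
  then show ?thesis
    using assms by unfold_locales (auto simp: a_inv_def)
qed

lemma submodule_facts:
  assumes "submodule N R M"
  shows "N \<subseteq> carrier M" "\<zero>\<^bsub>M\<^esub> \<in> N"
    "\<And>x y. x \<in> N \<Longrightarrow> y \<in> N \<Longrightarrow> x \<oplus>\<^bsub>M\<^esub> y \<in> N"
    "\<And>a x. a \<in> carrier R \<Longrightarrow> x \<in> N \<Longrightarrow> a \<odot>\<^bsub>M\<^esub> x \<in> N"
proof -
  interpret submodule N R M by (rule assms)
  show "N \<subseteq> carrier M" "\<zero>\<^bsub>M\<^esub> \<in> N"
    "\<And>x y. x \<in> N \<Longrightarrow> y \<in> N \<Longrightarrow> x \<oplus>\<^bsub>M\<^esub> y \<in> N"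
    "\<And>a x. a \<in> carrier R \<Longrightarrow> x \<in> N \<Longrightarrow> a \<odot>\<^bsub>M\<^esub> x \<in> N"
    using subset one_closed m_closed smult_closed by auto
qed

lemma (in left_module) mod_span_submodule:
  assumes "S \<subseteq> carrier M" shows "submodule (mod_span R M S) R M"
proof -
  have c: "submodule (carrier M) R M" by (rule submodule_leftI) auto
  show ?thesis
  proof (rule submodule_leftI)
    show "mod_span R M S \<subseteq> carrier M" using c assms unfolding mod_span_def by blast
  qed (auto simp: mod_span_def intro: submodule_facts(2) submodule_facts(3) submodule_facts(4))
qed

lemma ex_inj_interleave: "\<exists>p :: (nat \<Rightarrow> 'k) \<times> (nat \<Rightarrow> 'k) \<Rightarrow> nat \<Rightarrow> 'k. inj p"
proof -
  define p where "p = (\<lambda>(f :: nat \<Rightarrow> 'k, g :: nat \<Rightarrow> 'k) n. if even n then f (n div 2) else g (n div 2))"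
  have "inj p"
  proof (rule injI)
    fix u v assume eq: "p u = p v"
    have "fst u i = fst v i" "snd u i = snd v i" for i
      using fun_cong[OF eq, of "2 * i"] fun_cong[OF eq, of "2 * i + 1"]
      by (simp_all add: p_def split_beta)
    then show "u = v" by (simp add: prod_eq_iff fun_eq_iff)
  qed
  then show ?thesis by blast
qed

lemma (in left_module) ex_inj_mod_span:
  fixes \<phi> :: "'a \<Rightarrow> nat \<Rightarrow> 'k"
  assumes "inj_on \<phi> (carrier R)" "finite S" "S \<subseteq> carrier M"
  shows "\<exists>\<psi> :: 'c \<Rightarrow> nat \<Rightarrow> 'k. inj_on \<psi> (mod_span R M S)"
  using assms(2,3)
proof (induction S)
  case empty
  have "submodule {\<zero>\<^bsub>M\<^esub>} R M" by (rule submodule_leftI) (auto simp: smult_r_null)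
  then have "mod_span R M {} \<subseteq> {\<zero>\<^bsub>M\<^esub>}" unfolding mod_span_def by auto
  then show ?case by (auto simp: inj_on_def)
next
  case (insert s S)
  let ?N = "mod_span R M S"
  have S: "S \<subseteq> carrier M" and s: "s \<in> carrier M" using insert by auto
  obtain \<psi> :: "'c \<Rightarrow> nat \<Rightarrow> 'k" where \<psi>: "inj_on \<psi> ?N" using insert by auto
  have N: "submodule ?N R M" by (rule mod_span_submodule[OF S])
  have Nc: "?N \<subseteq> carrier M" and N0: "\<zero>\<^bsub>M\<^esub> \<in> ?N"
    using submodule_facts[OF N] by auto
  have Na: "x \<oplus>\<^bsub>M\<^esub> y \<in> ?N" if "x \<in> ?N" "y \<in> ?N" for x y
    using submodule_facts(3)[OF N] that by auto
  define h where "h = (\<lambda>(a, x). a \<odot>\<^bsub>M\<^esub> s \<oplus>\<^bsub>M\<^esub> x)"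
  let ?H = "h ` (carrier R \<times> ?N)"
  have "submodule ?H R M"
  proof (rule submodule_leftI)
    show "?H \<subseteq> carrier M" using s Nc by (auto simp: h_def)
    show "\<zero>\<^bsub>M\<^esub> \<in> ?H"
      by (rule image_eqI[of _ _ "(\<zero>, \<zero>\<^bsub>M\<^esub>)"]) (auto simp: h_def smult_l_null s N0)
    fix u v assume "u \<in> ?H" "v \<in> ?H"
    then obtain a x b y where uv: "a \<in> carrier R" "x \<in> ?N" "b \<in> carrier R" "y \<in> ?N"
      "u = a \<odot>\<^bsub>M\<^esub> s \<oplus>\<^bsub>M\<^esub> x" "v = b \<odot>\<^bsub>M\<^esub> s \<oplus>\<^bsub>M\<^esub> y" by (auto simp: h_def)
    have "x \<in> carrier M" "y \<in> carrier M" using uv Nc by auto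
    then have "u \<oplus>\<^bsub>M\<^esub> v = h (a \<oplus> b, x \<oplus>\<^bsub>M\<^esub> y)"
      using uv s by (simp add: h_def smult_l_distr M.a_ac)
    then show "u \<oplus>\<^bsub>M\<^esub> v \<in> ?H" using uv Na by auto
  next
    fix c u assume c: "c \<in> carrier R" and "u \<in> ?H"
    then obtain a x where u: "a \<in> carrier R" "x \<in> ?N" "u = a \<odot>\<^bsub>M\<^esub> s \<oplus>\<^bsub>M\<^esub> x"
      by (auto simp: h_def)
    have "x \<in> carrier M" using u Nc by auto
    then have "c \<odot>\<^bsub>M\<^esub> u = h (c \<otimes> a, c \<odot>\<^bsub>M\<^esub> x)"
      using u s c by (simp add: h_def smult_r_distr smult_assoc1)
    then show "c \<odot>\<^bsub>M\<^esub> u \<in> ?H" using u c submodule_facts(4)[OF N] by auto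
  qed
  moreover have "insert s S \<subseteq> ?H"
  proof -
    have "s = h (\<one>, \<zero>\<^bsub>M\<^esub>)" "\<And>x. x \<in> S \<Longrightarrow> x = h (\<zero>, x)"
      using s S by (auto simp: h_def smult_l_null subset_iff)
    moreover have "S \<subseteq> ?N" unfolding mod_span_def by auto
    ultimately show ?thesis using N0 by (auto intro!: image_eqI)
  qed
  ultimately have sub: "mod_span R M (insert s S) \<subseteq> ?H" unfolding mod_span_def by blast
  obtain p :: "(nat \<Rightarrow> 'k) \<times> (nat \<Rightarrow> 'k) \<Rightarrow> nat \<Rightarrow> 'k" where p: "inj p"
    using ex_inj_interleave by blast
  have ms: "inj_on (map_prod \<phi> \<psi>) (carrier R \<times> ?N)"
    by (rule map_prod_inj_on[OF assms(1) \<psi>])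
  have inv: "inj_on (inv_into (carrier R \<times> ?N) h) ?H" by (rule inj_on_inv_into) simp
  have "inj_on (map_prod \<phi> \<psi>) (inv_into (carrier R \<times> ?N) h ` ?H)"
    by (rule inj_on_subset[OF ms], rule image_subsetI, rule inv_into_into)
  then have "inj_on (p \<circ> (map_prod \<phi> \<psi> \<circ> inv_into (carrier R \<times> ?N) h)) ?H"
    by (intro comp_inj_on inv inj_on_subset[OF p]) auto
  then show ?case using sub inj_on_subset by blast
qed

lemma (in module) left_module: "left_module R M"
  by unfold_locales (auto simp: smult_l_distr smult_r_distr smult_assoc1)

theorem (in fin_dim_algebra) ex_isomorphic_std_module:
  fixes M :: "('a, 'm) module"
  assumes "fg_module A M"
  shows "\<exists>N :: ('k, 'a) std_module. fg_module A N \<and> mod_isomorphic A M N"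
proof -
  interpret L: left_module A M using assms by (simp add: fg_module_def)
  have "inj_on (\<lambda>c n. c) (carrier K)" by (auto simp: inj_on_def dest: fun_cong)
  then obtain \<phi> :: "'a \<Rightarrow> nat \<Rightarrow> 'k" where \<phi>: "inj_on \<phi> (carrier A)"
    using left_module.ex_inj_mod_span[OF KA.left_module] finite_dimensional
    unfolding finitely_generated_def by metis
  obtain S where S: "finite S" "S \<subseteq> carrier M" "mod_span A M S = carrier M"
    using assms unfolding fg_module_def finitely_generated_def by blast
  then obtain \<psi> :: "'m \<Rightarrow> nat \<Rightarrow> 'k" where \<psi>: "inj_on \<psi> (carrier M)"
    using L.ex_inj_mod_span[OF \<phi>] by metis
  define i where "i = inv_into (carrier M) \<psi>"
  have i [simp]: "i (\<psi> x) = x" if "x \<in> carrier M" for x using that \<psi> by (simp add: i_def)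
  define N :: "('k, 'a) std_module" where
    "N = \<lparr>carrier = \<psi> ` carrier M, monoid.mult = undefined, one = undefined, ring.zero = \<psi> \<zero>\<^bsub>M\<^esub>,
      add = (\<lambda>u v. \<psi> (i u \<oplus>\<^bsub>M\<^esub> i v)), smult = (\<lambda>a u. \<psi> (a \<odot>\<^bsub>M\<^esub> i u))\<rparr>"
  have "abelian_group N"
  proof (rule abelian_groupI)
    fix u assume "u \<in> carrier N"
    then obtain x where "x \<in> carrier M" "u = \<psi> x" by (auto simp: N_def)
    then show "\<exists>v\<in>carrier N. v \<oplus>\<^bsub>N\<^esub> u = \<zero>\<^bsub>N\<^esub>"
      by (intro bexI[of _ "\<psi> (\<ominus>\<^bsub>M\<^esub> x)"]) (auto simp: N_def L.M.l_neg)
  qed (auto simp: N_def L.M.a_ac)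
  then have N: "left_module A N"
    by (auto intro!: left_module.intro A.ring_axioms left_module_axioms.intro
        simp: N_def L.smult_l_distr L.smult_r_distr L.smult_assoc1)
  interpret N: left_module A N by (rule N)
  have hom: "\<psi> \<in> mod_hom A M N" by (auto simp: mod_hom_def N_def)
  have "mod_span A N (\<psi> ` S) = carrier N"
  proof
    show "mod_span A N (\<psi> ` S) \<subseteq> carrier N"
      using submodule_facts(1)[OF N.mod_span_submodule[of "\<psi> ` S"]] S
      by (auto simp: N_def)
    show "carrier N \<subseteq> mod_span A N (\<psi> ` S)"
      unfolding mod_span_def
    proof (intro Inter_greatest)
      fix U assume "U \<in> {U. submodule U A N \<and> \<psi> ` S \<subseteq> U}"
      then have U: "submodule U A N" "\<psi> ` S \<subseteq> U" by auto
      have "submodule {x \<in> carrier M. \<psi> x \<in> U} A M"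
      proof (rule L.submodule_leftI)
        show "\<zero>\<^bsub>M\<^esub> \<in> {x \<in> carrier M. \<psi> x \<in> U}"
          using submodule_facts(2)[OF U(1)] by (auto simp: N_def)
      next
        fix x y assume "x \<in> {x \<in> carrier M. \<psi> x \<in> U}" "y \<in> {x \<in> carrier M. \<psi> x \<in> U}"
        then show "x \<oplus>\<^bsub>M\<^esub> y \<in> {x \<in> carrier M. \<psi> x \<in> U}"
          using submodule_facts(3)[OF U(1), of "\<psi> x" "\<psi> y"]
          by (auto simp: N_def)
      next
        fix a x assume "a \<in> carrier A" "x \<in> {x \<in> carrier M. \<psi> x \<in> U}"
        then show "a \<odot>\<^bsub>M\<^esub> x \<in> {x \<in> carrier M. \<psi> x \<in> U}"
          using submodule_facts(4)[OF U(1), of a "\<psi> x"] by (auto simp: N_def)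
      qed auto
      then have "carrier M \<subseteq> {x \<in> carrier M. \<psi> x \<in> U}"
        using S U(2) unfolding mod_span_def by blast
      then show "carrier N \<subseteq> U" by (auto simp: N_def)
    qed
  qed
  then have "fg_module A N"
    using N S(1,2) unfolding fg_module_def finitely_generated_def
    by (intro conjI exI[of _ "\<psi> ` S"]) (auto simp: N_def)
  moreover have "mod_isomorphic A M N"
    using hom \<psi> unfolding mod_isomorphic_def by (auto simp: bij_betw_def N_def)
  ultimately show ?thesis by blast
qed

end

theory Submission
  imports Defs
begin

text \<open>
  Write pd for projective dimension. For \<open>d \<le> n\<close>, finitely many indecomposable modules with
  \<open>pd > d\<close> leave room for only finitely many with \<open>pd = d\<close>; so the finiteness for \<open>pd = n + 1\<close>,
  the largest value that the global dimension admits, descends to all \<open>d\<close>.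

  Let \<open>M\<close> be indecomposable with \<open>1 \<le> pd M = d \<le> n\<close>. The dominant dimension provides an embedding
  of \<open>M\<close> into a module \<open>I\<close> that is projective and injective (\<open>embeds_in_projective_injective\<close>), because
  \<open>Ext\<close> into \<open>M\<close> vanishes in degree \<open>0\<close> from modules without nonzero maps to such modules
  (\<open>ext_vanish_of_pd_le\<close>). Then \<open>M\<close> is a syzygy of \<open>N = I / M\<close>. Split \<open>N\<close> into
  indecomposable modules. Since the endomorphism ring of \<open>M\<close> is local and \<open>M\<close>, not being
  projective, is not a summand of \<open>I\<close>, it is a summand of the syzygy \<open>\<Omega> Y\<close> of one indecomposable
  summand \<open>Y\<close> of \<open>N\<close>, whatever surjection from a projective module onto \<open>Y\<close> defines \<open>\<Omega> Y\<close>
  (\<open>summand_of_syzygy\<close>). If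
  \<open>pd Y \<le> d\<close>, then \<open>pd \<Omega> Y \<le> d - 1\<close> (\<open>pd_le_kernel\<close>), hence \<open>pd M \<le> d - 1\<close>, a contradiction. So
  \<open>pd Y > d\<close>, and up to isomorphism there are finitely many such \<open>Y\<close>. Each \<open>\<Omega> Y\<close> has only finitely
  many indecomposable summands (\<open>finitely_many_indecomposable_summands\<close>), and \<open>M\<close> is one of them
  (\<open>finite_up_to_iso_step\<close>). In the end only the indecomposable projective modules are left; these are
  summands of the regular module (\<open>finite_up_to_iso_projectives\<close>).

  The only finiteness that enters is a length: since finitely generated modules are finite
  dimensional over the ground field, a strictly monotone function from submodules to natural numbers
  exists (\<open>length_function\<close>). It yields that submodules are finitely generated, Fitting's lemma,
  decompositions into indecomposable modules, and the extremal choices in several proofs.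
\<close>

section \<open>Homomorphisms and submodules\<close>

lemma mod_homI:
  assumes "\<And>x. x \<in> carrier M \<Longrightarrow> f x \<in> carrier N"
    and "\<And>x y. x \<in> carrier M \<Longrightarrow> y \<in> carrier M \<Longrightarrow> f (x \<oplus>\<^bsub>M\<^esub> y) = f x \<oplus>\<^bsub>N\<^esub> f y"
    and "\<And>a x. a \<in> carrier R \<Longrightarrow> x \<in> carrier M \<Longrightarrow> f (a \<odot>\<^bsub>M\<^esub> x) = a \<odot>\<^bsub>N\<^esub> f x"
  shows "f \<in> mod_hom R M N"
  using assms by (auto simp: mod_hom_def)

lemma mod_hom_closed: "f \<in> mod_hom R M N \<Longrightarrow> x \<in> carrier M \<Longrightarrow> f x \<in> carrier N"
  by (auto simp: mod_hom_def)

lemma mod_hom_add: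
  "f \<in> mod_hom R M N \<Longrightarrow> x \<in> carrier M \<Longrightarrow> y \<in> carrier M \<Longrightarrow> f (x \<oplus>\<^bsub>M\<^esub> y) = f x \<oplus>\<^bsub>N\<^esub> f y"
  by (auto simp: mod_hom_def)

lemma mod_hom_smult:
  "f \<in> mod_hom R M N \<Longrightarrow> a \<in> carrier R \<Longrightarrow> x \<in> carrier M \<Longrightarrow> f (a \<odot>\<^bsub>M\<^esub> x) = a \<odot>\<^bsub>N\<^esub> f x"
  by (auto simp: mod_hom_def)

lemma mod_hom_zero:
  assumes "left_module R M" "left_module R N" "f \<in> mod_hom R M N"
  shows "f \<zero>\<^bsub>M\<^esub> = \<zero>\<^bsub>N\<^esub>"
proof -
  interpret M: left_module R M by fact
  interpret N: left_module R N by fact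
  have "f \<zero>\<^bsub>M\<^esub> \<oplus>\<^bsub>N\<^esub> f \<zero>\<^bsub>M\<^esub> = f \<zero>\<^bsub>M\<^esub>"
    using mod_hom_add[OF assms(3), of "\<zero>\<^bsub>M\<^esub>" "\<zero>\<^bsub>M\<^esub>"] by simp
  then show ?thesis
    using mod_hom_closed[OF assms(3), of "\<zero>\<^bsub>M\<^esub>"] by (metis N.M.add.r_cancel_one M.M.zero_closed)
qed

lemma mod_hom_neg:
  assumes "left_module R M" "left_module R N" "f \<in> mod_hom R M N" "x \<in> carrier M"
  shows "f (\<ominus>\<^bsub>M\<^esub> x) = \<ominus>\<^bsub>N\<^esub> f x"
proof -
  interpret M: left_module R M by fact
  interpret N: left_module R N by fact
  have "f (\<ominus>\<^bsub>M\<^esub> x) \<oplus>\<^bsub>N\<^esub> f x = \<zero>\<^bsub>N\<^esub>"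
    using mod_hom_add[OF assms(3), of "\<ominus>\<^bsub>M\<^esub> x" x] assms mod_hom_zero[OF assms(1-3)]
    by (simp add: M.M.l_neg)
  then show ?thesis
    using assms mod_hom_closed[OF assms(3)] by (metis M.M.a_inv_closed N.M.minus_equality)
qed

lemma mod_hom_minus:
  assumes "left_module R M" "left_module R N" "f \<in> mod_hom R M N" "x \<in> carrier M" "y \<in> carrier M"
  shows "f (x \<ominus>\<^bsub>M\<^esub> y) = f x \<ominus>\<^bsub>N\<^esub> f y"
proof -
  interpret M: left_module R M by fact
  show ?thesis
    using assms by (simp add: a_minus_def mod_hom_add[OF assms(3)] mod_hom_neg[OF assms(1-3)])
qed

lemma (in abelian_group) add_minus_cancel:
  "x \<in> carrier G \<Longrightarrow> y \<in> carrier G \<Longrightarrow> x \<oplus> (y \<ominus> x) = y"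
  by (metis a_minus_def add.m_lcomm a_inv_closed r_neg r_zero)

lemma (in abelian_group) minus_eq_zero_iff:
  "x \<in> carrier G \<Longrightarrow> y \<in> carrier G \<Longrightarrow> x \<ominus> y = \<zero> \<longleftrightarrow> x = y"
  by (metis a_minus_def add.inv_solve_right a_inv_closed l_zero zero_closed r_neg)

lemma (in abelian_group) minus_zero_right: "x \<in> carrier G \<Longrightarrow> x \<ominus> \<zero> = x"
  by (simp add: a_minus_def)

lemma mod_hom_compose:
  "f \<in> mod_hom R L M \<Longrightarrow> g \<in> mod_hom R M N \<Longrightarrow> (\<lambda>x. g (f x)) \<in> mod_hom R L N"
  by (auto simp: mod_hom_def Pi_iff)

lemma mod_hom_id: "(\<lambda>x. x) \<in> mod_hom R M M"
  by (auto simp: mod_hom_def)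

lemma mod_hom_zero_map:
  assumes "left_module R N" shows "(\<lambda>_. \<zero>\<^bsub>N\<^esub>) \<in> mod_hom R M N"
proof -
  interpret N: left_module R N by fact
  show ?thesis by (rule mod_homI) (auto simp: N.smult_r_null)
qed

lemma mod_hom_plus:
  assumes "left_module R N" "f \<in> mod_hom R M N" "g \<in> mod_hom R M N"
  shows "(\<lambda>x. f x \<oplus>\<^bsub>N\<^esub> g x) \<in> mod_hom R M N"
proof -
  interpret N: left_module R N by fact
  note c = mod_hom_closed[OF assms(2)] mod_hom_closed[OF assms(3)]
  show ?thesis
    by (rule mod_homI) (auto simp: c N.smult_r_distr mod_hom_add[OF assms(2)]
        mod_hom_add[OF assms(3)] mod_hom_smult[OF assms(2)] mod_hom_smult[OF assms(3)] N.M.a_ac)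
qed

lemma mod_hom_uminus:
  assumes "left_module R N" "g \<in> mod_hom R M N"
  shows "(\<lambda>x. \<ominus>\<^bsub>N\<^esub> g x) \<in> mod_hom R M N"
proof -
  interpret N: left_module R N by fact
  note c = mod_hom_closed[OF assms(2)]
  have *: "a \<odot>\<^bsub>N\<^esub> (\<ominus>\<^bsub>N\<^esub> x) = \<ominus>\<^bsub>N\<^esub> (a \<odot>\<^bsub>N\<^esub> x)" if "a \<in> carrier R" "x \<in> carrier N" for a x
  proof -
    have "a \<odot>\<^bsub>N\<^esub> (\<ominus>\<^bsub>N\<^esub> x) \<oplus>\<^bsub>N\<^esub> a \<odot>\<^bsub>N\<^esub> x = \<zero>\<^bsub>N\<^esub>"
      using that N.smult_r_distr[of a "\<ominus>\<^bsub>N\<^esub> x" x] by (simp add: N.M.l_neg N.smult_r_null)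
    then show ?thesis using that N.M.minus_equality by (metis N.M.a_inv_closed N.smult_closed)
  qed
  show ?thesis
    by (rule mod_homI) (auto simp: c * N.M.minus_add mod_hom_add[OF assms(2)]
        mod_hom_smult[OF assms(2)] N.M.a_ac)
qed

lemma mod_hom_diff:
  assumes "left_module R N" "f \<in> mod_hom R M N" "g \<in> mod_hom R M N"
  shows "(\<lambda>x. f x \<ominus>\<^bsub>N\<^esub> g x) \<in> mod_hom R M N"
  unfolding a_minus_def by (rule mod_hom_plus[OF assms(1,2) mod_hom_uminus[OF assms(1,3)]])

lemma left_module_submodule:
  assumes "left_module R M" "submodule U R M"
  shows "left_module R (M\<lparr>carrier := U\<rparr>)"
proof -
  interpret M: left_module R M by fact
  note s = submodule_facts[OF assms(2)]
  have c: "x \<in> carrier M" if "x \<in> U" for x using s(1) that by blast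
  have neg: "\<ominus>\<^bsub>M\<^esub> x \<in> U" if "x \<in> U" for x
  proof -
    have "\<ominus>\<^bsub>M\<^esub> x = (\<ominus>\<^bsub>R\<^esub> \<one>\<^bsub>R\<^esub>) \<odot>\<^bsub>M\<^esub> x"
      using M.smult_l_minus[OF M.R.one_closed c[OF that]] M.smult_one[OF c[OF that]] by simp
    then show ?thesis using s(4)[OF M.R.a_inv_closed[OF M.R.one_closed] that] by simp
  qed
  have "abelian_group (M\<lparr>carrier := U\<rparr>)"
  proof (rule abelian_groupI, goal_cases)
    case (3 x y z)
    then show ?case using M.M.a_assoc[OF c c c, of x y z] by simp
  next
    case (4 x y)
    then show ?case using M.M.a_comm[OF c c, of x y] by simp
  next
    case (6 x)
    then show ?case using neg[of x] M.M.l_neg[OF c, of x] by auto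
  qed (simp_all add: s(2,3) c)
  moreover have "left_module_axioms R (M\<lparr>carrier := U\<rparr>)"
    by (rule left_module_axioms.intro)
      (simp_all add: s(4) c M.smult_l_distr M.smult_r_distr M.smult_assoc1)
  ultimately show ?thesis by (intro left_module.intro M.R.ring_axioms)
qed

lemma submodule_minus:
  assumes "left_module R M" "submodule U R M" "x \<in> U" "y \<in> U"
  shows "x \<ominus>\<^bsub>M\<^esub> y \<in> U"
proof -
  interpret M: left_module R M by fact
  note s = submodule_facts[OF assms(2)]
  have y: "y \<in> carrier M" using s(1) assms(4) by blast
  have "\<ominus>\<^bsub>M\<^esub> y = (\<ominus>\<^bsub>R\<^esub> \<one>\<^bsub>R\<^esub>) \<odot>\<^bsub>M\<^esub> y"
    using M.smult_l_minus[OF M.R.one_closed y] M.smult_one[OF y] by simp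
  then have "\<ominus>\<^bsub>M\<^esub> y \<in> U"
    using s(4)[OF M.R.a_inv_closed[OF M.R.one_closed] assms(4)] by simp
  then show ?thesis using s(3) assms by (simp add: a_minus_def)
qed

lemma submodule_sub_iff:
  assumes "left_module R M" "submodule U R M"
  shows "submodule V R (M\<lparr>carrier := U\<rparr>) \<longleftrightarrow> submodule V R M \<and> V \<subseteq> U"
proof
  assume "submodule V R (M\<lparr>carrier := U\<rparr>)"
  note s = submodule_facts[OF this]
  show "submodule V R M \<and> V \<subseteq> U"
    using s submodule_facts(1)[OF assms(2)]
    by (auto intro!: left_module.submodule_leftI[OF assms(1)])
next
  assume a: "submodule V R M \<and> V \<subseteq> U"
  note s = submodule_facts[OF conjunct1[OF a]]
  show "submodule V R (M\<lparr>carrier := U\<rparr>)"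
    using s a by (auto intro!: left_module.submodule_leftI[OF left_module_submodule[OF assms]])
qed

lemma submodule_carrier: "left_module R M \<Longrightarrow> submodule (carrier M) R M"
proof -
  assume "left_module R M"
  then interpret M: left_module R M .
  show ?thesis by (rule M.submodule_leftI) auto
qed

lemma submodule_zero: "left_module R M \<Longrightarrow> submodule {\<zero>\<^bsub>M\<^esub>} R M"
proof -
  assume "left_module R M"
  then interpret M: left_module R M .
  show ?thesis by (rule M.submodule_leftI) (auto simp: M.smult_r_null)
qed

lemma submodule_Int:
  assumes "left_module R M" "submodule U R M" "submodule V R M"
  shows "submodule (U \<inter> V) R M"
  using submodule_facts[OF assms(2)] submodule_facts[OF assms(3)]
  by (intro left_module.submodule_leftI[OF assms(1)]) auto

lemma submodule_vimage:
  assumes "left_module R M" "left_module R N" "f \<in> mod_hom R M N" "submodule U R N"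
  shows "submodule {x \<in> carrier M. f x \<in> U} R M"
proof -
  interpret M: left_module R M by fact
  show ?thesis
    using submodule_facts[OF assms(4)] mod_hom_zero[OF assms(1-3)] mod_hom_add[OF assms(3)]
      mod_hom_smult[OF assms(3)]
    by (intro M.submodule_leftI) auto
qed

lemma a_kernel_eq: "a_kernel M N f = {x \<in> carrier M. f x = \<zero>\<^bsub>N\<^esub>}"
  by (simp add: a_kernel_def')

lemma submodule_kernel:
  assumes "left_module R M" "left_module R N" "f \<in> mod_hom R M N"
  shows "submodule (a_kernel M N f) R M"
  using submodule_vimage[OF assms submodule_zero[OF assms(2)]] by (simp add: a_kernel_eq)

lemma submodule_image:
  assumes "left_module R M" "left_module R N" "f \<in> mod_hom R M N" "submodule U R M"
  shows "submodule (f ` U) R N"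
proof -
  interpret N: left_module R N by fact
  note s = submodule_facts[OF assms(4)]
  have c: "x \<in> carrier M" if "x \<in> U" for x using s(1) that by blast
  show ?thesis
  proof (rule N.submodule_leftI)
    show "f ` U \<subseteq> carrier N" using mod_hom_closed[OF assms(3)] c by auto
    show "\<zero>\<^bsub>N\<^esub> \<in> f ` U" using mod_hom_zero[OF assms(1-3)] s(2) by (metis image_eqI)
    show "x \<oplus>\<^bsub>N\<^esub> y \<in> f ` U" if "x \<in> f ` U" "y \<in> f ` U" for x y
    proof -
      from that obtain u v where uv: "u \<in> U" "v \<in> U" "x = f u" "y = f v" by blast
      then have "x \<oplus>\<^bsub>N\<^esub> y = f (u \<oplus>\<^bsub>M\<^esub> v)" using mod_hom_add[OF assms(3) c c] by simp
      then show ?thesis using s(3) uv by blast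
    qed
    show "a \<odot>\<^bsub>N\<^esub> x \<in> f ` U" if "a \<in> carrier R" "x \<in> f ` U" for a x
    proof -
      from that(2) obtain u where u: "u \<in> U" "x = f u" by blast
      then have "a \<odot>\<^bsub>N\<^esub> x = f (a \<odot>\<^bsub>M\<^esub> u)" using mod_hom_smult[OF assms(3) that(1) c] by simp
      then show ?thesis using s(4) u that by blast
    qed
  qed
qed

lemma mod_hom_into_sub:
  assumes "f \<in> mod_hom R M N" "\<And>x. x \<in> carrier M \<Longrightarrow> f x \<in> U"
  shows "f \<in> mod_hom R M (N\<lparr>carrier := U\<rparr>)"
  using assms by (auto simp: mod_hom_def)

lemma mod_hom_from_sub:
  assumes "f \<in> mod_hom R M N" "submodule U R M"
  shows "f \<in> mod_hom R (M\<lparr>carrier := U\<rparr>) N"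
  using assms(1) submodule_facts(1)[OF assms(2)] by (auto simp: mod_hom_def Pi_iff subset_iff)

lemma mod_hom_sub_incl:
  assumes "f \<in> mod_hom R M (N\<lparr>carrier := U\<rparr>)" "submodule U R N"
  shows "f \<in> mod_hom R M N"
  using assms(1) submodule_facts(1)[OF assms(2)] by (auto simp: mod_hom_def Pi_iff subset_iff)

lemma mod_hom_inv:
  assumes "left_module R M" "f \<in> mod_hom R M N" "bij_betw f (carrier M) (carrier N)"
  shows "inv_into (carrier M) f \<in> mod_hom R N M"
proof -
  interpret M: left_module R M by fact
  let ?g = "inv_into (carrier M) f"
  have i: "?g (f x) = x" if "x \<in> carrier M" for x using assms(3) that by (simp add: bij_betw_def)
  have ex: "\<exists>x\<in>carrier M. y = f x" if "y \<in> carrier N" for y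
    using assms(3) that by (auto simp: bij_betw_def)
  show ?thesis
  proof (rule mod_homI)
    show "?g x \<in> carrier M" if "x \<in> carrier N" for x using ex[OF that] i by auto
    fix x y assume "x \<in> carrier N" "y \<in> carrier N"
    then show "?g (x \<oplus>\<^bsub>N\<^esub> y) = ?g x \<oplus>\<^bsub>M\<^esub> ?g y"
      using ex i mod_hom_add[OF assms(2)] by (metis M.M.a_closed)
  next
    fix a x assume "a \<in> carrier R" "x \<in> carrier N"
    then show "?g (a \<odot>\<^bsub>N\<^esub> x) = a \<odot>\<^bsub>M\<^esub> ?g x"
      using ex i mod_hom_smult[OF assms(2)] by (metis M.smult_closed)
  qed
qed

text \<open>Factoring \<open>f\<close> through a surjection \<open>g\<close> that kills no more than \<open>f\<close> does.\<close>

lemma mod_hom_factor: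
  assumes lm: "left_module R M" "left_module R N" "left_module R L"
    and f: "f \<in> mod_hom R M N" and g: "g \<in> mod_hom R M L" "g ` carrier M = carrier L"
    and k: "\<And>x. x \<in> carrier M \<Longrightarrow> g x = \<zero>\<^bsub>L\<^esub> \<Longrightarrow> f x = \<zero>\<^bsub>N\<^esub>"
  shows "\<exists>h\<in>mod_hom R L N. \<forall>x\<in>carrier M. h (g x) = f x"
proof -
  interpret M: left_module R M by fact
  interpret N: left_module R N by fact
  interpret L: left_module R L by fact
  define h where "h y = f (inv_into (carrier M) g y)" for y
  have h: "h (g x) = f x" if "x \<in> carrier M" for x
  proof -
    let ?x = "inv_into (carrier M) g (g x)"
    have x: "?x \<in> carrier M" "g ?x = g x"
      using that by (auto intro: inv_into_into simp: f_inv_into_f)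
    have "g (?x \<ominus>\<^bsub>M\<^esub> x) = \<zero>\<^bsub>L\<^esub>"
      using x that mod_hom_closed[OF g(1)]
      by (simp add: mod_hom_minus[OF lm(1,3) g(1)] L.M.minus_eq_zero_iff)
    then have "f (?x \<ominus>\<^bsub>M\<^esub> x) = \<zero>\<^bsub>N\<^esub>" using k x that by simp
    then show ?thesis
      using x that mod_hom_closed[OF f]
      by (simp add: mod_hom_minus[OF lm(1,2) f] N.M.minus_eq_zero_iff h_def)
  qed
  have ex: "\<exists>x\<in>carrier M. y = g x" if "y \<in> carrier L" for y using g(2) that by auto
  have "h \<in> mod_hom R L N"
  proof (rule mod_homI)
    show "h y \<in> carrier N" if "y \<in> carrier L" for y
      using ex[OF that] h mod_hom_closed[OF f] by auto
    fix x y assume "x \<in> carrier L" "y \<in> carrier L"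
    then show "h (x \<oplus>\<^bsub>L\<^esub> y) = h x \<oplus>\<^bsub>N\<^esub> h y"
      using ex h mod_hom_add[OF f] mod_hom_add[OF g(1)] by (metis M.M.a_closed)
  next
    fix a x assume "a \<in> carrier R" "x \<in> carrier L"
    then show "h (a \<odot>\<^bsub>L\<^esub> x) = a \<odot>\<^bsub>N\<^esub> h x"
      using ex h mod_hom_smult[OF f] mod_hom_smult[OF g(1)] by (metis M.smult_closed)
  qed
  then show ?thesis using h by blast
qed

lemma inj_on_mod_hom_iff:
  assumes "left_module R M" "left_module R N" "f \<in> mod_hom R M N"
  shows "inj_on f (carrier M) \<longleftrightarrow> (\<forall>x\<in>carrier M. f x = \<zero>\<^bsub>N\<^esub> \<longrightarrow> x = \<zero>\<^bsub>M\<^esub>)"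
proof -
  interpret M: left_module R M by fact
  interpret N: left_module R N by fact
  note z = mod_hom_zero[OF assms] and c = mod_hom_closed[OF assms(3)]
    and m = mod_hom_minus[OF assms]
  show ?thesis
  proof
    assume "inj_on f (carrier M)"
    then show "\<forall>x\<in>carrier M. f x = \<zero>\<^bsub>N\<^esub> \<longrightarrow> x = \<zero>\<^bsub>M\<^esub>"
      using z by (metis M.M.zero_closed inj_onD)
  next
    assume k: "\<forall>x\<in>carrier M. f x = \<zero>\<^bsub>N\<^esub> \<longrightarrow> x = \<zero>\<^bsub>M\<^esub>"
    show "inj_on f (carrier M)"
    proof (rule inj_onI)
      fix x y assume "x \<in> carrier M" "y \<in> carrier M" "f x = f y"
      then show "x = y"
        using m[of x y] c k by (metis M.M.minus_closed M.M.minus_eq_zero_iff N.M.minus_eq_zero_iff)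
    qed
  qed
qed

lemma fg_left_module: "fg_module R M \<Longrightarrow> left_module R M"
  by (simp add: fg_module_def)

section \<open>Lengths of finitely generated modules\<close>

lemma mod_span_subset: "S \<subseteq> mod_span R M S"
  by (auto simp: mod_span_def)

lemma mod_span_least: "submodule N R M \<Longrightarrow> S \<subseteq> N \<Longrightarrow> mod_span R M S \<subseteq> N"
  by (auto simp: mod_span_def)

text \<open>Over a field the function to find counts the steps at which a subspace grows along the
  filtration by the spans of the first generators. The step for one new generator can contribute
  at most 1 because two vectors outside the smaller span are proportional modulo it.\<close>

lemma vector_space_rank_function:
  fixes V :: "('k, 'v, 'd) module_scheme"
  assumes "field K" "left_module K V" "finite S" "S \<subseteq> carrier V"
  shows "\<exists>\<mu> :: 'v set \<Rightarrow> nat. \<forall>U W. submodule U K V \<and> submodule W K V \<and> U \<subset> W \<and> W \<subseteq> mod_span K V S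
    \<longrightarrow> \<mu> U < \<mu> W"
  using assms(3,4)
proof (induction S)
  case empty
  have "mod_span K V {} \<subseteq> {\<zero>\<^bsub>V\<^esub>}" by (rule mod_span_least[OF submodule_zero[OF assms(2)]]) simp
  then have "False" if "submodule U K V" "U \<subset> W" "W \<subseteq> mod_span K V {}" for U W
    using submodule_facts(2)[OF that(1)] that(2,3) by blast
  then show ?case by blast
next
  case (insert s S)
  interpret K: field K by fact
  interpret V: left_module K V by fact
  let ?N = "mod_span K V S"
  have S: "S \<subseteq> carrier V" and s: "s \<in> carrier V" using insert by auto
  obtain \<mu> :: "'v set \<Rightarrow> nat" where \<mu>: "\<And>U W. submodule U K V \<Longrightarrow> submodule W K V \<Longrightarrow> U \<subset> W
      \<Longrightarrow> W \<subseteq> ?N \<Longrightarrow> \<mu> U < \<mu> W"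
    using insert.IH[OF S] by blast
  have N: "submodule ?N K V" by (rule V.mod_span_submodule[OF S])
  note Nf = submodule_facts[OF N]
  define H where "H = {c \<odot>\<^bsub>V\<^esub> s \<oplus>\<^bsub>V\<^esub> x | c x. c \<in> carrier K \<and> x \<in> ?N}"
  have "submodule H K V"
  proof (rule V.submodule_leftI)
    show "H \<subseteq> carrier V" using s Nf(1) by (auto simp: H_def)
    have "\<zero>\<^bsub>V\<^esub> = \<zero>\<^bsub>K\<^esub> \<odot>\<^bsub>V\<^esub> s \<oplus>\<^bsub>V\<^esub> \<zero>\<^bsub>V\<^esub>" using s by (simp add: V.smult_l_null)
    then show "\<zero>\<^bsub>V\<^esub> \<in> H" unfolding H_def using Nf(2) by blast
  next
    fix u v assume "u \<in> H" "v \<in> H"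
    then obtain a x b y where uv: "a \<in> carrier K" "x \<in> ?N" "b \<in> carrier K" "y \<in> ?N"
      "u = a \<odot>\<^bsub>V\<^esub> s \<oplus>\<^bsub>V\<^esub> x" "v = b \<odot>\<^bsub>V\<^esub> s \<oplus>\<^bsub>V\<^esub> y" by (auto simp: H_def)
    have "x \<in> carrier V" "y \<in> carrier V" using uv Nf(1) by auto
    then have "u \<oplus>\<^bsub>V\<^esub> v = (a \<oplus>\<^bsub>K\<^esub> b) \<odot>\<^bsub>V\<^esub> s \<oplus>\<^bsub>V\<^esub> (x \<oplus>\<^bsub>V\<^esub> y)"
      using uv s by (simp add: V.smult_l_distr V.M.a_ac)
    then show "u \<oplus>\<^bsub>V\<^esub> v \<in> H" unfolding H_def using uv Nf(3) K.a_closed by blast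
  next
    fix c u assume c: "c \<in> carrier K" and "u \<in> H"
    then obtain a x where u: "a \<in> carrier K" "x \<in> ?N" "u = a \<odot>\<^bsub>V\<^esub> s \<oplus>\<^bsub>V\<^esub> x"
      by (auto simp: H_def)
    have "x \<in> carrier V" using u Nf(1) by auto
    then have "c \<odot>\<^bsub>V\<^esub> u = (c \<otimes>\<^bsub>K\<^esub> a) \<odot>\<^bsub>V\<^esub> s \<oplus>\<^bsub>V\<^esub> c \<odot>\<^bsub>V\<^esub> x"
      using u s c by (simp add: V.smult_r_distr V.smult_assoc1)
    then show "c \<odot>\<^bsub>V\<^esub> u \<in> H" unfolding H_def using u c Nf(4) K.m_closed by blast
  qed
  moreover have "insert s S \<subseteq> H"
  proof -
    have "s = \<one>\<^bsub>K\<^esub> \<odot>\<^bsub>V\<^esub> s \<oplus>\<^bsub>V\<^esub> \<zero>\<^bsub>V\<^esub>" using s by simp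
    then have "s \<in> H" unfolding H_def using Nf(2) K.one_closed by blast
    moreover have "x \<in> H" if "x \<in> S" for x
    proof -
      have "x = \<zero>\<^bsub>K\<^esub> \<odot>\<^bsub>V\<^esub> s \<oplus>\<^bsub>V\<^esub> x" using s S that by (auto simp: V.smult_l_null)
      then show ?thesis unfolding H_def using that mod_span_subset[of S K V] K.zero_closed by blast
    qed
    ultimately show ?thesis by blast
  qed
  ultimately have sub: "mod_span K V (insert s S) \<subseteq> H" by (rule mod_span_least)
  define \<nu> where "\<nu> U = \<mu> (U \<inter> ?N) + (if U \<subseteq> ?N then 0 else 1)" for U
  have "\<nu> U < \<nu> W" if U: "submodule U K V" and W: "submodule W K V" and UW: "U \<subset> W"
    and WH: "W \<subseteq> mod_span K V (insert s S)" for U W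
  proof (cases "U \<inter> ?N = W \<inter> ?N")
    case False
    then have "\<mu> (U \<inter> ?N) < \<mu> (W \<inter> ?N)"
      using UW by (intro \<mu> submodule_Int[OF assms(2)] U W N) auto
    then show ?thesis using UW by (auto simp: \<nu>_def)
  next
    case eq: True
    have WN: "\<not> W \<subseteq> ?N" using eq UW by blast
    have "U \<subseteq> ?N"
    proof (rule ccontr)
      assume "\<not> U \<subseteq> ?N"
      then obtain u where u: "u \<in> U" "u \<notin> ?N" by blast
      have "u \<in> H" using u UW WH sub by blast
      then obtain d y where uy: "d \<in> carrier K" "y \<in> ?N" "u = d \<odot>\<^bsub>V\<^esub> s \<oplus>\<^bsub>V\<^esub> y" by (auto simp: H_def)
      have yV: "y \<in> carrier V" using uy Nf(1) by blast
      have d0: "d \<noteq> \<zero>\<^bsub>K\<^esub>" using u uy s yV by (auto simp: V.smult_l_null)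
      then have d: "d \<in> Units K" using K.field_Units uy by auto
      have uV: "u \<in> carrier V" using u submodule_facts(1)[OF U] by blast
      have "w \<in> U" if w: "w \<in> W" for w
      proof -
        have "w \<in> H" using w WH sub by blast
        then obtain c x where wx: "c \<in> carrier K" "x \<in> ?N" "w = c \<odot>\<^bsub>V\<^esub> s \<oplus>\<^bsub>V\<^esub> x" by (auto simp: H_def)
        have xV: "x \<in> carrier V" using wx Nf(1) by blast
        define e where "e = c \<otimes>\<^bsub>K\<^esub> inv\<^bsub>K\<^esub> d"
        have e: "e \<in> carrier K" using d wx by (auto simp: e_def)
        have ed: "e \<otimes>\<^bsub>K\<^esub> d = c" using d wx uy by (simp add: e_def K.m_assoc)
        have eu: "e \<odot>\<^bsub>V\<^esub> u = c \<odot>\<^bsub>V\<^esub> s \<oplus>\<^bsub>V\<^esub> e \<odot>\<^bsub>V\<^esub> y"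
          using uy e yV s ed by (simp add: V.smult_r_distr V.smult_assoc1[symmetric])
        have euU: "e \<odot>\<^bsub>V\<^esub> u \<in> U" using e u submodule_facts(4)[OF U] by blast
        have w_eq: "e \<odot>\<^bsub>V\<^esub> u \<oplus>\<^bsub>V\<^esub> (x \<ominus>\<^bsub>V\<^esub> e \<odot>\<^bsub>V\<^esub> y) = w"
          using V.M.add_minus_cancel[of "e \<odot>\<^bsub>V\<^esub> y" x] s e yV xV wx
          by (simp add: eu V.M.a_assoc)
        have xe: "x \<ominus>\<^bsub>V\<^esub> e \<odot>\<^bsub>V\<^esub> y \<in> ?N"
          using wx uy e Nf(4) by (intro submodule_minus[OF assms(2) N]) auto
        have closed: "x \<ominus>\<^bsub>V\<^esub> e \<odot>\<^bsub>V\<^esub> y \<in> carrier V" "e \<odot>\<^bsub>V\<^esub> u \<in> carrier V" "w \<in> carrier V"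
          using xe Nf(1) e uV submodule_facts(1)[OF W] w by auto
        have "x \<ominus>\<^bsub>V\<^esub> e \<odot>\<^bsub>V\<^esub> y = w \<ominus>\<^bsub>V\<^esub> e \<odot>\<^bsub>V\<^esub> u"
          by (rule V.M.add.l_cancel[OF _ closed(1) V.M.minus_closed[OF closed(3,2)] closed(2)])
            (simp add: w_eq V.M.add_minus_cancel[OF closed(2,3)])
        then have "x \<ominus>\<^bsub>V\<^esub> e \<odot>\<^bsub>V\<^esub> y \<in> W"
          using w euU UW submodule_minus[OF assms(2) W] by auto
        then have "x \<ominus>\<^bsub>V\<^esub> e \<odot>\<^bsub>V\<^esub> y \<in> U" using xe eq by blast
        then show "w \<in> U"
          using submodule_facts(3)[OF U euU] w_eq by metis
      qed
      then show False using UW by blast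
    qed
    then show ?thesis using WN eq by (simp add: \<nu>_def)
  qed
  then show ?case by blast
qed

context fin_dim_algebra
begin

definition restrict_scalars :: "('a, 'm) module \<Rightarrow> ('k, 'm) module"
  where "restrict_scalars M = \<lparr>carrier = carrier M, monoid.mult = undefined, one = undefined,
    ring.zero = \<zero>\<^bsub>M\<^esub>, add = add M, smult = (\<lambda>c x. (c \<odot>\<^bsub>A\<^esub> \<one>\<^bsub>A\<^esub>) \<odot>\<^bsub>M\<^esub> x)\<rparr>"

lemma left_module_restrict_scalars:
  assumes "left_module A M" shows "left_module K (restrict_scalars M)"
proof -
  interpret M: left_module A M by fact
  have "abelian_group (restrict_scalars M)"
  proof (rule abelian_groupI)
    fix x assume "x \<in> carrier (restrict_scalars M)"
    then show "\<exists>y\<in>carrier (restrict_scalars M). y \<oplus>\<^bsub>restrict_scalars M\<^esub> x = \<zero>\<^bsub>restrict_scalars M\<^esub>"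
      by (intro bexI[of _ "\<ominus>\<^bsub>M\<^esub> x"]) (auto simp: restrict_scalars_def M.M.l_neg)
  qed (auto simp: restrict_scalars_def M.M.a_ac)
  moreover have "(c \<otimes> d) \<odot>\<^bsub>A\<^esub> \<one>\<^bsub>A\<^esub> = (c \<odot>\<^bsub>A\<^esub> \<one>\<^bsub>A\<^esub>) \<otimes>\<^bsub>A\<^esub> (d \<odot>\<^bsub>A\<^esub> \<one>\<^bsub>A\<^esub>)"
    if "c \<in> carrier K" "d \<in> carrier K" for c d
    using that by (simp add: smult_mult_left KA.smult_assoc1)
  then have "left_module_axioms K (restrict_scalars M)"
    by (intro left_module_axioms.intro)
      (simp_all add: restrict_scalars_def KA.smult_l_distr M.smult_l_distr M.smult_r_distr M.smult_assoc1)
  ultimately show ?thesis by (intro left_module.intro K.ring_axioms)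
qed

lemma submodule_restrict_scalars:
  assumes "left_module A M" "submodule U A M" shows "submodule U K (restrict_scalars M)"
  using submodule_facts[OF assms(2)]
  by (intro left_module.submodule_leftI[OF left_module_restrict_scalars[OF assms(1)]])
    (auto simp: restrict_scalars_def)

lemma finitely_generated_restrict_scalars:
  assumes "fg_module A M" shows "finitely_generated K (restrict_scalars M)"
proof -
  have lm: "left_module A M" using assms by (simp add: fg_module_def)
  interpret M: left_module A M by (rule lm)
  interpret KM: left_module K "restrict_scalars M" by (rule left_module_restrict_scalars[OF lm])
  obtain S where S: "finite S" "S \<subseteq> carrier M" "mod_span A M S = carrier M"
    using assms unfolding fg_module_def finitely_generated_def by blast
  obtain T where T: "finite T" "T \<subseteq> carrier A" "mod_span K A T = carrier A"
    using finite_dimensional unfolding finitely_generated_def by blast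
  let ?G = "(\<lambda>(t, s). t \<odot>\<^bsub>M\<^esub> s) ` (T \<times> S)"
  let ?W = "mod_span K (restrict_scalars M) ?G"
  have G: "?G \<subseteq> carrier (restrict_scalars M)" using S T by (auto simp: restrict_scalars_def)
  have W: "submodule ?W K (restrict_scalars M)" by (rule KM.mod_span_submodule[OF G])
  note Wf = submodule_facts[OF W]
  have sW: "(c \<odot>\<^bsub>A\<^esub> \<one>\<^bsub>A\<^esub>) \<odot>\<^bsub>M\<^esub> x \<in> ?W" if "c \<in> carrier K" "x \<in> ?W" for c x
    using Wf(4)[OF that] by (simp add: restrict_scalars_def)
  have aW: "x \<oplus>\<^bsub>M\<^esub> y \<in> ?W" if "x \<in> ?W" "y \<in> ?W" for x y
    using Wf(3)[OF that] by (simp add: restrict_scalars_def)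
  have zW: "\<zero>\<^bsub>M\<^esub> \<in> ?W" using Wf(2) by (simp add: restrict_scalars_def)
  have s: "a \<odot>\<^bsub>M\<^esub> s \<in> ?W" if "a \<in> carrier A" "s \<in> S" for a s
  proof -
    have sM: "s \<in> carrier M" using S that by blast
    have "submodule {b \<in> carrier A. b \<odot>\<^bsub>M\<^esub> s \<in> ?W} K A"
    proof (rule left_module.submodule_leftI[OF KA.left_module])
      show "\<zero>\<^bsub>A\<^esub> \<in> {b \<in> carrier A. b \<odot>\<^bsub>M\<^esub> s \<in> ?W}" using sM zW by (simp add: M.smult_l_null)
      fix c b assume "c \<in> carrier K" "b \<in> {b \<in> carrier A. b \<odot>\<^bsub>M\<^esub> s \<in> ?W}"
      then show "c \<odot>\<^bsub>A\<^esub> b \<in> {b \<in> carrier A. b \<odot>\<^bsub>M\<^esub> s \<in> ?W}"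
        using sW[of c "b \<odot>\<^bsub>M\<^esub> s"] sM
        by (simp add: M.smult_assoc1[symmetric] smult_mult_left)
    qed (use sM aW in \<open>auto simp: M.smult_l_distr\<close>)
    then have "mod_span K A T \<subseteq> {b \<in> carrier A. b \<odot>\<^bsub>M\<^esub> s \<in> ?W}"
      using T that mod_span_subset[of ?G K "restrict_scalars M"] by (intro mod_span_least) auto
    then show ?thesis using T that by blast
  qed
  have "submodule {x \<in> carrier M. \<forall>a\<in>carrier A. a \<odot>\<^bsub>M\<^esub> x \<in> ?W} A M"
    using aW zW by (intro M.submodule_leftI)
      (auto simp: M.smult_r_null M.smult_r_distr M.smult_assoc1[symmetric])
  then have "mod_span A M S \<subseteq> {x \<in> carrier M. \<forall>a\<in>carrier A. a \<odot>\<^bsub>M\<^esub> x \<in> ?W}"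
    using S s by (intro mod_span_least) auto
  then have "x \<in> ?W" if "x \<in> carrier M" for x
    using that S M.smult_one[OF that] A.one_closed by (metis (mono_tags, lifting) mem_Collect_eq subsetD)
  then have "?W = carrier (restrict_scalars M)" using Wf(1) by (auto simp: restrict_scalars_def)
  then show ?thesis unfolding finitely_generated_def
    using G S(1) T(1) by (intro exI[of _ ?G] conjI finite_imageI finite_cartesian_product)
qed

text \<open>Only strict monotonicity matters below; the vector space dimension of a submodule is one
  such function.\<close>

lemma length_function:
  fixes M :: "('a, 'm) module"
  assumes "fg_module A M"
  shows "\<exists>\<mu> :: 'm set \<Rightarrow> nat. \<forall>U V. submodule U A M \<and> submodule V A M \<and> U \<subset> V \<longrightarrow> \<mu> U < \<mu> V"
proof -
  have lm: "left_module A M" using assms by (simp add: fg_module_def)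
  obtain S where S: "finite S" "S \<subseteq> carrier (restrict_scalars M)" "mod_span K (restrict_scalars M) S = carrier (restrict_scalars M)"
    using finitely_generated_restrict_scalars[OF assms] unfolding finitely_generated_def by blast
  obtain \<mu> :: "'m set \<Rightarrow> nat" where \<mu>: "\<And>U W. submodule U K (restrict_scalars M) \<Longrightarrow> submodule W K (restrict_scalars M)
      \<Longrightarrow> U \<subset> W \<Longrightarrow> W \<subseteq> carrier (restrict_scalars M) \<Longrightarrow> \<mu> U < \<mu> W"
    using vector_space_rank_function[OF K.field_axioms left_module_restrict_scalars[OF lm] S(1,2)] S(3) by metis
  then show ?thesis
    using submodule_restrict_scalars[OF lm] submodule_facts(1) by (metis (no_types, lifting))
qed

lemma length_bound:
  assumes \<mu>: "\<forall>U V. submodule U A M \<and> submodule V A M \<and> U \<subset> V \<longrightarrow> \<mu> U < (\<mu> V :: nat)"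
    and lm: "left_module A M" and U: "submodule U A M"
  shows "\<mu> U \<le> \<mu> (carrier M)"
proof (cases "U = carrier M")
  case False
  then have "U \<subset> carrier M" using submodule_facts(1)[OF U] by blast
  then show ?thesis using \<mu> U submodule_carrier[OF lm] less_imp_le by blast
qed simp

text \<open>A finitely generated submodule of \<open>U\<close> of maximal length is all of \<open>U\<close>.\<close>

lemma fg_submodule:
  fixes M :: "('a, 'm) module"
  assumes fg: "fg_module A M" and U: "submodule U A M"
  shows "fg_module A (M\<lparr>carrier := U\<rparr>)"
proof -
  have lm: "left_module A M" using fg by (rule fg_left_module)
  interpret M: left_module A M by (rule lm)
  note Uf = submodule_facts[OF U]
  obtain \<mu> :: "'m set \<Rightarrow> nat"
    where \<mu>: "\<forall>U V. submodule U A M \<and> submodule V A M \<and> U \<subset> V \<longrightarrow> \<mu> U < \<mu> V"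
    using length_function[OF fg] by blast
  have sub: "submodule (mod_span A M S) A M" if "S \<subseteq> U" for S
    using that Uf(1) by (intro M.mod_span_submodule) blast
  have "\<exists>S. (finite S \<and> S \<subseteq> U) \<and> (\<forall>T. finite T \<and> T \<subseteq> U \<longrightarrow> \<mu> (mod_span A M T) \<le> \<mu> (mod_span A M S))"
  proof (rule ex_has_greatest_nat[where P = "\<lambda>S. finite S \<and> S \<subseteq> U" and f = "\<lambda>S. \<mu> (mod_span A M S)"])
    show "finite {} \<and> {} \<subseteq> U" by simp
    show "\<forall>T. finite T \<and> T \<subseteq> U \<longrightarrow> \<mu> (mod_span A M T) < Suc (\<mu> (carrier M))"
      using length_bound[OF \<mu> lm sub] by (simp add: less_Suc_eq_le)
  qed
  then obtain S where S: "finite S" "S \<subseteq> U"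
    and max: "\<And>T. finite T \<Longrightarrow> T \<subseteq> U \<Longrightarrow> \<mu> (mod_span A M T) \<le> \<mu> (mod_span A M S)" by blast
  have "x \<in> mod_span A M S" if x: "x \<in> U" for x
  proof (rule ccontr)
    assume n: "x \<notin> mod_span A M S"
    have i: "insert x S \<subseteq> U" using x S by blast
    have "mod_span A M S \<subseteq> mod_span A M (insert x S)"
      using mod_span_subset[of "insert x S" A M] by (intro mod_span_least sub i) blast
    then have "mod_span A M S \<subset> mod_span A M (insert x S)"
      using n mod_span_subset[of "insert x S" A M] by blast
    then have "\<mu> (mod_span A M S) < \<mu> (mod_span A M (insert x S))"
      using \<mu> sub[OF S(2)] sub[OF i] by blast
    then show False using max[of "insert x S"] S i by simp
  qed
  then have sp: "U \<subseteq> mod_span A M S" by blast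
  have lmU: "left_module A (M\<lparr>carrier := U\<rparr>)" by (rule left_module_submodule[OF lm U])
  have "mod_span A (M\<lparr>carrier := U\<rparr>) S = U"
  proof
    show "mod_span A (M\<lparr>carrier := U\<rparr>) S \<subseteq> U"
      using mod_span_least[OF submodule_carrier[OF lmU], of S] S by simp
    have "U \<subseteq> V" if "submodule V A (M\<lparr>carrier := U\<rparr>)" "S \<subseteq> V" for V
      using that sp mod_span_least[of V A M S] by (simp add: submodule_sub_iff[OF lm U])
    then show "U \<subseteq> mod_span A (M\<lparr>carrier := U\<rparr>) S" unfolding mod_span_def by blast
  qed
  then show ?thesis
    unfolding fg_module_def finitely_generated_def using lmU S by (intro conjI exI[of _ S]) auto
qed

end

section \<open>Quotients and direct sums\<close>

text \<open>The quotient is carried by representatives, so that it is a module on the same type.\<close>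

lemma ex_quotient_module:
  fixes M :: "('a, 'm) module"
  assumes lm: "left_module R M" and U: "submodule U R M"
  shows "\<exists>N :: ('a, 'm) module. left_module R N \<and> (\<exists>q\<in>mod_hom R M N. q ` carrier M = carrier N \<and>
    (\<forall>x\<in>carrier M. q x = \<zero>\<^bsub>N\<^esub> \<longleftrightarrow> x \<in> U))"
proof -
  interpret M: left_module R M by fact
  note s = submodule_facts[OF U]
  have s1: "x \<in> carrier M" if "x \<in> U" for x using s(1) that by blast
  define r where "r x = (SOME y. y \<in> carrier M \<and> y \<ominus>\<^bsub>M\<^esub> x \<in> U)" for x
  have r: "r x \<in> carrier M \<and> r x \<ominus>\<^bsub>M\<^esub> x \<in> U" if "x \<in> carrier M" for x
    unfolding r_def using that s(2)
    by (intro someI[of "\<lambda>y. y \<in> carrier M \<and> y \<ominus>\<^bsub>M\<^esub> x \<in> U" x]) (simp add: a_minus_def M.M.r_neg)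
  have neg: "\<ominus>\<^bsub>M\<^esub> u \<in> U" if "u \<in> U" for u
    using submodule_minus[OF lm U s(2) that] s1[OF that] by (simp add: a_minus_def)
  have req: "r (x \<oplus>\<^bsub>M\<^esub> u) = r x" if x: "x \<in> carrier M" and u: "u \<in> U" for x u
  proof -
    have "y \<ominus>\<^bsub>M\<^esub> (x \<oplus>\<^bsub>M\<^esub> u) \<in> U \<longleftrightarrow> y \<ominus>\<^bsub>M\<^esub> x \<in> U" if y: "y \<in> carrier M" for y
    proof -
      have a: "y \<ominus>\<^bsub>M\<^esub> (x \<oplus>\<^bsub>M\<^esub> u) = (y \<ominus>\<^bsub>M\<^esub> x) \<oplus>\<^bsub>M\<^esub> \<ominus>\<^bsub>M\<^esub> u"
        using x y s1[OF u] by (simp add: a_minus_def M.M.minus_add M.M.a_assoc)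
      have b: "y \<ominus>\<^bsub>M\<^esub> x = (y \<ominus>\<^bsub>M\<^esub> (x \<oplus>\<^bsub>M\<^esub> u)) \<oplus>\<^bsub>M\<^esub> u"
        using x y s1[OF u] unfolding a by (simp add: M.M.a_assoc M.M.l_neg)
      show ?thesis
      proof
        assume "y \<ominus>\<^bsub>M\<^esub> (x \<oplus>\<^bsub>M\<^esub> u) \<in> U"
        from s(3)[OF this u] show "y \<ominus>\<^bsub>M\<^esub> x \<in> U" using b by simp
      next
        assume "y \<ominus>\<^bsub>M\<^esub> x \<in> U"
        from s(3)[OF this neg[OF u]] show "y \<ominus>\<^bsub>M\<^esub> (x \<oplus>\<^bsub>M\<^esub> u) \<in> U" using a by simp
      qed
    qed
    then have "(\<lambda>y. y \<in> carrier M \<and> y \<ominus>\<^bsub>M\<^esub> (x \<oplus>\<^bsub>M\<^esub> u) \<in> U) = (\<lambda>y. y \<in> carrier M \<and> y \<ominus>\<^bsub>M\<^esub> x \<in> U)"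
      by blast
    then show ?thesis unfolding r_def by presburger
  qed
  have rx: "\<exists>u\<in>U. r x = x \<oplus>\<^bsub>M\<^esub> u" if "x \<in> carrier M" for x
    using r[OF that] M.M.add_minus_cancel[OF that, of "r x"] by metis
  have radd: "r (r x \<oplus>\<^bsub>M\<^esub> r y) = r (x \<oplus>\<^bsub>M\<^esub> y)" if "x \<in> carrier M" "y \<in> carrier M" for x y
  proof -
    from rx[OF that(1)] obtain u where u: "u \<in> U" "r x = x \<oplus>\<^bsub>M\<^esub> u" by blast
    from rx[OF that(2)] obtain v where v: "v \<in> U" "r y = y \<oplus>\<^bsub>M\<^esub> v" by blast
    have "r x \<oplus>\<^bsub>M\<^esub> r y = (x \<oplus>\<^bsub>M\<^esub> y) \<oplus>\<^bsub>M\<^esub> (u \<oplus>\<^bsub>M\<^esub> v)"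
      using that u v s1 by (simp add: M.M.a_ac)
    then show ?thesis using req[of "x \<oplus>\<^bsub>M\<^esub> y" "u \<oplus>\<^bsub>M\<^esub> v"] that u v s(3) by simp
  qed
  have rsm: "r (a \<odot>\<^bsub>M\<^esub> r x) = r (a \<odot>\<^bsub>M\<^esub> x)" if "x \<in> carrier M" "a \<in> carrier R" for x a
  proof -
    from rx[OF that(1)] obtain u where u: "u \<in> U" "r x = x \<oplus>\<^bsub>M\<^esub> u" by blast
    have "a \<odot>\<^bsub>M\<^esub> r x = a \<odot>\<^bsub>M\<^esub> x \<oplus>\<^bsub>M\<^esub> a \<odot>\<^bsub>M\<^esub> u"
      using that u s1 by (simp add: M.smult_r_distr)
    then show ?thesis using req[of "a \<odot>\<^bsub>M\<^esub> x" "a \<odot>\<^bsub>M\<^esub> u"] that u s(4) by simp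
  qed
  define N :: "('a, 'm) module" where "N = \<lparr>carrier = r ` carrier M, monoid.mult = undefined,
    one = undefined, ring.zero = r \<zero>\<^bsub>M\<^esub>, add = (\<lambda>x y. r (x \<oplus>\<^bsub>M\<^esub> y)), smult = (\<lambda>a x. r (a \<odot>\<^bsub>M\<^esub> x))\<rparr>"
  have Nc: "carrier N = r ` carrier M" and N0: "\<zero>\<^bsub>N\<^esub> = r \<zero>\<^bsub>M\<^esub>"
    by (simp_all add: N_def)
  have Nadd: "r x \<oplus>\<^bsub>N\<^esub> r y = r (x \<oplus>\<^bsub>M\<^esub> y)" if "x \<in> carrier M" "y \<in> carrier M" for x y
    using radd[OF that] by (simp add: N_def)
  have Nsm: "a \<odot>\<^bsub>N\<^esub> r x = r (a \<odot>\<^bsub>M\<^esub> x)" if "a \<in> carrier R" "x \<in> carrier M" for a x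
    using rsm[OF that(2,1)] by (simp add: N_def)
  have "abelian_group N"
  proof (rule abelian_groupI)
    fix x assume "x \<in> carrier N"
    then obtain u where "u \<in> carrier M" "x = r u" by (auto simp: Nc)
    then show "\<exists>y\<in>carrier N. y \<oplus>\<^bsub>N\<^esub> x = \<zero>\<^bsub>N\<^esub>"
      by (intro bexI[of _ "r (\<ominus>\<^bsub>M\<^esub> u)"]) (auto simp: Nadd Nc N0 M.M.l_neg)
  qed (auto simp: Nadd Nc N0 M.M.a_ac)
  moreover have "left_module_axioms R N"
  proof (rule left_module_axioms.intro, goal_cases)
    case (1 a x) then show ?case by (auto simp: Nc Nsm)
  next
    case (2 a b x) then show ?case by (auto simp: Nc Nsm Nadd M.smult_l_distr)
  next
    case (3 a x y) then show ?case by (auto simp: Nc Nsm Nadd M.smult_r_distr)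
  next
    case (4 a b x) then show ?case by (auto simp: Nc Nsm M.smult_assoc1)
  next
    case (5 x) then show ?case by (auto simp: Nc Nsm)
  qed
  ultimately have "left_module R N" by (intro left_module.intro M.R.ring_axioms)
  moreover have "r \<in> mod_hom R M N" by (rule mod_homI) (auto simp: Nc Nadd Nsm)
  moreover have "r x = \<zero>\<^bsub>N\<^esub> \<longleftrightarrow> x \<in> U" if x: "x \<in> carrier M" for x
  proof
    assume "x \<in> U"
    then show "r x = \<zero>\<^bsub>N\<^esub>" using req[OF M.M.zero_closed, of x] x by (simp add: N0)
  next
    assume "r x = \<zero>\<^bsub>N\<^esub>"
    then have e: "r x = r \<zero>\<^bsub>M\<^esub>" by (simp add: N0)
    from rx[OF x] obtain u where u: "u \<in> U" "r x = x \<oplus>\<^bsub>M\<^esub> u" by blast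
    from rx[OF M.M.zero_closed] obtain v where v: "v \<in> U" "r \<zero>\<^bsub>M\<^esub> = \<zero>\<^bsub>M\<^esub> \<oplus>\<^bsub>M\<^esub> v" by blast
    have "x \<oplus>\<^bsub>M\<^esub> u = v" using e u v s1 by simp
    moreover have "(x \<oplus>\<^bsub>M\<^esub> u) \<oplus>\<^bsub>M\<^esub> \<ominus>\<^bsub>M\<^esub> u = x"
      using x s1[OF u(1)] by (simp add: M.M.a_assoc M.M.r_neg)
    ultimately show "x \<in> U" using s(3)[OF v(1) neg[OF u(1)]] by simp
  qed
  ultimately show ?thesis using Nc by blast
qed

lemma fg_module_image:
  assumes "fg_module R M" "left_module R N" "f \<in> mod_hom R M N" "f ` carrier M = carrier N"
  shows "fg_module R N"
proof -
  have lm: "left_module R M" using assms(1) by (rule fg_left_module)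
  from assms(1) obtain S where S: "finite S" "S \<subseteq> carrier M" "mod_span R M S = carrier M"
    unfolding fg_module_def finitely_generated_def by blast
  have fS: "f ` S \<subseteq> carrier N" using S(2) assms(4) by blast
  have "carrier N \<subseteq> U" if U: "submodule U R N" "f ` S \<subseteq> U" for U
  proof -
    have "mod_span R M S \<subseteq> {x \<in> carrier M. f x \<in> U}"
      using S(2) U by (intro mod_span_least submodule_vimage[OF lm assms(2,3) U(1)]) auto
    then have "f ` carrier M \<subseteq> U" unfolding S(3) by blast
    then show ?thesis unfolding assms(4) .
  qed
  then have "carrier N \<subseteq> mod_span R N (f ` S)" unfolding mod_span_def by blast
  moreover have "mod_span R N (f ` S) \<subseteq> carrier N"
    by (rule mod_span_least[OF submodule_carrier[OF assms(2)] fS])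
  ultimately show ?thesis
    unfolding fg_module_def finitely_generated_def using assms(2) S(1) fS
    by (intro conjI exI[of _ "f ` S"] equalityI finite_imageI)
qed

text \<open>Interleaving encodes a pair of sequences as one sequence, so direct sums of modules carried by
  sequences are again carried by sequences.\<close>

definition dpair :: "(nat \<Rightarrow> 'k) \<Rightarrow> (nat \<Rightarrow> 'k) \<Rightarrow> nat \<Rightarrow> 'k"
  where "dpair f g = (\<lambda>n. if even n then f (n div 2) else g (n div 2))"

definition dfst :: "(nat \<Rightarrow> 'k) \<Rightarrow> nat \<Rightarrow> 'k" where "dfst h = (\<lambda>i. h (2 * i))"

definition dsnd :: "(nat \<Rightarrow> 'k) \<Rightarrow> nat \<Rightarrow> 'k" where "dsnd h = (\<lambda>i. h (2 * i + 1))"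

lemma dfst_dpair [simp]: "dfst (dpair f g) = f" and dsnd_dpair [simp]: "dsnd (dpair f g) = g"
  by (auto simp: dfst_def dsnd_def dpair_def)

lemma dpair_dfst_dsnd [simp]: "dpair (dfst h) (dsnd h) = h"
  by (auto simp: dfst_def dsnd_def dpair_def fun_eq_iff elim!: evenE oddE)

lemma dpair_eq_iff [simp]: "dpair f g = dpair f' g' \<longleftrightarrow> f = f' \<and> g = g'"
  by (metis dfst_dpair dsnd_dpair)

definition direct_sum :: "('a, nat \<Rightarrow> 'k) module \<Rightarrow> ('a, nat \<Rightarrow> 'k) module \<Rightarrow> ('a, nat \<Rightarrow> 'k) module"
  where "direct_sum M N = \<lparr>carrier = {h. dfst h \<in> carrier M \<and> dsnd h \<in> carrier N},
    monoid.mult = undefined, one = undefined, ring.zero = dpair \<zero>\<^bsub>M\<^esub> \<zero>\<^bsub>N\<^esub>,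
    add = (\<lambda>x y. dpair (dfst x \<oplus>\<^bsub>M\<^esub> dfst y) (dsnd x \<oplus>\<^bsub>N\<^esub> dsnd y)),
    smult = (\<lambda>a x. dpair (a \<odot>\<^bsub>M\<^esub> dfst x) (a \<odot>\<^bsub>N\<^esub> dsnd x))\<rparr>"

lemma direct_sum_simps [simp]:
  "h \<in> carrier (direct_sum M N) \<longleftrightarrow> dfst h \<in> carrier M \<and> dsnd h \<in> carrier N"
  "\<zero>\<^bsub>direct_sum M N\<^esub> = dpair \<zero>\<^bsub>M\<^esub> \<zero>\<^bsub>N\<^esub>"
  "x \<oplus>\<^bsub>direct_sum M N\<^esub> y = dpair (dfst x \<oplus>\<^bsub>M\<^esub> dfst y) (dsnd x \<oplus>\<^bsub>N\<^esub> dsnd y)"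
  "a \<odot>\<^bsub>direct_sum M N\<^esub> x = dpair (a \<odot>\<^bsub>M\<^esub> dfst x) (a \<odot>\<^bsub>N\<^esub> dsnd x)"
  by (simp_all add: direct_sum_def)

lemma left_module_direct_sum:
  assumes "left_module R M" "left_module R N" shows "left_module R (direct_sum M N)"
proof -
  interpret M: left_module R M by fact
  interpret N: left_module R N by fact
  have "abelian_group (direct_sum M N)"
  proof (rule abelian_groupI)
    fix x assume "x \<in> carrier (direct_sum M N)"
    then show "\<exists>y\<in>carrier (direct_sum M N). y \<oplus>\<^bsub>direct_sum M N\<^esub> x = \<zero>\<^bsub>direct_sum M N\<^esub>"
      by (intro bexI[of _ "dpair (\<ominus>\<^bsub>M\<^esub> dfst x) (\<ominus>\<^bsub>N\<^esub> dsnd x)"]) (auto simp: M.M.l_neg N.M.l_neg)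
  qed (auto simp: M.M.a_ac N.M.a_ac)
  moreover have "left_module_axioms R (direct_sum M N)"
    by (rule left_module_axioms.intro) (auto simp: M.smult_l_distr M.smult_r_distr M.smult_assoc1
        N.smult_l_distr N.smult_r_distr N.smult_assoc1)
  ultimately show ?thesis by (intro left_module.intro M.R.ring_axioms)
qed

lemma mod_hom_dfst: "dfst \<in> mod_hom R (direct_sum M N) M"
  and mod_hom_dsnd: "dsnd \<in> mod_hom R (direct_sum M N) N"
  by (auto intro!: mod_homI)

lemma mod_hom_dpair:
  "f \<in> mod_hom R L M \<Longrightarrow> g \<in> mod_hom R L N \<Longrightarrow> (\<lambda>x. dpair (f x) (g x)) \<in> mod_hom R L (direct_sum M N)"
  by (auto simp: mod_hom_def Pi_iff)

lemma mod_hom_copair: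
  assumes "left_module R L" "f \<in> mod_hom R M L" "g \<in> mod_hom R N L"
  shows "(\<lambda>x. f (dfst x) \<oplus>\<^bsub>L\<^esub> g (dsnd x)) \<in> mod_hom R (direct_sum M N) L"
  by (intro mod_hom_plus assms mod_hom_compose[OF mod_hom_dfst] mod_hom_compose[OF mod_hom_dsnd])

lemma fg_module_direct_sum:
  assumes "fg_module R M" "fg_module R N" shows "fg_module R (direct_sum M N)"
proof -
  have lm: "left_module R M" "left_module R N" using assms by (auto intro: fg_left_module)
  interpret M: left_module R M by fact
  interpret N: left_module R N by fact
  have lms: "left_module R (direct_sum M N)" by (rule left_module_direct_sum[OF lm])
  from assms(1) obtain S where S: "finite S" "S \<subseteq> carrier M" "mod_span R M S = carrier M"
    unfolding fg_module_def finitely_generated_def by blast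
  from assms(2) obtain T where T: "finite T" "T \<subseteq> carrier N" "mod_span R N T = carrier N"
    unfolding fg_module_def finitely_generated_def by blast
  let ?i = "\<lambda>x. dpair x \<zero>\<^bsub>N\<^esub>" and ?j = "\<lambda>y. dpair \<zero>\<^bsub>M\<^esub> y"
  have i: "?i \<in> mod_hom R M (direct_sum M N)" by (rule mod_hom_dpair[OF mod_hom_id mod_hom_zero_map[OF lm(2)]])
  have j: "?j \<in> mod_hom R N (direct_sum M N)" by (rule mod_hom_dpair[OF mod_hom_zero_map[OF lm(1)] mod_hom_id])
  let ?G = "?i ` S \<union> ?j ` T"
  have G: "?G \<subseteq> carrier (direct_sum M N)" using S(2) T(2) by auto
  have "h \<in> U" if U: "submodule U R (direct_sum M N)" "?G \<subseteq> U" and h: "h \<in> carrier (direct_sum M N)" for U h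
  proof -
    have "mod_span R M S \<subseteq> {x \<in> carrier M. ?i x \<in> U}"
      using S(2) U by (intro mod_span_least submodule_vimage[OF lm(1) lms i U(1)]) auto
    then have 1: "?i (dfst h) \<in> U" using S(3) h by auto
    have "mod_span R N T \<subseteq> {y \<in> carrier N. ?j y \<in> U}"
      using T(2) U by (intro mod_span_least submodule_vimage[OF lm(2) lms j U(1)]) auto
    then have 2: "?j (dsnd h) \<in> U" using T(3) h by auto
    show ?thesis using submodule_facts(3)[OF U(1) 1 2] h by simp
  qed
  then have "carrier (direct_sum M N) \<subseteq> mod_span R (direct_sum M N) ?G" unfolding mod_span_def by blast
  moreover have "mod_span R (direct_sum M N) ?G \<subseteq> carrier (direct_sum M N)"
    by (rule mod_span_least[OF submodule_carrier[OF lms] G])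
  ultimately show ?thesis
    unfolding fg_module_def finitely_generated_def using lms S(1) T(1) G
    by (intro conjI exI[of _ ?G]) auto
qed

section \<open>Direct summands and indecomposable modules\<close>

definition summand :: "('a, 'c) ring_scheme \<Rightarrow> ('a, 'm, 'd) module_scheme \<Rightarrow> ('a, 'n, 'e) module_scheme \<Rightarrow> bool"
  where "summand R Z Y \<longleftrightarrow>
    (\<exists>i\<in>mod_hom R Z Y. \<exists>p\<in>mod_hom R Y Z. \<forall>x\<in>carrier Z. p (i x) = x)"

lemma summandI:
  "i \<in> mod_hom R Z Y \<Longrightarrow> p \<in> mod_hom R Y Z \<Longrightarrow> (\<And>x. x \<in> carrier Z \<Longrightarrow> p (i x) = x) \<Longrightarrow> summand R Z Y"
  by (auto simp: summand_def)

lemma summand_refl: "summand R Z Z"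
  by (rule summandI[OF mod_hom_id mod_hom_id]) auto

lemma summand_trans:
  assumes "summand R Z Y" "summand R Y W" shows "summand R Z W"
proof -
  from assms(1) obtain i p where 1: "i \<in> mod_hom R Z Y" "p \<in> mod_hom R Y Z" "\<forall>x\<in>carrier Z. p (i x) = x"
    by (auto simp: summand_def)
  from assms(2) obtain j q where 2: "j \<in> mod_hom R Y W" "q \<in> mod_hom R W Y" "\<forall>x\<in>carrier Y. q (j x) = x"
    by (auto simp: summand_def)
  show ?thesis
    by (rule summandI[OF mod_hom_compose[OF 1(1) 2(1)] mod_hom_compose[OF 2(2) 1(2)]])
      (use 1 2 mod_hom_closed[OF 1(1)] in auto)
qed

lemma summand_of_iso:
  assumes "left_module R M" "f \<in> mod_hom R M N" "bij_betw f (carrier M) (carrier N)"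
  shows "summand R M N" "summand R N M"
  using mod_hom_inv[OF assms] assms(2,3)
  by (auto intro!: summandI simp: bij_betw_def f_inv_into_f)

text \<open>An automorphism of \<open>M\<close> that factors through \<open>Y\<close> splits \<open>M\<close> off \<open>Y\<close>.\<close>

lemma summand_of_bij_comp:
  assumes "left_module R M" "a \<in> mod_hom R M Y" "b \<in> mod_hom R Y M"
    and "bij_betw (\<lambda>x. b (a x)) (carrier M) (carrier M)"
  shows "summand R M Y"
proof -
  let ?c = "inv_into (carrier M) (\<lambda>x. b (a x))"
  have "?c \<in> mod_hom R M M"
    by (rule mod_hom_inv[OF assms(1) mod_hom_compose[OF assms(2,3)] assms(4)])
  then show ?thesis
    using inv_into_f_f[OF bij_betw_imp_inj_on[OF assms(4)]]
    by (intro summandI[OF assms(2) mod_hom_compose[OF assms(3)]]) auto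
qed

lemma set_add_iff: "z \<in> U <+>\<^bsub>M\<^esub> V \<longleftrightarrow> (\<exists>u\<in>U. \<exists>v\<in>V. z = u \<oplus>\<^bsub>M\<^esub> v)"
  by (auto simp: set_add_def')

lemma internal_direct_sum_projections:
  assumes lm: "left_module R M" and U: "submodule U R M" and V: "submodule V R M"
    and int: "U \<inter> V = {\<zero>\<^bsub>M\<^esub>}" and sum: "U <+>\<^bsub>M\<^esub> V = carrier M"
  shows "\<exists>p\<in>mod_hom R M (M\<lparr>carrier := U\<rparr>). \<exists>q\<in>mod_hom R M (M\<lparr>carrier := V\<rparr>).
    \<forall>x\<in>carrier M. x = p x \<oplus>\<^bsub>M\<^esub> q x"
proof -
  interpret M: left_module R M by fact
  note u = submodule_facts[OF U] and v = submodule_facts[OF V]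
  have uc: "x \<in> carrier M" if "x \<in> U" for x using u(1) that by blast
  have vc: "x \<in> carrier M" if "x \<in> V" for x using v(1) that by blast
  have uniq: "a = a' \<and> b = b'" if "a \<in> U" "a' \<in> U" "b \<in> V" "b' \<in> V" "a \<oplus>\<^bsub>M\<^esub> b = a' \<oplus>\<^bsub>M\<^esub> b'" for a a' b b'
  proof -
    note c = uc[OF that(1)] uc[OF that(2)] vc[OF that(3)] vc[OF that(4)]
    have cancel: "(x \<oplus>\<^bsub>M\<^esub> z) \<ominus>\<^bsub>M\<^esub> (y \<oplus>\<^bsub>M\<^esub> z) = x \<ominus>\<^bsub>M\<^esub> y"
      if c: "x \<in> carrier M" "y \<in> carrier M" "z \<in> carrier M" for x y z
    proof -
      have "(x \<oplus>\<^bsub>M\<^esub> z) \<ominus>\<^bsub>M\<^esub> (y \<oplus>\<^bsub>M\<^esub> z) = x \<oplus>\<^bsub>M\<^esub> ((z \<oplus>\<^bsub>M\<^esub> \<ominus>\<^bsub>M\<^esub> z) \<oplus>\<^bsub>M\<^esub> \<ominus>\<^bsub>M\<^esub> y)"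
        using c by (simp only: a_minus_def M.M.minus_add) (simp add: M.M.a_ac)
      then show ?thesis using c by (simp add: a_minus_def M.M.r_neg)
    qed
    have "a \<ominus>\<^bsub>M\<^esub> a' = (a \<oplus>\<^bsub>M\<^esub> b) \<ominus>\<^bsub>M\<^esub> (a' \<oplus>\<^bsub>M\<^esub> b)"
      using c cancel by simp
    also have "\<dots> = (b' \<oplus>\<^bsub>M\<^esub> a') \<ominus>\<^bsub>M\<^esub> (b \<oplus>\<^bsub>M\<^esub> a')"
      unfolding that(5) using c by (simp add: M.M.a_comm)
    also have "\<dots> = b' \<ominus>\<^bsub>M\<^esub> b" using c cancel by simp
    finally have "a \<ominus>\<^bsub>M\<^esub> a' \<in> U \<inter> V"
      using submodule_minus[OF lm U that(1,2)] submodule_minus[OF lm V that(4,3)] by simp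
    then have "a \<ominus>\<^bsub>M\<^esub> a' = \<zero>\<^bsub>M\<^esub>" using int by blast
    then have "a = a'" using c by (simp add: M.M.minus_eq_zero_iff)
    then show ?thesis using that(5) c by simp
  qed
  define P where "P x z \<longleftrightarrow> fst z \<in> U \<and> snd z \<in> V \<and> x = fst z \<oplus>\<^bsub>M\<^esub> snd z" for x z
  have ex: "\<exists>z. P x z" if "x \<in> carrier M" for x
  proof -
    have "x \<in> U <+>\<^bsub>M\<^esub> V" using that sum by simp
    then show ?thesis unfolding set_add_iff P_def by auto
  qed
  define z where "z x = (SOME z. P x z)" for x
  have z: "fst (z x) \<in> U \<and> snd (z x) \<in> V \<and> x = fst (z x) \<oplus>\<^bsub>M\<^esub> snd (z x)" if "x \<in> carrier M" for x
  proof -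
    have "P x (z x)" unfolding z_def by (rule someI_ex[OF ex[OF that]])
    then show ?thesis unfolding P_def .
  qed
  have zu: "fst (z x) = a \<and> snd (z x) = b" if "a \<in> U" "b \<in> V" "x = a \<oplus>\<^bsub>M\<^esub> b" for x a b
  proof -
    have "x \<in> carrier M" using that uc vc by auto
    note zx = z[OF this]
    show ?thesis using uniq[of "fst (z x)" a "snd (z x)" b] zx that by simp
  qed
  have zadd: "fst (z (x \<oplus>\<^bsub>M\<^esub> y)) = fst (z x) \<oplus>\<^bsub>M\<^esub> fst (z y) \<and> snd (z (x \<oplus>\<^bsub>M\<^esub> y)) = snd (z x) \<oplus>\<^bsub>M\<^esub> snd (z y)"
    if "x \<in> carrier M" "y \<in> carrier M" for x y
  proof (rule zu)
    note zx = z[OF that(1)] and zy = z[OF that(2)]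
    show "fst (z x) \<oplus>\<^bsub>M\<^esub> fst (z y) \<in> U" "snd (z x) \<oplus>\<^bsub>M\<^esub> snd (z y) \<in> V"
      using zx zy u(3) v(3) by auto
    have mid: "(a \<oplus>\<^bsub>M\<^esub> b) \<oplus>\<^bsub>M\<^esub> (c \<oplus>\<^bsub>M\<^esub> d) = (a \<oplus>\<^bsub>M\<^esub> c) \<oplus>\<^bsub>M\<^esub> (b \<oplus>\<^bsub>M\<^esub> d)"
      if "a \<in> U" "b \<in> V" "c \<in> U" "d \<in> V" for a b c d
      using that uc vc by (simp add: M.M.a_ac)
    show "x \<oplus>\<^bsub>M\<^esub> y = (fst (z x) \<oplus>\<^bsub>M\<^esub> fst (z y)) \<oplus>\<^bsub>M\<^esub> (snd (z x) \<oplus>\<^bsub>M\<^esub> snd (z y))"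
      using mid[of "fst (z x)" "snd (z x)" "fst (z y)" "snd (z y)"] zx zy by simp
  qed
  have zsm: "fst (z (a \<odot>\<^bsub>M\<^esub> x)) = a \<odot>\<^bsub>M\<^esub> fst (z x) \<and> snd (z (a \<odot>\<^bsub>M\<^esub> x)) = a \<odot>\<^bsub>M\<^esub> snd (z x)"
    if "x \<in> carrier M" "a \<in> carrier R" for x a
  proof (rule zu)
    note zx = z[OF that(1)]
    show "a \<odot>\<^bsub>M\<^esub> fst (z x) \<in> U" "a \<odot>\<^bsub>M\<^esub> snd (z x) \<in> V" using zx u(4) v(4) that by auto
    show "a \<odot>\<^bsub>M\<^esub> x = a \<odot>\<^bsub>M\<^esub> fst (z x) \<oplus>\<^bsub>M\<^esub> a \<odot>\<^bsub>M\<^esub> snd (z x)"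
      using M.smult_r_distr[OF that(2) uc vc, of "fst (z x)" "snd (z x)"] zx by simp
  qed
  have p: "(\<lambda>x. fst (z x)) \<in> mod_hom R M (M\<lparr>carrier := U\<rparr>)"
    by (rule mod_homI) (use z zadd zsm in auto)
  have q: "(\<lambda>x. snd (z x)) \<in> mod_hom R M (M\<lparr>carrier := V\<rparr>)"
    by (rule mod_homI) (use z zadd zsm in auto)
  have "\<forall>x\<in>carrier M. x = fst (z x) \<oplus>\<^bsub>M\<^esub> snd (z x)"
    by (intro ballI conjunct2[OF conjunct2[OF z]])
  then show ?thesis by (intro bexI[OF bexI[OF _ q] p])
qed

text \<open>The image of the inclusion and the kernel of the projection decompose \<open>Y\<close>, so the kernel
  is zero.\<close>

lemma indecomposable_summand_iso:
  assumes lm: "left_module R Z" "left_module R Y" and Y: "indecomposable_module R Y"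
    and Z: "carrier Z \<noteq> {\<zero>\<^bsub>Z\<^esub>}" and s: "summand R Z Y"
  shows "mod_isomorphic R Y Z"
proof -
  interpret Z: left_module R Z by fact
  interpret Y: left_module R Y by fact
  from s obtain i p where i: "i \<in> mod_hom R Z Y" and p: "p \<in> mod_hom R Y Z"
    and pi: "\<And>x. x \<in> carrier Z \<Longrightarrow> p (i x) = x"
    by (auto simp: summand_def)
  note ic = mod_hom_closed[OF i] and pc = mod_hom_closed[OF p]
  let ?U = "i ` carrier Z" and ?V = "a_kernel Y Z p"
  have U: "submodule ?U R Y" by (rule submodule_image[OF lm i submodule_carrier[OF lm(1)]])
  have V: "submodule ?V R Y" by (rule submodule_kernel[OF lm(2,1) p])
  have "?U \<inter> ?V = {\<zero>\<^bsub>Y\<^esub>}"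
  proof
    show "?U \<inter> ?V \<subseteq> {\<zero>\<^bsub>Y\<^esub>}" using pi mod_hom_zero[OF lm i] by (auto simp: a_kernel_eq)
    show "{\<zero>\<^bsub>Y\<^esub>} \<subseteq> ?U \<inter> ?V" using submodule_facts(2)[OF U] submodule_facts(2)[OF V] by blast
  qed
  moreover have "?U <+>\<^bsub>Y\<^esub> ?V = carrier Y"
  proof
    show "?U <+>\<^bsub>Y\<^esub> ?V \<subseteq> carrier Y" using ic by (auto simp: set_add_iff a_kernel_eq)
    show "carrier Y \<subseteq> ?U <+>\<^bsub>Y\<^esub> ?V"
    proof
      fix y assume y: "y \<in> carrier Y"
      have "p (y \<ominus>\<^bsub>Y\<^esub> i (p y)) = \<zero>\<^bsub>Z\<^esub>"
        using y pc ic by (simp add: mod_hom_minus[OF lm(2,1) p] pi Z.M.minus_eq_zero_iff)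
      then have "y \<ominus>\<^bsub>Y\<^esub> i (p y) \<in> ?V" using y pc ic by (simp add: a_kernel_eq)
      moreover have "y = i (p y) \<oplus>\<^bsub>Y\<^esub> (y \<ominus>\<^bsub>Y\<^esub> i (p y))" using y pc ic by (simp add: Y.M.add_minus_cancel)
      ultimately show "y \<in> ?U <+>\<^bsub>Y\<^esub> ?V" using pc y unfolding set_add_iff by blast
    qed
  qed
  ultimately have "?U = {\<zero>\<^bsub>Y\<^esub>} \<or> ?V = {\<zero>\<^bsub>Y\<^esub>}"
    using Y U V unfolding indecomposable_module_def by blast
  moreover have "?U \<noteq> {\<zero>\<^bsub>Y\<^esub>}"
  proof
    assume e: "?U = {\<zero>\<^bsub>Y\<^esub>}"
    have "x = \<zero>\<^bsub>Z\<^esub>" if "x \<in> carrier Z" for x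
    proof -
      have "i x = \<zero>\<^bsub>Y\<^esub>" using e that by blast
      then show ?thesis using pi[OF that] mod_hom_zero[OF lm(2,1) p] by simp
    qed
    then show False using Z by blast
  qed
  ultimately have "?V = {\<zero>\<^bsub>Y\<^esub>}" by blast
  then have "inj_on p (carrier Y)"
    unfolding inj_on_mod_hom_iff[OF lm(2,1) p] by (auto simp: a_kernel_eq)
  moreover have "p ` carrier Y = carrier Z"
  proof
    show "p ` carrier Y \<subseteq> carrier Z" using pc by blast
    show "carrier Z \<subseteq> p ` carrier Y" using pi ic by (metis image_eqI subsetI)
  qed
  ultimately show ?thesis unfolding mod_isomorphic_def bij_betw_def using p by blast
qed

lemma mod_isomorphic_refl: "mod_isomorphic R M M"
  unfolding mod_isomorphic_def by (rule bexI[OF _ mod_hom_id]) (auto simp: bij_betw_def)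

lemma mod_isomorphic_sym:
  assumes "left_module R M" "mod_isomorphic R M N" shows "mod_isomorphic R N M"
  using assms mod_hom_inv[OF assms(1)] bij_betw_inv_into unfolding mod_isomorphic_def by blast

lemma mod_isomorphic_trans:
  assumes "mod_isomorphic R L M" "mod_isomorphic R M N" shows "mod_isomorphic R L N"
proof -
  from assms obtain f g where f: "f \<in> mod_hom R L M" "bij_betw f (carrier L) (carrier M)"
    and g: "g \<in> mod_hom R M N" "bij_betw g (carrier M) (carrier N)"
    unfolding mod_isomorphic_def by blast
  have "bij_betw (g \<circ> f) (carrier L) (carrier N)" by (rule bij_betw_trans[OF f(2) g(2)])
  then show ?thesis
    unfolding mod_isomorphic_def using mod_hom_compose[OF f(1) g(1)] by (auto simp: o_def)
qed

context fin_dim_algebra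
begin

section \<open>Endomorphisms of indecomposable modules\<close>

text \<open>Images and kernels of the powers of \<open>f\<close> become stationary, say from the \<open>m\<close>-th power on. Then \<open>M\<close>
  is the internal direct sum of the image and the kernel of \<open>f ^^ m\<close>, and one of them is zero.\<close>

lemma indecomposable_fitting:
  fixes M :: "('a, 'm) module"
  assumes fg: "fg_module A M" and ind: "indecomposable_module A M" and f: "f \<in> mod_hom A M M"
  shows "bij_betw f (carrier M) (carrier M) \<or> (\<exists>k. \<forall>x\<in>carrier M. (f ^^ k) x = \<zero>\<^bsub>M\<^esub>)"
proof -
  have lm: "left_module A M" using fg by (rule fg_left_module)
  interpret M: left_module A M by (rule lm)
  obtain \<mu> :: "'m set \<Rightarrow> nat"
    where \<mu>: "\<forall>U V. submodule U A M \<and> submodule V A M \<and> U \<subset> V \<longrightarrow> \<mu> U < \<mu> V"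
    using length_function[OF fg] by blast
  have fk: "f ^^ k \<in> mod_hom A M M" for k
  proof (induction k)
    case 0 show ?case using mod_hom_id[of A M] by (simp add: id_def)
  next
    case (Suc k) show ?case using mod_hom_compose[OF Suc.IH f] by (simp add: o_def)
  qed
  have fkc: "(f ^^ k) x \<in> carrier M" if "x \<in> carrier M" for k x by (rule mod_hom_closed[OF fk that])
  have fadd: "(f ^^ (i + j)) x = (f ^^ i) ((f ^^ j) x)" for i j x by (simp add: funpow_add)
  define I where "I k = (f ^^ k) ` carrier M" for k
  define Q where "Q k = a_kernel M M (f ^^ k)" for k
  have I: "submodule (I k) A M" for k
    unfolding I_def by (rule submodule_image[OF lm lm fk submodule_carrier[OF lm]])
  have Q: "submodule (Q k) A M" for k
    unfolding Q_def by (rule submodule_kernel[OF lm lm fk])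
  have f0: "(f ^^ k) \<zero>\<^bsub>M\<^esub> = \<zero>\<^bsub>M\<^esub>" for k by (rule mod_hom_zero[OF lm lm fk])
  have Idec: "I (i + j) \<subseteq> I i" for i j unfolding I_def by (auto simp: fadd fkc)
  have Qinc: "Q j \<subseteq> Q (i + j)" for i j unfolding Q_def by (auto simp: a_kernel_eq fadd f0)
  obtain k where k: "\<And>j. \<mu> (I k) \<le> \<mu> (I j)"
    using ex_has_least_nat[of "\<lambda>_. True" 0 "\<lambda>j. \<mu> (I j)"] by auto
  obtain l where l: "\<And>j. \<mu> (Q j) \<le> \<mu> (Q l)"
    using ex_has_greatest_nat[of "\<lambda>_. True" 0 "\<lambda>j. \<mu> (Q j)" "Suc (\<mu> (carrier M))"]
      length_bound[OF \<mu> lm Q] by (auto simp: less_Suc_eq_le)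
  have Ik: "I (k + j) = I k" for j
  proof (rule ccontr)
    assume "I (k + j) \<noteq> I k"
    then have "\<mu> (I (k + j)) < \<mu> (I k)" using \<mu> I Idec[of k j] by blast
    then show False using k[of "k + j"] by simp
  qed
  have Ql: "Q (j + l) = Q l" for j
  proof (rule ccontr)
    assume "Q (j + l) \<noteq> Q l"
    then have "\<mu> (Q l) < \<mu> (Q (j + l))" using \<mu> Q Qinc[of l j] by blast
    then show False using l[of "j + l"] by simp
  qed
  \<comment> \<open>The successor makes \<open>m\<close> positive: below, injectivity of the \<open>m\<close>-th power has to give that of \<open>f\<close>.\<close>
  define m where "m = Suc (k + l)"
  have Im: "I (m + m) = I m" using Ik[of "Suc l"] Ik[of "Suc l + m"] by (simp add: m_def ac_simps)
  have Qm: "Q (m + m) = Q m" using Ql[of "Suc k"] Ql[of "Suc k + m"] by (simp add: m_def ac_simps)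
  have int: "I m \<inter> Q m = {\<zero>\<^bsub>M\<^esub>}"
  proof
    show "I m \<inter> Q m \<subseteq> {\<zero>\<^bsub>M\<^esub>}"
    proof
      fix x assume x: "x \<in> I m \<inter> Q m"
      then obtain y where y: "y \<in> carrier M" "x = (f ^^ m) y" by (auto simp: I_def)
      have "y \<in> Q (m + m)" using x y by (simp add: Q_def a_kernel_eq fadd)
      then have "y \<in> Q m" by (simp add: Qm)
      then show "x \<in> {\<zero>\<^bsub>M\<^esub>}" using y by (simp add: Q_def a_kernel_eq)
    qed
    show "{\<zero>\<^bsub>M\<^esub>} \<subseteq> I m \<inter> Q m" using submodule_facts(2)[OF I] submodule_facts(2)[OF Q] by blast
  qed
  have dec: "\<exists>y\<in>carrier M. x \<ominus>\<^bsub>M\<^esub> (f ^^ m) y \<in> Q m" if x: "x \<in> carrier M" for x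
  proof -
    have "(f ^^ m) x \<in> I (m + m)" using x Im by (auto simp: I_def)
    then obtain y where y: "y \<in> carrier M" "(f ^^ m) x = (f ^^ m) ((f ^^ m) y)"
      by (auto simp: I_def fadd)
    have "x \<ominus>\<^bsub>M\<^esub> (f ^^ m) y \<in> Q m"
      using x y fkc by (simp add: Q_def a_kernel_eq mod_hom_minus[OF lm lm fk] M.M.minus_eq_zero_iff)
    then show ?thesis using y by blast
  qed
  have sum: "I m <+>\<^bsub>M\<^esub> Q m = carrier M"
  proof
    show "I m <+>\<^bsub>M\<^esub> Q m \<subseteq> carrier M"
      using submodule_facts(1)[OF I[of m]] submodule_facts(1)[OF Q[of m]]
      by (auto simp: set_add_iff intro!: M.M.a_closed)
    show "carrier M \<subseteq> I m <+>\<^bsub>M\<^esub> Q m"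
    proof
      fix x assume x: "x \<in> carrier M"
      from dec[OF x] obtain y where y: "y \<in> carrier M" "x \<ominus>\<^bsub>M\<^esub> (f ^^ m) y \<in> Q m" by blast
      have "x = (f ^^ m) y \<oplus>\<^bsub>M\<^esub> (x \<ominus>\<^bsub>M\<^esub> (f ^^ m) y)"
        using x y fkc by (simp add: M.M.add_minus_cancel)
      moreover have "(f ^^ m) y \<in> I m" using y by (simp add: I_def)
      ultimately show "x \<in> I m <+>\<^bsub>M\<^esub> Q m" using y(2) unfolding set_add_iff by blast
    qed
  qed
  have "I m = {\<zero>\<^bsub>M\<^esub>} \<or> Q m = {\<zero>\<^bsub>M\<^esub>}"
    using ind I[of m] Q[of m] int sum unfolding indecomposable_module_def by blast
  then show ?thesis
  proof
    assume "I m = {\<zero>\<^bsub>M\<^esub>}"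
    then have "\<forall>x\<in>carrier M. (f ^^ m) x = \<zero>\<^bsub>M\<^esub>" unfolding I_def by blast
    then show ?thesis by blast
  next
    assume Q0: "Q m = {\<zero>\<^bsub>M\<^esub>}"
    have "x = \<zero>\<^bsub>M\<^esub>" if "x \<in> carrier M" "f x = \<zero>\<^bsub>M\<^esub>" for x
    proof -
      have "(f ^^ m) x = \<zero>\<^bsub>M\<^esub>" using that f0[of "k + l"] by (simp add: m_def funpow_Suc_right del: funpow.simps)
      then have "x \<in> Q m" using that by (simp add: Q_def a_kernel_eq)
      then show ?thesis using Q0 by blast
    qed
    then have "inj_on f (carrier M)" unfolding inj_on_mod_hom_iff[OF lm lm f] by blast
    moreover have "x \<in> f ` carrier M" if x: "x \<in> carrier M" for x
    proof -
      from dec[OF x] Q0 obtain y where y: "y \<in> carrier M" "x \<ominus>\<^bsub>M\<^esub> (f ^^ m) y = \<zero>\<^bsub>M\<^esub>" by blast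
      then have "x = f ((f ^^ (k + l)) y)" using x fkc[OF y(1), of m] by (simp add: M.M.minus_eq_zero_iff m_def)
      then show ?thesis using fkc[OF y(1)] by blast
    qed
    ultimately show ?thesis using mod_hom_closed[OF f] unfolding bij_betw_def by blast
  qed
qed

text \<open>The endomorphism ring is local: if \<open>f + g\<close> is invertible, it may be taken to be the identity.
  If \<open>f\<close> is not invertible, it is nilpotent, hence \<open>g = 1 - f\<close> is injective and not nilpotent.\<close>

lemma indecomposable_local:
  fixes M :: "('a, 'm) module"
  assumes fg: "fg_module A M" and ind: "indecomposable_module A M"
    and f: "f \<in> mod_hom A M M" and g: "g \<in> mod_hom A M M"
    and fg_bij: "bij_betw (\<lambda>x. f x \<oplus>\<^bsub>M\<^esub> g x) (carrier M) (carrier M)"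
  shows "bij_betw f (carrier M) (carrier M) \<or> bij_betw g (carrier M) (carrier M)"
proof -
  have lm: "left_module A M" using fg by (rule fg_left_module)
  interpret M: left_module A M by (rule lm)
  let ?s = "\<lambda>x. f x \<oplus>\<^bsub>M\<^esub> g x" let ?t = "inv_into (carrier M) ?s"
  have s: "?s \<in> mod_hom A M M" by (rule mod_hom_plus[OF lm f g])
  have t: "?t \<in> mod_hom A M M" by (rule mod_hom_inv[OF lm s fg_bij])
  have tb: "bij_betw ?t (carrier M) (carrier M)" by (rule bij_betw_inv_into[OF fg_bij])
  note fc = mod_hom_closed[OF f] and gc = mod_hom_closed[OF g]
  define f' where "f' x = ?t (f x)" for x
  define g' where "g' x = ?t (g x)" for x
  have f': "f' \<in> mod_hom A M M" unfolding f'_def by (rule mod_hom_compose[OF f t])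
  have g': "g' \<in> mod_hom A M M" unfolding g'_def by (rule mod_hom_compose[OF g t])
  have one: "f' x \<oplus>\<^bsub>M\<^esub> g' x = x" if "x \<in> carrier M" for x
    using mod_hom_add[OF t fc[OF that] gc[OF that]] inv_into_f_f[OF bij_betw_imp_inj_on[OF fg_bij] that]
    by (simp add: f'_def g'_def)
  have lift: "bij_betw h (carrier M) (carrier M)"
    if h: "h \<in> mod_hom A M M" and b: "bij_betw (\<lambda>x. ?t (h x)) (carrier M) (carrier M)" for h
  proof -
    have "bij_betw (?s \<circ> (\<lambda>x. ?t (h x))) (carrier M) (carrier M)" by (rule bij_betw_trans[OF b fg_bij])
    moreover have "(?s \<circ> (\<lambda>x. ?t (h x))) x = h x" if "x \<in> carrier M" for x
      using f_inv_into_f[of "h x" ?s "carrier M"] mod_hom_closed[OF h that] fg_bij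
      unfolding bij_betw_def by simp
    ultimately show ?thesis using bij_betw_cong[of "carrier M" "?s \<circ> (\<lambda>x. ?t (h x))" h] by blast
  qed
  have "bij_betw f' (carrier M) (carrier M) \<or> bij_betw g' (carrier M) (carrier M)"
  proof (rule ccontr)
    assume n: "\<not> ?thesis"
    obtain k where k: "\<And>x. x \<in> carrier M \<Longrightarrow> (f' ^^ k) x = \<zero>\<^bsub>M\<^esub>"
      using indecomposable_fitting[OF fg ind f'] n by blast
    obtain l where l: "\<And>x. x \<in> carrier M \<Longrightarrow> (g' ^^ l) x = \<zero>\<^bsub>M\<^esub>"
      using indecomposable_fitting[OF fg ind g'] n by blast
    have ginj: "x = \<zero>\<^bsub>M\<^esub>" if x: "x \<in> carrier M" "g' x = \<zero>\<^bsub>M\<^esub>" for x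
    proof -
      have "f' x = x" using one[OF x(1)] x mod_hom_closed[OF f' x(1)] by simp
      then have "(f' ^^ i) x = x" for i by (induction i) auto
      then show ?thesis using k[OF x(1)] by simp
    qed
    have "x = \<zero>\<^bsub>M\<^esub>" if "x \<in> carrier M" "(g' ^^ i) x = \<zero>\<^bsub>M\<^esub>" for x i
      using that
    proof (induction i arbitrary: x)
      case (Suc i)
      have "g' x = \<zero>\<^bsub>M\<^esub>"
        using Suc.IH[of "g' x"] Suc.prems mod_hom_closed[OF g'] by (simp add: funpow_swap1)
      then show ?case using ginj Suc.prems by blast
    qed simp
    then have "carrier M = {\<zero>\<^bsub>M\<^esub>}" using l M.M.zero_closed by blast
    then show False using ind by (simp add: indecomposable_module_def)
  qed
  then show ?thesis unfolding f'_def g'_def using lift[OF f] lift[OF g] by blast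
qed

text \<open>Along the splitting of \<open>Y\<close>, the identity of \<open>M\<close> is the sum of an endomorphism through \<open>P\<close> and
  one through \<open>Q\<close>. One of the two is an automorphism because the endomorphism ring of \<open>M\<close> is local.\<close>

lemma indecomposable_summand_split:
  fixes M :: "('a, 'm) module"
  assumes fg: "fg_module A M" and ind: "indecomposable_module A M" and s: "summand A M Y"
    and p: "p \<in> mod_hom A Y P" "i \<in> mod_hom A P Y" and q: "q \<in> mod_hom A Y Q" "j \<in> mod_hom A Q Y"
    and e: "\<And>y. y \<in> carrier Y \<Longrightarrow> y = i (p y) \<oplus>\<^bsub>Y\<^esub> j (q y)"
  shows "summand A M P \<or> summand A M Q"
proof -
  have lm: "left_module A M" using fg by (rule fg_left_module)
  from s obtain a b where a: "a \<in> mod_hom A M Y" and b: "b \<in> mod_hom A Y M"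
    and ba: "\<And>x. x \<in> carrier M \<Longrightarrow> b (a x) = x"
    by (auto simp: summand_def)
  note ap = mod_hom_compose[OF a p(1)] and aq = mod_hom_compose[OF a q(1)]
  note bi = mod_hom_compose[OF p(2) b] and bj = mod_hom_compose[OF q(2) b]
  have one: "b (i (p (a x))) \<oplus>\<^bsub>M\<^esub> b (j (q (a x))) = x" if x: "x \<in> carrier M" for x
  proof -
    have ax: "a x \<in> carrier Y" by (rule mod_hom_closed[OF a x])
    have "b (i (p (a x)) \<oplus>\<^bsub>Y\<^esub> j (q (a x))) = b (i (p (a x))) \<oplus>\<^bsub>M\<^esub> b (j (q (a x)))"
      using mod_hom_closed[OF p(1) ax] mod_hom_closed[OF q(1) ax]
      by (intro mod_hom_add[OF b] mod_hom_closed[OF p(2)] mod_hom_closed[OF q(2)])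
    then show ?thesis using e[OF ax] ba[OF x] by simp
  qed
  have "bij_betw (\<lambda>x. b (i (p (a x))) \<oplus>\<^bsub>M\<^esub> b (j (q (a x)))) (carrier M) (carrier M)"
    by (subst bij_betw_cong[OF one]) (use bij_betw_id[of "carrier M"] in \<open>simp_all add: id_def\<close>)
  from indecomposable_local[OF fg ind mod_hom_compose[OF ap bi] mod_hom_compose[OF aq bj] this]
  show ?thesis using summand_of_bij_comp[OF lm ap bi] summand_of_bij_comp[OF lm aq bj] by blast
qed

text \<open>Submodules are built from \<open>0\<close> and indecomposable ones by internal direct sums of proper
  submodules; the length of a submodule bounds the number of steps.\<close>

lemma submodule_decomposition_induct [consumes 2, case_names zero indecomposable sum]:
  fixes Y :: "('a, 'm) module"
  assumes fg: "fg_module A Y" and U: "submodule U A Y"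
    and zero: "Prop {\<zero>\<^bsub>Y\<^esub>}"
    and indec: "\<And>U. submodule U A Y \<Longrightarrow> indecomposable_module A (Y\<lparr>carrier := U\<rparr>) \<Longrightarrow> Prop U"
    and sum: "\<And>U P Q p q. submodule U A Y \<Longrightarrow> submodule P A Y \<Longrightarrow> submodule Q A Y \<Longrightarrow> P \<subseteq> U \<Longrightarrow> Q \<subseteq> U \<Longrightarrow>
      p \<in> mod_hom A (Y\<lparr>carrier := U\<rparr>) (Y\<lparr>carrier := P\<rparr>) \<Longrightarrow>
      q \<in> mod_hom A (Y\<lparr>carrier := U\<rparr>) (Y\<lparr>carrier := Q\<rparr>) \<Longrightarrow>
      (\<And>x. x \<in> U \<Longrightarrow> x = p x \<oplus>\<^bsub>Y\<^esub> q x) \<Longrightarrow> Prop P \<Longrightarrow> Prop Q \<Longrightarrow> Prop U"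
  shows "Prop U"
proof -
  have lm: "left_module A Y" using fg by (rule fg_left_module)
  obtain \<mu> :: "'m set \<Rightarrow> nat"
    where \<mu>: "\<forall>U V. submodule U A Y \<and> submodule V A Y \<and> U \<subset> V \<longrightarrow> \<mu> U < \<mu> V"
    using length_function[OF fg] by blast
  show ?thesis
    using U
  proof (induction "\<mu> U" arbitrary: U rule: less_induct)
    case less
    note U = less.prems
    have lmU: "left_module A (Y\<lparr>carrier := U\<rparr>)" by (rule left_module_submodule[OF lm U])
    consider "U = {\<zero>\<^bsub>Y\<^esub>}" | "indecomposable_module A (Y\<lparr>carrier := U\<rparr>)"
      | "U \<noteq> {\<zero>\<^bsub>Y\<^esub>}" "\<not> indecomposable_module A (Y\<lparr>carrier := U\<rparr>)" by blast
    then show ?case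
    proof cases
      case 1 then show ?thesis using zero by simp
    next
      case 2 then show ?thesis using indec U by simp
    next
      case 3
      then obtain P Q where PQ: "submodule P A (Y\<lparr>carrier := U\<rparr>)" "submodule Q A (Y\<lparr>carrier := U\<rparr>)"
        "P \<inter> Q = {\<zero>\<^bsub>Y\<^esub>}" "P <+>\<^bsub>Y\<lparr>carrier := U\<rparr>\<^esub> Q = U" "P \<noteq> {\<zero>\<^bsub>Y\<^esub>}" "Q \<noteq> {\<zero>\<^bsub>Y\<^esub>}"
        unfolding indecomposable_module_def by auto
      have PY: "submodule P A Y" "P \<subseteq> U" and QY: "submodule Q A Y" "Q \<subseteq> U"
        using PQ(1,2) by (simp_all add: submodule_sub_iff[OF lm U])
      have "P \<subset> U" "Q \<subset> U" using PY(2) QY(2) PQ(3,5,6) by blast+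
      then have "\<mu> P < \<mu> U" "\<mu> Q < \<mu> U" using \<mu> PY(1) QY(1) U by blast+
      then have "Prop P" "Prop Q" using less.hyps PY(1) QY(1) by blast+
      moreover obtain p q where "p \<in> mod_hom A (Y\<lparr>carrier := U\<rparr>) (Y\<lparr>carrier := P\<rparr>)"
        "q \<in> mod_hom A (Y\<lparr>carrier := U\<rparr>) (Y\<lparr>carrier := Q\<rparr>)" "\<forall>x\<in>U. x = p x \<oplus>\<^bsub>Y\<^esub> q x"
        using internal_direct_sum_projections[OF lmU PQ(1,2)] PQ(3,4) by auto
      ultimately show ?thesis using sum[OF U PY(1) QY(1) PY(2) QY(2)] by blast
    qed
  qed
qed

text \<open>The part of the Krull-Schmidt theorem that is needed: the indecomposable parts of any
  decomposition of \<open>Y\<close> already include all indecomposable summands up to isomorphism.\<close>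

lemma finitely_many_indecomposable_summands:
  fixes Y :: "('a, 'm) module"
  assumes fg: "fg_module A Y"
  shows "\<exists>F :: ('a, 'm) module set. finite F \<and> (\<forall>N\<in>F. fg_module A N) \<and>
    (\<forall>M :: ('a, 'n) module. fg_module A M \<and> indecomposable_module A M \<and> summand A M Y \<longrightarrow>
      (\<exists>N\<in>F. mod_isomorphic A N M))"
proof -
  have lm: "left_module A Y" using fg by (rule fg_left_module)
  define Good where "Good U \<longleftrightarrow> (\<exists>F :: ('a, 'm) module set. finite F \<and> (\<forall>N\<in>F. fg_module A N) \<and>
    (\<forall>M :: ('a, 'n) module. fg_module A M \<and> indecomposable_module A M \<and> summand A M (Y\<lparr>carrier := U\<rparr>) \<longrightarrow>
      (\<exists>N\<in>F. mod_isomorphic A N M)))" for U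
  have "Good (carrier Y)"
    using fg submodule_carrier[OF lm]
  proof (induction rule: submodule_decomposition_induct)
    case zero
    have "False" if M: "fg_module A M" "indecomposable_module A M" "summand A M (Y\<lparr>carrier := {\<zero>\<^bsub>Y\<^esub>}\<rparr>)"
      for M :: "('a, 'n) module"
    proof -
      from M(3) obtain i p where ip: "i \<in> mod_hom A M (Y\<lparr>carrier := {\<zero>\<^bsub>Y\<^esub>}\<rparr>)"
        "p \<in> mod_hom A (Y\<lparr>carrier := {\<zero>\<^bsub>Y\<^esub>}\<rparr>) M" "\<And>x. x \<in> carrier M \<Longrightarrow> p (i x) = x"
        by (auto simp: summand_def)
      have lm0: "left_module A (Y\<lparr>carrier := {\<zero>\<^bsub>Y\<^esub>}\<rparr>)" by (rule left_module_submodule[OF lm submodule_zero[OF lm]])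
      interpret M: left_module A M by (rule fg_left_module[OF M(1)])
      have "x = \<zero>\<^bsub>M\<^esub>" if "x \<in> carrier M" for x
        using ip(3)[OF that] mod_hom_closed[OF ip(1) that] mod_hom_zero[OF lm0 M.left_module_axioms ip(2)] by simp
      then have "carrier M = {\<zero>\<^bsub>M\<^esub>}" by blast
      then show False using M(2) by (simp add: indecomposable_module_def)
    qed
    then show ?case unfolding Good_def by (intro exI[of _ "{}"]) auto
  next
    case (indecomposable U)
    have fgU: "fg_module A (Y\<lparr>carrier := U\<rparr>)" by (rule fg_submodule[OF fg indecomposable(1)])
    have "mod_isomorphic A (Y\<lparr>carrier := U\<rparr>) M"
      if "fg_module A M" "indecomposable_module A M" "summand A M (Y\<lparr>carrier := U\<rparr>)" for M :: "('a, 'n) module"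
      using that(2) by (intro indecomposable_summand_iso fg_left_module that indecomposable fgU)
        (simp add: indecomposable_module_def)
    then show ?case unfolding Good_def using fgU by (intro exI[of _ "{Y\<lparr>carrier := U\<rparr>}"]) auto
  next
    case (sum U P Q p q)
    have inP: "(\<lambda>x. x) \<in> mod_hom A (Y\<lparr>carrier := P\<rparr>) (Y\<lparr>carrier := U\<rparr>)"
      and inQ: "(\<lambda>x. x) \<in> mod_hom A (Y\<lparr>carrier := Q\<rparr>) (Y\<lparr>carrier := U\<rparr>)"
      using sum(4,5) by (auto intro!: mod_homI)
    from sum(9) obtain F :: "('a, 'm) module set" where F: "finite F" "\<forall>N\<in>F. fg_module A N"
      "\<And>M :: ('a, 'n) module. fg_module A M \<Longrightarrow> indecomposable_module A M \<Longrightarrow> summand A M (Y\<lparr>carrier := P\<rparr>) \<Longrightarrow>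
        (\<exists>N\<in>F. mod_isomorphic A N M)" unfolding Good_def by blast
    from sum(10) obtain G :: "('a, 'm) module set" where G: "finite G" "\<forall>N\<in>G. fg_module A N"
      "\<And>M :: ('a, 'n) module. fg_module A M \<Longrightarrow> indecomposable_module A M \<Longrightarrow> summand A M (Y\<lparr>carrier := Q\<rparr>) \<Longrightarrow>
        (\<exists>N\<in>G. mod_isomorphic A N M)" unfolding Good_def by blast
    have "\<exists>N\<in>F \<union> G. mod_isomorphic A N M"
      if M: "fg_module A M" "indecomposable_module A M" "summand A M (Y\<lparr>carrier := U\<rparr>)" for M :: "('a, 'n) module"
    proof -
      have "summand A M (Y\<lparr>carrier := P\<rparr>) \<or> summand A M (Y\<lparr>carrier := Q\<rparr>)"
        by (rule indecomposable_summand_split[OF M sum(6) inP sum(7) inQ]) (use sum(8) in simp)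
      then show ?thesis using F(3)[OF M(1,2)] G(3)[OF M(1,2)] by blast
    qed
    then show ?case unfolding Good_def using F(1,2) G(1,2) by (intro exI[of _ "F \<union> G"]) auto
  qed
  then show ?thesis by (simp add: Good_def)
qed

section \<open>Projective and injective modules\<close>

lemma projective_fg: "projective_module A P \<Longrightarrow> fg_module A P"
  by (simp add: projective_module_def)

lemma projective_left_module: "projective_module A P \<Longrightarrow> left_module A P"
  by (intro fg_left_module projective_fg)

lemma injective_fg: "injective_module A J \<Longrightarrow> fg_module A J"
  by (simp add: injective_module_def)

lemma injective_left_module: "injective_module A J \<Longrightarrow> left_module A J"
  by (intro fg_left_module injective_fg)

lemma projective_lift:
  fixes M N :: "('k, 'a) std_module"
  assumes "projective_module A P" "fg_module A M" "fg_module A N"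
    and "g \<in> mod_hom A M N" "g ` carrier M = carrier N" "f \<in> mod_hom A P N"
  obtains h where "h \<in> mod_hom A P M" "\<And>x. x \<in> carrier P \<Longrightarrow> g (h x) = f x"
proof -
  have "\<exists>h\<in>mod_hom A P M. \<forall>x\<in>carrier P. g (h x) = f x"
    using assms(1)[unfolded projective_module_def, THEN conjunct2, rule_format, OF assms(4,6)]
      assms(2,3,5) by simp
  then show ?thesis using that by blast
qed

lemma injective_extend:
  fixes N :: "('k, 'a) std_module"
  assumes J: "injective_module A J" and N: "fg_module A N" and U: "submodule U A N"
    and f: "f \<in> mod_hom A (N\<lparr>carrier := U\<rparr>) J"
  obtains h where "h \<in> mod_hom A N J" "\<And>x. x \<in> U \<Longrightarrow> h x = f x"
proof -
  have i: "(\<lambda>x. x) \<in> mod_hom A (N\<lparr>carrier := U\<rparr>) N" by (rule mod_hom_from_sub[OF mod_hom_id U])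
  have "\<exists>h\<in>mod_hom A N J. \<forall>x\<in>carrier (N\<lparr>carrier := U\<rparr>). h x = f x"
    using J[unfolded injective_module_def, THEN conjunct2, rule_format, OF i f]
      fg_submodule[OF N U] N by (simp add: inj_on_def)
  then show ?thesis using that by auto
qed

lemma projective_summand:
  assumes P: "projective_module A P" and Q: "fg_module A Q" and s: "summand A Q P"
  shows "projective_module A Q"
proof -
  from s obtain i p where i: "i \<in> mod_hom A Q P" and p: "p \<in> mod_hom A P Q"
    and pi: "\<And>x. x \<in> carrier Q \<Longrightarrow> p (i x) = x"
    by (auto simp: summand_def)
  show ?thesis
    unfolding projective_module_def
  proof (intro conjI Q allI ballI impI)
    fix M N :: "('k, 'a) std_module" and g f
    assume g: "g \<in> mod_hom A M N" and f: "f \<in> mod_hom A Q N"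
      and a: "fg_module A M \<and> fg_module A N \<and> g ` carrier M = carrier N"
    obtain h where h: "h \<in> mod_hom A P M" "\<And>x. x \<in> carrier P \<Longrightarrow> g (h x) = f (p x)"
      using projective_lift[OF P _ _ g _ mod_hom_compose[OF p f]] a by blast
    show "\<exists>h\<in>mod_hom A Q M. \<forall>x\<in>carrier Q. g (h x) = f x"
      using h(2) mod_hom_closed[OF i] pi by (intro bexI[OF _ mod_hom_compose[OF i h(1)]]) simp
  qed
qed

lemma projective_direct_sum:
  assumes P: "projective_module A P" and Q: "projective_module A Q"
  shows "projective_module A (direct_sum P Q)"
  unfolding projective_module_def
proof (intro conjI allI ballI impI)
  show "fg_module A (direct_sum P Q)" by (intro fg_module_direct_sum projective_fg assms)
  have lmP: "left_module A P" and lmQ: "left_module A Q" using assms by (auto intro: projective_left_module)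
  interpret P: left_module A P by fact
  interpret Q: left_module A Q by fact
  fix M N :: "('k, 'a) std_module" and g f
  assume g: "g \<in> mod_hom A M N" and f: "f \<in> mod_hom A (direct_sum P Q) N"
    and a: "fg_module A M \<and> fg_module A N \<and> g ` carrier M = carrier N"
  have lmM: "left_module A M" using a by (blast intro: fg_left_module)
  have i: "(\<lambda>x. dpair x \<zero>\<^bsub>Q\<^esub>) \<in> mod_hom A P (direct_sum P Q)"
    by (rule mod_hom_dpair[OF mod_hom_id mod_hom_zero_map[OF lmQ]])
  have j: "(\<lambda>x. dpair \<zero>\<^bsub>P\<^esub> x) \<in> mod_hom A Q (direct_sum P Q)"
    by (rule mod_hom_dpair[OF mod_hom_zero_map[OF lmP] mod_hom_id])
  obtain h where h: "h \<in> mod_hom A P M" "\<And>x. x \<in> carrier P \<Longrightarrow> g (h x) = f (dpair x \<zero>\<^bsub>Q\<^esub>)"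
    using projective_lift[OF P _ _ g _ mod_hom_compose[OF i f]] a by blast
  obtain k where k: "k \<in> mod_hom A Q M" "\<And>x. x \<in> carrier Q \<Longrightarrow> g (k x) = f (dpair \<zero>\<^bsub>P\<^esub> x)"
    using projective_lift[OF Q _ _ g _ mod_hom_compose[OF j f]] a by blast
  have "g (h (dfst x) \<oplus>\<^bsub>M\<^esub> k (dsnd x)) = f x" if x: "x \<in> carrier (direct_sum P Q)" for x
  proof -
    have "g (h (dfst x) \<oplus>\<^bsub>M\<^esub> k (dsnd x)) = f (dpair (dfst x) \<zero>\<^bsub>Q\<^esub>) \<oplus>\<^bsub>N\<^esub> f (dpair \<zero>\<^bsub>P\<^esub> (dsnd x))"
      using x h k mod_hom_closed[OF h(1)] mod_hom_closed[OF k(1)] by (simp add: mod_hom_add[OF g])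
    also have "\<dots> = f (dpair (dfst x) \<zero>\<^bsub>Q\<^esub> \<oplus>\<^bsub>direct_sum P Q\<^esub> dpair \<zero>\<^bsub>P\<^esub> (dsnd x))"
      using x by (intro mod_hom_add[OF f, symmetric]) auto
    also have "\<dots> = f x" using x by simp
    finally show ?thesis .
  qed
  then show "\<exists>h\<in>mod_hom A (direct_sum P Q) M. \<forall>x\<in>carrier (direct_sum P Q). g (h x) = f x"
    by (intro bexI[OF _ mod_hom_copair[OF lmM h(1) k(1)]]) blast
qed

lemma injective_direct_sum:
  assumes I: "injective_module A I" and J: "injective_module A J"
  shows "injective_module A (direct_sum I J)"
  unfolding injective_module_def
proof (intro conjI allI ballI impI)
  show "fg_module A (direct_sum I J)" by (intro fg_module_direct_sum injective_fg assms)
  fix M N :: "('k, 'a) std_module" and g f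
  assume g: "g \<in> mod_hom A M N" and f: "f \<in> mod_hom A M (direct_sum I J)"
    and a: "fg_module A M \<and> fg_module A N \<and> inj_on g (carrier M)"
  obtain h where h: "h \<in> mod_hom A N I" "\<forall>x\<in>carrier M. h (g x) = dfst (f x)"
    using I[unfolded injective_module_def, THEN conjunct2, rule_format, OF g mod_hom_compose[OF f mod_hom_dfst]] a
    by blast
  obtain k where k: "k \<in> mod_hom A N J" "\<forall>x\<in>carrier M. k (g x) = dsnd (f x)"
    using J[unfolded injective_module_def, THEN conjunct2, rule_format, OF g mod_hom_compose[OF f mod_hom_dsnd]] a
    by blast
  show "\<exists>h\<in>mod_hom A N (direct_sum I J). \<forall>x\<in>carrier M. h (g x) = f x"
    using h(2) k(2) by (intro bexI[OF _ mod_hom_dpair[OF h(1) k(1)]]) simp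
qed

lemma projective_zero:
  fixes M :: "('k, 'a) std_module"
  assumes "fg_module A M" shows "projective_module A (M\<lparr>carrier := {\<zero>\<^bsub>M\<^esub>}\<rparr>)"
  unfolding projective_module_def
proof (intro conjI allI ballI impI)
  let ?Z = "M\<lparr>carrier := {\<zero>\<^bsub>M\<^esub>}\<rparr>"
  have lm: "left_module A M" using assms by (rule fg_left_module)
  have lmZ: "left_module A ?Z" by (rule left_module_submodule[OF lm submodule_zero[OF lm]])
  show "fg_module A ?Z" by (rule fg_submodule[OF assms submodule_zero[OF lm]])
  fix L N :: "('k, 'a) std_module" and g f
  assume g: "g \<in> mod_hom A L N" and f: "f \<in> mod_hom A ?Z N"
    and a: "fg_module A L \<and> fg_module A N \<and> g ` carrier L = carrier N"
  have lmL: "left_module A L" and lmN: "left_module A N" using a by (blast intro: fg_left_module)+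
  show "\<exists>h\<in>mod_hom A ?Z L. \<forall>x\<in>carrier ?Z. g (h x) = f x"
    using mod_hom_zero[OF lmZ lmN f] mod_hom_zero[OF lmL lmN g]
    by (intro bexI[OF _ mod_hom_zero_map[OF lmL]]) simp
qed

section \<open>Free covers\<close>

text \<open>A copy of the regular module on the type of sequences, recognised by its generator \<open>b\<close>, which
  may be sent to any element of any module.\<close>

definition rank_one_free :: "('k, 'a) std_module \<Rightarrow> (nat \<Rightarrow> 'k) \<Rightarrow> bool"
  where "rank_one_free B b \<longleftrightarrow> fg_module A B \<and> b \<in> carrier B \<and> carrier B \<subseteq> (\<lambda>a. a \<odot>\<^bsub>B\<^esub> b) ` carrier A \<and>
    (\<forall>(M :: ('k, 'a) std_module). left_module A M \<longrightarrow> (\<forall>x\<in>carrier M. \<exists>h\<in>mod_hom A B M. h b = x))"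

lemma rank_one_free_image_of_regular:
  fixes N :: "('k, 'a) std_module"
  assumes N: "fg_module A N" and e: "e \<in> mod_hom A (regular_module A) N" "inj_on e (carrier (regular_module A))"
  shows "rank_one_free (N\<lparr>carrier := e ` carrier (regular_module A)\<rparr>) (e \<one>\<^bsub>A\<^esub>)"
proof -
  have lm: "left_module A N" using N by (rule fg_left_module)
  have rc: "carrier (regular_module A) = carrier A" by (simp add: regular_module_def)
  have "abelian_group (regular_module A)"
  proof (rule abelian_groupI)
    fix x assume "x \<in> carrier (regular_module A)"
    then show "\<exists>y\<in>carrier (regular_module A). y \<oplus>\<^bsub>regular_module A\<^esub> x = \<zero>\<^bsub>regular_module A\<^esub>"
      by (intro bexI[of _ "\<ominus>\<^bsub>A\<^esub> x"]) (auto simp: regular_module_def A.l_neg)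
  qed (auto simp: regular_module_def A.a_ac)
  then have lmR: "left_module A (regular_module A)"
    by (intro left_module.intro A.ring_axioms left_module_axioms.intro)
      (auto simp: regular_module_def A.l_distr A.r_distr A.m_assoc)
  have ea: "e (a \<otimes>\<^bsub>A\<^esub> x) = a \<odot>\<^bsub>N\<^esub> e x" "e (a \<oplus>\<^bsub>A\<^esub> x) = e a \<oplus>\<^bsub>N\<^esub> e x" if "a \<in> carrier A" "x \<in> carrier A" for a x
    using mod_hom_smult[OF e(1), of a x] mod_hom_add[OF e(1), of a x] that by (auto simp: regular_module_def)
  have U: "submodule (e ` carrier A) A N"
    using submodule_image[OF lmR lm e(1) submodule_carrier[OF lmR]] by (simp add: rc)
  let ?B = "N\<lparr>carrier := e ` carrier A\<rparr>"
  have "\<exists>h\<in>mod_hom A ?B M. h (e \<one>\<^bsub>A\<^esub>) = x"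
    if M: "left_module A M" and x: "x \<in> carrier M" for M :: "('k, 'a) std_module" and x
  proof -
    interpret M: left_module A M by (rule M)
    define h where "h y = inv_into (carrier A) e y \<odot>\<^bsub>M\<^esub> x" for y
    have h: "h (e a) = a \<odot>\<^bsub>M\<^esub> x" if "a \<in> carrier A" for a
      using inv_into_f_f[OF e(2)] that by (simp add: h_def rc)
    have "h \<in> mod_hom A ?B M"
    proof (rule mod_homI)
      fix y assume "y \<in> carrier ?B" then show "h y \<in> carrier M" using x by (auto simp: h)
    next
      fix y z assume "y \<in> carrier ?B" "z \<in> carrier ?B"
      then show "h (y \<oplus>\<^bsub>?B\<^esub> z) = h y \<oplus>\<^bsub>M\<^esub> h z"
        using x by (auto simp: h M.smult_l_distr ea(2)[symmetric])
    next
      fix a y assume "a \<in> carrier A" "y \<in> carrier ?B"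
      then show "h (a \<odot>\<^bsub>?B\<^esub> y) = a \<odot>\<^bsub>M\<^esub> h y"
        using x by (auto simp: h M.smult_assoc1 ea(1)[symmetric])
    qed
    moreover have "h (e \<one>\<^bsub>A\<^esub>) = x" using h[OF A.one_closed] x by simp
    ultimately show ?thesis by blast
  qed
  moreover have "e ` carrier A \<subseteq> (\<lambda>a. a \<odot>\<^bsub>N\<^esub> e \<one>\<^bsub>A\<^esub>) ` carrier A"
    by (auto simp: ea(1)[symmetric] intro!: image_eqI)
  ultimately show ?thesis
    unfolding rank_one_free_def using fg_submodule[OF N U] by (simp add: rc)
qed

lemma projective_rank_one_free:
  assumes "rank_one_free B b" shows "projective_module A B"
  unfolding projective_module_def
proof (intro conjI allI ballI impI)
  have B: "fg_module A B" "b \<in> carrier B" "carrier B \<subseteq> (\<lambda>a. a \<odot>\<^bsub>B\<^esub> b) ` carrier A"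
    "\<And>(M :: ('k, 'a) std_module) x. left_module A M \<Longrightarrow> x \<in> carrier M \<Longrightarrow> \<exists>h\<in>mod_hom A B M. h b = x"
    using assms by (auto simp: rank_one_free_def)
  show "fg_module A B" by fact
  fix M N :: "('k, 'a) std_module" and g f
  assume g: "g \<in> mod_hom A M N" and f: "f \<in> mod_hom A B N"
    and a: "fg_module A M \<and> fg_module A N \<and> g ` carrier M = carrier N"
  have "f b \<in> g ` carrier M" using a mod_hom_closed[OF f B(2)] by simp
  then obtain m where m: "m \<in> carrier M" "f b = g m" by blast
  obtain h where h: "h \<in> mod_hom A B M" "h b = m" using B(4)[OF _ m(1)] a fg_left_module by blast
  have "g (h x) = f x" if x: "x \<in> carrier B" for x
  proof -
    from x B(3) obtain c where c: "c \<in> carrier A" "x = c \<odot>\<^bsub>B\<^esub> b" by blast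
    then show ?thesis
      using B(2) m h by (simp add: mod_hom_smult[OF h(1)] mod_hom_smult[OF f] mod_hom_smult[OF g])
  qed
  then show "\<exists>h\<in>mod_hom A B M. \<forall>x\<in>carrier B. g (h x) = f x" using h(1) by blast
qed

inductive finite_power :: "('k, 'a) std_module \<Rightarrow> ('k, 'a) std_module \<Rightarrow> bool" for B
  where base: "finite_power B B"
  | step: "finite_power B P \<Longrightarrow> finite_power B (direct_sum P B)"

lemma projective_finite_power:
  "finite_power B P \<Longrightarrow> projective_module A B \<Longrightarrow> projective_module A P"
  by (induction rule: finite_power.induct) (auto intro: projective_direct_sum)

text \<open>A map from a power of \<open>B\<close> with image of maximal length is onto, because one more copy
  of \<open>B\<close> reaches any given element.\<close>

lemma ex_free_cover:
  fixes M :: "('k, 'a) std_module"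
  assumes B: "rank_one_free B b" and M: "fg_module A M"
  obtains P g where "finite_power B P" "g \<in> mod_hom A P M" "g ` carrier P = carrier M"
proof -
  have lm: "left_module A M" using M by (rule fg_left_module)
  interpret M: left_module A M by (rule lm)
  have Bb: "b \<in> carrier B" "\<And>x. x \<in> carrier M \<Longrightarrow> \<exists>h\<in>mod_hom A B M. h b = x"
    using B lm by (auto simp: rank_one_free_def)
  have lmp: "left_module A P" if "finite_power B P" for P
    using projective_left_module projective_finite_power[OF that projective_rank_one_free[OF B]] by blast
  obtain \<mu> :: "(nat \<Rightarrow> 'k) set \<Rightarrow> nat"
    where \<mu>: "\<forall>U V. submodule U A M \<and> submodule V A M \<and> U \<subset> V \<longrightarrow> \<mu> U < \<mu> V"
    using length_function[OF M] by blast
  define good where "good z \<longleftrightarrow> finite_power B (fst z) \<and> snd z \<in> mod_hom A (fst z) M" for z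
  define im where "im z = snd z ` carrier (fst z)" for z :: "('k, 'a) std_module \<times> ((nat \<Rightarrow> 'k) \<Rightarrow> nat \<Rightarrow> 'k)"
  have im: "submodule (im z) A M" if "good z" for z
    using that unfolding good_def im_def
    by (intro submodule_image[OF lmp lm _ submodule_carrier[OF lmp]]) auto
  have g0: "good (B, \<lambda>_. \<zero>\<^bsub>M\<^esub>)" using mod_hom_zero_map[OF lm] by (auto simp: good_def intro: finite_power.base)
  have "\<exists>z. good z \<and> (\<forall>w. good w \<longrightarrow> \<mu> (im w) \<le> \<mu> (im z))"
    by (rule ex_has_greatest_nat[of good, OF g0, of _ "Suc (\<mu> (carrier M))"])
      (use length_bound[OF \<mu> lm im] in \<open>simp add: less_Suc_eq_le\<close>)
  then obtain z where z: "good z" and max: "\<And>w. good w \<Longrightarrow> \<mu> (im w) \<le> \<mu> (im z)" by blast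
  obtain P g where zz: "z = (P, g)" by fastforce
  have P: "finite_power B P" and g: "g \<in> mod_hom A P M" using z zz by (auto simp: good_def)
  interpret P: left_module A P by (rule lmp[OF P])
  interpret B: left_module A B by (rule lmp[OF finite_power.base])
  have "x \<in> g ` carrier P" if x: "x \<in> carrier M" for x
  proof (rule ccontr)
    assume n: "x \<notin> g ` carrier P"
    obtain h where h: "h \<in> mod_hom A B M" "h b = x" using Bb(2)[OF x] by blast
    let ?f = "\<lambda>y. g (dfst y) \<oplus>\<^bsub>M\<^esub> h (dsnd y)"
    have f: "?f \<in> mod_hom A (direct_sum P B) M" by (rule mod_hom_copair[OF lm g h(1)])
    have w: "good (direct_sum P B, ?f)" using f P by (auto simp: good_def intro: finite_power.step)
    have "g y \<in> im (direct_sum P B, ?f)" if "y \<in> carrier P" for y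
      using that mod_hom_closed[OF g that] mod_hom_zero[OF B.left_module_axioms lm h(1)]
      by (auto simp: im_def intro!: image_eqI[of _ _ "dpair y \<zero>\<^bsub>B\<^esub>"])
    then have "im z \<subseteq> im (direct_sum P B, ?f)" by (auto simp: im_def zz)
    moreover have "x \<in> im (direct_sum P B, ?f)"
      using x h Bb(1) mod_hom_zero[OF P.left_module_axioms lm g]
      by (auto simp: im_def intro!: image_eqI[of _ _ "dpair \<zero>\<^bsub>P\<^esub> b"])
    moreover have "x \<notin> im z" using n by (simp add: im_def zz)
    ultimately have "im z \<subset> im (direct_sum P B, ?f)" by blast
    then have "\<mu> (im z) < \<mu> (im (direct_sum P B, ?f))" using \<mu> im[OF z] im[OF w] by blast
    then show False using max[OF w] by simp
  qed
  then have "g ` carrier P = carrier M" using mod_hom_closed[OF g] by blast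
  then show ?thesis using that P g by blast
qed

lemma projective_summand_of_free:
  assumes B: "rank_one_free B b" and P: "projective_module A P"
  obtains F where "finite_power B F" "summand A P F"
proof -
  obtain F g where F: "finite_power B F" and g: "g \<in> mod_hom A F P" "g ` carrier F = carrier P"
    by (rule ex_free_cover[OF B projective_fg[OF P]])
  have fgF: "fg_module A F" by (intro projective_fg projective_finite_power[OF F] projective_rank_one_free[OF B])
  obtain h where h: "h \<in> mod_hom A P F" "\<And>x. x \<in> carrier P \<Longrightarrow> g (h x) = x"
    using projective_lift[OF P fgF projective_fg[OF P] g mod_hom_id] by blast
  have "summand A P F" by (rule summandI[OF h(1) g(1)]) (rule h(2))
  then show ?thesis by (rule that[OF F])
qed

section \<open>Projective dimension\<close>

text \<open>Here \<open>pd_le d M\<close> expresses that the projective dimension of \<open>M\<close> is at most \<open>d\<close>. Closure under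
  direct summands is built into the recursion because comparing the kernels of two surjections from
  projective modules gives a direct summand rather than an isomorphism (\<open>kernel_summand\<close> below).\<close>

fun pd_le :: "nat \<Rightarrow> ('k, 'a) std_module \<Rightarrow> bool"
  where "pd_le 0 M \<longleftrightarrow> projective_module A M"
  | "pd_le (Suc d) M \<longleftrightarrow> fg_module A M \<and> (\<exists>P (Y :: ('k, 'a) std_module) g. projective_module A P \<and> fg_module A Y \<and>
      g \<in> mod_hom A P Y \<and> g ` carrier P = carrier Y \<and> summand A M Y \<and>
      pd_le d (P\<lparr>carrier := a_kernel P Y g\<rparr>))"

lemma pd_le_fg: "pd_le d M \<Longrightarrow> fg_module A M"
  by (cases d) (auto intro: projective_fg)

lemma pd_le_summand: "pd_le d M \<Longrightarrow> fg_module A N \<Longrightarrow> summand A N M \<Longrightarrow> pd_le d N"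
  by (cases d) (auto intro: projective_summand summand_trans)

lemma pd_le_projective: "projective_module A P \<Longrightarrow> pd_le d P"
proof (induction d arbitrary: P)
  case (Suc d)
  have "a_kernel P P (\<lambda>x. x) = {\<zero>\<^bsub>P\<^esub>}"
    using submodule_facts(2)[OF submodule_carrier[OF projective_left_module[OF Suc.prems]]]
    by (auto simp: a_kernel_eq)
  then show ?case
    using Suc projective_fg[OF Suc.prems] Suc.IH[OF projective_zero[OF projective_fg[OF Suc.prems]]]
    by (auto simp: summand_refl mod_hom_id intro!: exI[of _ P] exI[of _ "\<lambda>x. x"])
qed simp

text \<open>The added \<open>Q\<close> can be covered by itself, which does not change the kernel.\<close>

lemma pd_le_direct_sum_projective:
  assumes "projective_module A Q"
  shows "pd_le d M \<Longrightarrow> pd_le d (direct_sum M Q)"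
proof (cases d)
  case 0
  assume "pd_le d M"
  then show ?thesis using 0 assms by (simp add: projective_direct_sum)
next
  case (Suc d')
  assume "pd_le d M"
  then obtain P and Y :: "('k, 'a) std_module" and g where P: "projective_module A P" and Y: "fg_module A Y" and g: "g \<in> mod_hom A P Y"
    "g ` carrier P = carrier Y" and s: "summand A M Y" and k: "pd_le d' (P\<lparr>carrier := a_kernel P Y g\<rparr>)"
    and M: "fg_module A M"
    by (auto simp: Suc)
  have lmP: "left_module A P" and lmQ: "left_module A Q" and lmY: "left_module A Y"
    using P assms Y by (auto intro: fg_left_module projective_left_module)
  interpret P: left_module A P by fact
  interpret Q: left_module A Q by fact
  interpret Y: left_module A Y by fact
  from s obtain i p where ip: "i \<in> mod_hom A M Y" "p \<in> mod_hom A Y M" "\<And>x. x \<in> carrier M \<Longrightarrow> p (i x) = x"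
    by (auto simp: summand_def)
  let ?i = "\<lambda>x. dpair (i (dfst x)) (dsnd x)" and ?p = "\<lambda>x. dpair (p (dfst x)) (dsnd x)"
    and ?g = "\<lambda>x. dpair (g (dfst x)) (dsnd x)"
  have i': "?i \<in> mod_hom A (direct_sum M Q) (direct_sum Y Q)"
    by (rule mod_hom_dpair[OF mod_hom_compose[OF mod_hom_dfst ip(1)] mod_hom_dsnd])
  have p': "?p \<in> mod_hom A (direct_sum Y Q) (direct_sum M Q)"
    by (rule mod_hom_dpair[OF mod_hom_compose[OF mod_hom_dfst ip(2)] mod_hom_dsnd])
  have g': "?g \<in> mod_hom A (direct_sum P Q) (direct_sum Y Q)"
    by (rule mod_hom_dpair[OF mod_hom_compose[OF mod_hom_dfst g(1)] mod_hom_dsnd])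
  have s': "summand A (direct_sum M Q) (direct_sum Y Q)"
    by (rule summandI[OF i' p']) (auto simp: ip(3))
  have "y \<in> ?g ` carrier (direct_sum P Q)" if y: "y \<in> carrier (direct_sum Y Q)" for y
  proof -
    have "dfst y \<in> g ` carrier P" using y g(2) by simp
    then obtain x where "x \<in> carrier P" "dfst y = g x" by blast
    then show ?thesis using y by (intro image_eqI[of _ _ "dpair x (dsnd y)"]) (auto dest: sym)
  qed
  then have gs: "?g ` carrier (direct_sum P Q) = carrier (direct_sum Y Q)"
    using mod_hom_closed[OF g'] by blast
  let ?K = "(direct_sum P Q)\<lparr>carrier := a_kernel (direct_sum P Q) (direct_sum Y Q) ?g\<rparr>" and ?L = "P\<lparr>carrier := a_kernel P Y g\<rparr>"
  have fgK: "fg_module A ?K"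
    by (intro fg_submodule fg_module_direct_sum projective_fg P assms submodule_kernel[OF _ _ g'] left_module_direct_sum lmP lmQ lmY)
  have 1: "dfst \<in> mod_hom A ?K ?L" by (rule mod_homI) (auto simp: a_kernel_eq)
  have 2: "(\<lambda>x. dpair x \<zero>\<^bsub>Q\<^esub>) \<in> mod_hom A ?L ?K"
    by (rule mod_homI) (auto simp: a_kernel_eq Q.smult_r_null)
  have "dpair (dfst x) \<zero>\<^bsub>Q\<^esub> = x" if "x \<in> carrier ?K" for x
  proof -
    have "dsnd x = \<zero>\<^bsub>Q\<^esub>" using that by (simp add: a_kernel_eq)
    then show ?thesis using dpair_dfst_dsnd[of x] by simp
  qed
  then have "summand A ?K ?L" by (rule summandI[OF 1 2])
  then have "pd_le d' ?K" by (rule pd_le_summand[OF k fgK])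
  then show ?thesis
    unfolding Suc pd_le.simps
    using projective_direct_sum[OF P assms] fg_module_direct_sum[OF Y projective_fg[OF assms]]
      fg_module_direct_sum[OF M projective_fg[OF assms]] g' gs s' by blast
qed

text \<open>Schanuel's lemma in the form of a homotopy: lift the inclusion of \<open>M\<close> into \<open>Y\<close> and the
  projection back to maps \<open>a : Q \<rightarrow> P\<close> and \<open>b : P \<rightarrow> Q\<close>. Then \<open>1 - b a\<close> maps \<open>Q\<close> into the kernel of \<open>h\<close>, so that on
  this kernel the identity is the sum of \<open>b a\<close>, which factors through the kernel of \<open>g\<close>, and of
  a map that factors through \<open>Q\<close>.\<close>

lemma kernel_summand:
  fixes M Y :: "('k, 'a) std_module"
  assumes P: "projective_module A P" and Y: "fg_module A Y" and g: "g \<in> mod_hom A P Y" "g ` carrier P = carrier Y"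
    and s: "summand A M Y"
    and Q: "projective_module A Q" and M: "fg_module A M" and h: "h \<in> mod_hom A Q M" "h ` carrier Q = carrier M"
  shows "summand A (Q\<lparr>carrier := a_kernel Q M h\<rparr>) (direct_sum (P\<lparr>carrier := a_kernel P Y g\<rparr>) Q)"
proof -
  have lmP: "left_module A P" and lmQ: "left_module A Q" and lmY: "left_module A Y" and lmM: "left_module A M"
    using P Q Y M by (auto intro: fg_left_module projective_left_module)
  interpret Q: left_module A Q by fact
  interpret M: left_module A M by fact
  let ?L = "Q\<lparr>carrier := a_kernel Q M h\<rparr>" and ?K = "P\<lparr>carrier := a_kernel P Y g\<rparr>"
  have kerQ: "submodule (a_kernel Q M h) A Q" by (rule submodule_kernel[OF lmQ lmM h(1)])
  have kerP: "submodule (a_kernel P Y g) A P" by (rule submodule_kernel[OF lmP lmY g(1)])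
  have lmL: "left_module A ?L" by (rule left_module_submodule[OF lmQ kerQ])
  from s obtain i p where i: "i \<in> mod_hom A M Y" and p: "p \<in> mod_hom A Y M"
    and pi: "\<And>x. x \<in> carrier M \<Longrightarrow> p (i x) = x"
    by (auto simp: summand_def)
  obtain a where a: "a \<in> mod_hom A Q P" "\<And>x. x \<in> carrier Q \<Longrightarrow> g (a x) = i (h x)"
    using projective_lift[OF Q projective_fg[OF P] Y g mod_hom_compose[OF h(1) i]] by blast
  obtain b where b: "b \<in> mod_hom A P Q" "\<And>x. x \<in> carrier P \<Longrightarrow> h (b x) = p (g x)"
    using projective_lift[OF P projective_fg[OF Q] M h mod_hom_compose[OF g(1) p]] by blast
  note ac = mod_hom_closed[OF a(1)] and bc = mod_hom_closed[OF b(1)] and hc = mod_hom_closed[OF h(1)]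
  note ab = mod_hom_compose[OF a(1) b(1)]
  define c where "c x = x \<ominus>\<^bsub>Q\<^esub> b (a x)" for x
  have cQ: "c \<in> mod_hom A Q Q" unfolding c_def by (rule mod_hom_diff[OF lmQ mod_hom_id ab])
  have c: "c \<in> mod_hom A Q ?L"
  proof (rule mod_hom_into_sub[OF cQ])
    fix x assume x: "x \<in> carrier Q"
    have "h (c x) = \<zero>\<^bsub>M\<^esub>"
      using x ac bc hc a(2) b(2) pi
      by (simp add: c_def mod_hom_minus[OF lmQ lmM h(1)] M.M.minus_eq_zero_iff)
    then show "c x \<in> a_kernel Q M h" using mod_hom_closed[OF cQ x] by (simp add: a_kernel_eq)
  qed
  have aL: "a \<in> mod_hom A ?L ?K"
  proof (rule mod_hom_into_sub[OF mod_hom_from_sub[OF a(1) kerQ]])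
    fix x assume "x \<in> carrier ?L"
    then show "a x \<in> a_kernel P Y g"
      using ac a(2) mod_hom_zero[OF lmM lmY i] by (simp add: a_kernel_eq)
  qed
  have bK: "b \<in> mod_hom A ?K ?L"
  proof (rule mod_hom_into_sub[OF mod_hom_from_sub[OF b(1) kerP]])
    fix x assume "x \<in> carrier ?K"
    then show "b x \<in> a_kernel Q M h"
      using bc b(2) mod_hom_zero[OF lmY lmM p] by (simp add: a_kernel_eq)
  qed
  have 1: "(\<lambda>x. dpair (a x) x) \<in> mod_hom A ?L (direct_sum ?K Q)"
    by (rule mod_hom_dpair[OF aL mod_hom_from_sub[OF mod_hom_id kerQ]])
  have 2: "(\<lambda>x. b (dfst x) \<oplus>\<^bsub>?L\<^esub> c (dsnd x)) \<in> mod_hom A (direct_sum ?K Q) ?L"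
    by (rule mod_hom_copair[OF lmL bK c])
  show ?thesis
  proof (rule summandI[OF 1 2])
    fix x assume "x \<in> carrier ?L"
    then have "x \<in> carrier Q" by (simp add: a_kernel_eq)
    then show "b (dfst (dpair (a x) x)) \<oplus>\<^bsub>?L\<^esub> c (dsnd (dpair (a x) x)) = x"
      using ac bc by (simp add: c_def Q.M.add_minus_cancel)
  qed
qed

lemma pd_le_kernel:
  assumes M: "pd_le (Suc d) M" and Q: "projective_module A Q"
    and h: "h \<in> mod_hom A Q M" "h ` carrier Q = carrier M"
  shows "pd_le d (Q\<lparr>carrier := a_kernel Q M h\<rparr>)"
proof -
  have fgM: "fg_module A M" using M by (rule pd_le_fg)
  from M obtain P and Y :: "('k, 'a) std_module" and g where P: "projective_module A P" and Y: "fg_module A Y" and g: "g \<in> mod_hom A P Y"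
    "g ` carrier P = carrier Y" and s: "summand A M Y" and k: "pd_le d (P\<lparr>carrier := a_kernel P Y g\<rparr>)"
    by auto
  have "fg_module A (Q\<lparr>carrier := a_kernel Q M h\<rparr>)"
    by (intro fg_submodule projective_fg Q submodule_kernel[OF _ _ h(1)] projective_left_module fg_left_module fgM)
  then show ?thesis
    by (rule pd_le_summand[OF pd_le_direct_sum_projective[OF Q k] _ kernel_summand[OF P Y g s Q fgM h]])
qed

text \<open>Cutting off \<open>P 0\<close> leaves a resolution of the kernel of the augmentation \<open>e\<close>.\<close>

lemma projective_resolution_pd_le:
  fixes M :: "('k, 'a) std_module"
  assumes "projective_resolution A M P e d" "\<forall>i>l. carrier (P i) = {\<zero>\<^bsub>P i\<^esub>}" "fg_module A M"
  shows "pd_le l M"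
  using assms
proof (induction l arbitrary: M P e d)
  case 0
  have P: "projective_module A (P i)" for i using 0 by (simp add: projective_resolution_def)
  have e: "e \<in> mod_hom A (P 0) M" "e ` carrier (P 0) = carrier M"
    and d: "d 0 \<in> mod_hom A (P (Suc 0)) (P 0)" and k: "d 0 ` carrier (P (Suc 0)) = a_kernel (P 0) M e"
    using 0 by (auto simp: projective_resolution_def)
  have lmM: "left_module A M" using 0 by (blast intro: fg_left_module)
  have lm: "left_module A (P i)" for i by (rule projective_left_module[OF P])
  have "a_kernel (P 0) M e = {\<zero>\<^bsub>P 0\<^esub>}"
    using k 0(2) mod_hom_zero[OF lm lm d] by simp
  then have "inj_on e (carrier (P 0))"
    unfolding inj_on_mod_hom_iff[OF lm lmM e(1)] by (auto simp: a_kernel_eq)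
  then have "summand A M (P 0)" by (intro summand_of_iso(2)[OF lm e(1)]) (simp add: bij_betw_def e)
  then show ?case using projective_summand[OF P] 0 by simp
next
  case (Suc l)
  have P: "projective_module A (P i)" for i using Suc.prems by (simp add: projective_resolution_def)
  have e: "e \<in> mod_hom A (P 0) M" "e ` carrier (P 0) = carrier M"
    and d: "\<And>i. d i \<in> mod_hom A (P (Suc i)) (P i)" and k: "d 0 ` carrier (P (Suc 0)) = a_kernel (P 0) M e"
    and ks: "\<And>i. d (Suc i) ` carrier (P (Suc (Suc i))) = a_kernel (P (Suc i)) (P i) (d i)"
    using Suc.prems by (auto simp: projective_resolution_def)
  let ?K = "(P 0)\<lparr>carrier := a_kernel (P 0) M e\<rparr>"
  have d0: "d 0 \<in> mod_hom A (P (Suc 0)) ?K" using k by (intro mod_hom_into_sub[OF d]) blast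
  have "projective_resolution A ?K (\<lambda>i. P (Suc i)) (d 0) (\<lambda>i. d (Suc i))"
    unfolding projective_resolution_def using P d0 d k ks by (auto simp: a_kernel_eq)
  moreover have "fg_module A ?K"
    by (intro fg_submodule projective_fg P submodule_kernel[OF _ _ e(1)] projective_left_module
        fg_left_module Suc.prems)
  ultimately have "pd_le l ?K" using Suc.IH Suc.prems(2) by simp
  then show ?case using P e Suc.prems(3) summand_refl[of A M] by auto
qed

lemma proj_dim_pd_le:
  fixes M :: "('k, 'a) std_module"
  assumes "fg_module A M" "proj_dim A M \<le> enat d" shows "pd_le d M"
proof -
  have "proj_dim A M < enat (Suc d)" using assms(2) by (simp add: order_le_less_trans)
  then obtain l P e dd where l: "enat l < enat (Suc d)" and r: "projective_resolution A M P e dd"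
    and z: "\<forall>i>l. carrier (P i) = {\<zero>\<^bsub>P i\<^esub>}"
    unfolding proj_dim_def Inf_less_iff by blast
  have "\<forall>i>d. carrier (P i) = {\<zero>\<^bsub>P i\<^esub>}" using z l by auto
  then show ?thesis by (rule projective_resolution_pd_le[OF r _ assms(1)])
qed

end

section \<open>Vanishing of extensions\<close>

text \<open>A projective resolution \<open>\<cdots> \<rightarrow> C 2 \<rightarrow> C 1\<close> of some module, continued by \<open>C 0 = 0\<close>. The zero
  at the end makes \<open>Hom\<close> out of the resolved module the case \<open>i = 0\<close> of the cohomology below.\<close>

locale shifted_resolution = fin_dim_algebra K A
  for K :: "'k ring" (structure) and A :: "('k, 'a) module" (structure) +
  fixes C :: "nat \<Rightarrow> ('k, 'a) std_module" and d :: "nat \<Rightarrow> (nat \<Rightarrow> 'k) \<Rightarrow> nat \<Rightarrow> 'k"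
  assumes C: "projective_module A (C i)"
    and d: "d i \<in> mod_hom A (C (Suc i)) (C i)"
    and C0: "carrier (C 0) = {\<zero>\<^bsub>C 0\<^esub>}"
    and dd: "x \<in> carrier (C (Suc (Suc i))) \<Longrightarrow> d i (d (Suc i) x) = \<zero>\<^bsub>C i\<^esub>"
    and exact: "x \<in> carrier (C (Suc (Suc i))) \<Longrightarrow> d (Suc i) x = \<zero>\<^bsub>C (Suc i)\<^esub> \<Longrightarrow>
      x \<in> d (Suc (Suc i)) ` carrier (C (Suc (Suc (Suc i))))"
begin

lemma lmC: "left_module A (C i)"
  by (rule projective_left_module[OF C])

text \<open>Vanishing of \<open>Ext\<close> of degree \<open>i\<close> from the resolved module to \<open>M\<close>.\<close>

definition ext_vanish :: "nat \<Rightarrow> ('k, 'a) std_module \<Rightarrow> bool"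
  where "ext_vanish i M \<longleftrightarrow> (\<forall>f\<in>mod_hom A (C (Suc i)) M.
    (\<forall>x\<in>carrier (C (Suc (Suc i))). f (d (Suc i) x) = \<zero>\<^bsub>M\<^esub>) \<longrightarrow>
    (\<exists>h\<in>mod_hom A (C i) M. \<forall>x\<in>carrier (C (Suc i)). h (d i x) = f x))"

lemma ext_vanishI:
  assumes "\<And>f. f \<in> mod_hom A (C (Suc i)) M \<Longrightarrow>
      (\<And>x. x \<in> carrier (C (Suc (Suc i))) \<Longrightarrow> f (d (Suc i) x) = \<zero>\<^bsub>M\<^esub>) \<Longrightarrow>
      \<exists>h\<in>mod_hom A (C i) M. \<forall>x\<in>carrier (C (Suc i)). h (d i x) = f x"
  shows "ext_vanish i M"
  using assms unfolding ext_vanish_def by blast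

lemma ext_vanishD:
  assumes "ext_vanish i M" "f \<in> mod_hom A (C (Suc i)) M"
    and "\<And>x. x \<in> carrier (C (Suc (Suc i))) \<Longrightarrow> f (d (Suc i) x) = \<zero>\<^bsub>M\<^esub>"
  shows "\<exists>h\<in>mod_hom A (C i) M. \<forall>x\<in>carrier (C (Suc i)). h (d i x) = f x"
  using assms unfolding ext_vanish_def by blast

lemma ext_vanish_0D:
  assumes "ext_vanish 0 M" "left_module A M" "f \<in> mod_hom A (C (Suc 0)) M"
    and "\<And>x. x \<in> carrier (C (Suc (Suc 0))) \<Longrightarrow> f (d (Suc 0) x) = \<zero>\<^bsub>M\<^esub>"
    and x: "x \<in> carrier (C (Suc 0))"
  shows "f x = \<zero>\<^bsub>M\<^esub>"
proof -
  obtain h where h: "h \<in> mod_hom A (C 0) M" "\<And>x. x \<in> carrier (C (Suc 0)) \<Longrightarrow> h (d 0 x) = f x"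
    using ext_vanishD[OF assms(1,3)] assms(4) by blast
  have "d 0 x = \<zero>\<^bsub>C 0\<^esub>" using mod_hom_closed[OF d x] C0 by blast
  then show ?thesis using h(2)[OF x] mod_hom_zero[OF lmC assms(2) h(1)] by simp
qed

lemma ext_vanish_0I:
  assumes "left_module A M"
    and "\<And>f x. f \<in> mod_hom A (C (Suc 0)) M \<Longrightarrow>
      (\<And>x. x \<in> carrier (C (Suc (Suc 0))) \<Longrightarrow> f (d (Suc 0) x) = \<zero>\<^bsub>M\<^esub>) \<Longrightarrow>
      x \<in> carrier (C (Suc 0)) \<Longrightarrow> f x = \<zero>\<^bsub>M\<^esub>"
  shows "ext_vanish 0 M"
  using assms(2) by (intro ext_vanishI bexI[OF _ mod_hom_zero_map[OF assms(1)]]) auto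

lemma ext_vanish_0_submodule:
  assumes "ext_vanish 0 M" "left_module A M" "submodule U A M"
  shows "ext_vanish 0 (M\<lparr>carrier := U\<rparr>)"
proof (rule ext_vanish_0I)
  show "left_module A (M\<lparr>carrier := U\<rparr>)" by (rule left_module_submodule[OF assms(2,3)])
  fix f x assume f: "f \<in> mod_hom A (C (Suc 0)) (M\<lparr>carrier := U\<rparr>)"
    and z: "\<And>x. x \<in> carrier (C (Suc (Suc 0))) \<Longrightarrow> f (d (Suc 0) x) = \<zero>\<^bsub>M\<lparr>carrier := U\<rparr>\<^esub>"
    and x: "x \<in> carrier (C (Suc 0))"
  show "f x = \<zero>\<^bsub>M\<lparr>carrier := U\<rparr>\<^esub>"
    using ext_vanish_0D[OF assms(1,2) mod_hom_sub_incl[OF f assms(3)] _ x] z by simp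
qed

text \<open>The next two lemmas are the pieces of the long exact sequence at the kernel and at the
  cokernel of a short exact sequence \<open>0 \<rightarrow> ker p \<rightarrow> M \<rightarrow> N \<rightarrow> 0\<close>.\<close>

lemma ext_vanish_kernel:
  fixes M N :: "('k, 'a) std_module"
  assumes M: "fg_module A M" and N: "fg_module A N" and p: "p \<in> mod_hom A M N" "p ` carrier M = carrier N"
    and vM: "ext_vanish (Suc i) M" and vN: "ext_vanish i N"
  shows "ext_vanish (Suc i) (M\<lparr>carrier := a_kernel M N p\<rparr>)"
proof (rule ext_vanishI)
  have lmM: "left_module A M" and lmN: "left_module A N" using M N by (auto intro: fg_left_module)
  interpret M: left_module A M by fact
  interpret N: left_module A N by fact
  let ?K = "M\<lparr>carrier := a_kernel M N p\<rparr>"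
  have ker: "submodule (a_kernel M N p) A M" by (rule submodule_kernel[OF lmM lmN p(1)])
  \<comment> \<open>In \<open>M\<close> the cocycle \<open>f\<close> is the coboundary of some \<open>g\<close>. The image of \<open>g\<close> in \<open>N\<close> is a cocycle, hence
    a coboundary; lifting the latter to \<open>M\<close> gives the correction that moves \<open>g\<close> into the kernel.\<close>
  fix f assume f: "f \<in> mod_hom A (C (Suc (Suc i))) ?K"
    and z: "\<And>x. x \<in> carrier (C (Suc (Suc (Suc i)))) \<Longrightarrow> f (d (Suc (Suc i)) x) = \<zero>\<^bsub>?K\<^esub>"
  obtain g where g: "g \<in> mod_hom A (C (Suc i)) M"
    "\<And>x. x \<in> carrier (C (Suc (Suc i))) \<Longrightarrow> g (d (Suc i) x) = f x"
    using ext_vanishD[OF vM mod_hom_sub_incl[OF f ker]] z by auto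
  have fk: "p (f x) = \<zero>\<^bsub>N\<^esub>" if "x \<in> carrier (C (Suc (Suc i)))" for x
    using mod_hom_closed[OF f that] by (simp add: a_kernel_eq)
  obtain h where h: "h \<in> mod_hom A (C i) N" "\<And>x. x \<in> carrier (C (Suc i)) \<Longrightarrow> h (d i x) = p (g x)"
    using ext_vanishD[OF vN mod_hom_compose[OF g(1) p(1)]] g(2) fk by auto
  obtain h' where h': "h' \<in> mod_hom A (C i) M" "\<And>x. x \<in> carrier (C i) \<Longrightarrow> p (h' x) = h x"
    using projective_lift[OF C M N p h(1)] by blast
  note gc = mod_hom_closed[OF g(1)] and hc = mod_hom_closed[OF h'(1)] and dc = mod_hom_closed[OF d]
  define k where "k x = g x \<ominus>\<^bsub>M\<^esub> h' (d i x)" for x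
  have kM: "k \<in> mod_hom A (C (Suc i)) M"
    unfolding k_def by (rule mod_hom_diff[OF lmM g(1) mod_hom_compose[OF d h'(1)]])
  have "k \<in> mod_hom A (C (Suc i)) ?K"
  proof (rule mod_hom_into_sub[OF kM])
    fix x assume x: "x \<in> carrier (C (Suc i))"
    have "p (k x) = \<zero>\<^bsub>N\<^esub>"
      using x gc hc dc h'(2) h(2) mod_hom_closed[OF p(1)]
      by (simp add: k_def mod_hom_minus[OF lmM lmN p(1)] N.M.minus_eq_zero_iff)
    then show "k x \<in> a_kernel M N p" using mod_hom_closed[OF kM x] by (simp add: a_kernel_eq)
  qed
  moreover have "k (d (Suc i) x) = f x" if x: "x \<in> carrier (C (Suc (Suc i)))" for x
    using g(2)[OF x] dd[OF x] mod_hom_zero[OF lmC lmM h'(1)]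
      mod_hom_closed[OF mod_hom_sub_incl[OF f ker] x]
    by (simp add: k_def M.M.minus_zero_right)
  ultimately show "\<exists>h\<in>mod_hom A (C (Suc i)) ?K. \<forall>x\<in>carrier (C (Suc (Suc i))). h (d (Suc i) x) = f x"
    by blast
qed

lemma ext_vanish_cokernel:
  fixes M N :: "('k, 'a) std_module"
  assumes M: "fg_module A M" and N: "fg_module A N" and p: "p \<in> mod_hom A M N" "p ` carrier M = carrier N"
    and vM: "ext_vanish i M" and vK: "ext_vanish (Suc i) (M\<lparr>carrier := a_kernel M N p\<rparr>)"
  shows "ext_vanish i N"
proof (rule ext_vanishI)
  have lmM: "left_module A M" and lmN: "left_module A N" using M N by (auto intro: fg_left_module)
  interpret M: left_module A M by fact
  interpret N: left_module A N by fact
  let ?K = "M\<lparr>carrier := a_kernel M N p\<rparr>"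
  have ker: "submodule (a_kernel M N p) A M" by (rule submodule_kernel[OF lmM lmN p(1)])
  \<comment> \<open>A lift \<open>F\<close> of \<open>f\<close> need not be a cocycle, but its coboundary has values in the kernel. There it
    is also the coboundary of some \<open>G\<close>, and \<open>F - G\<close> is a cocycle that still lifts \<open>f\<close>.\<close>
  fix f assume f: "f \<in> mod_hom A (C (Suc i)) N"
    and z: "\<And>x. x \<in> carrier (C (Suc (Suc i))) \<Longrightarrow> f (d (Suc i) x) = \<zero>\<^bsub>N\<^esub>"
  obtain F where F: "F \<in> mod_hom A (C (Suc i)) M" "\<And>x. x \<in> carrier (C (Suc i)) \<Longrightarrow> p (F x) = f x"
    using projective_lift[OF C M N p f] by blast
  note Fd = mod_hom_compose[OF d F(1)] and Fc = mod_hom_closed[OF F(1)] and dc = mod_hom_closed[OF d]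
  have FK: "(\<lambda>x. F (d (Suc i) x)) \<in> mod_hom A (C (Suc (Suc i))) ?K"
    by (rule mod_hom_into_sub[OF Fd]) (use F(2) Fc dc z in \<open>simp add: a_kernel_eq\<close>)
  obtain G where G: "G \<in> mod_hom A (C (Suc i)) ?K"
    "\<And>x. x \<in> carrier (C (Suc (Suc i))) \<Longrightarrow> G (d (Suc i) x) = F (d (Suc i) x)"
    using ext_vanishD[OF vK FK] dd mod_hom_zero[OF lmC lmM F(1)] by auto
  have GM: "G \<in> mod_hom A (C (Suc i)) M" by (rule mod_hom_sub_incl[OF G(1) ker])
  obtain h where h: "h \<in> mod_hom A (C i) M" "\<And>x. x \<in> carrier (C (Suc i)) \<Longrightarrow> h (d i x) = F x \<ominus>\<^bsub>M\<^esub> G x"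
    using ext_vanishD[OF vM mod_hom_diff[OF lmM F(1) GM]] G(2) Fc dc
    by (auto simp: M.M.minus_eq_zero_iff)
  have "p (h (d i x)) = f x" if x: "x \<in> carrier (C (Suc i))" for x
  proof -
    have "p (G x) = \<zero>\<^bsub>N\<^esub>" using mod_hom_closed[OF G(1) x] by (simp add: a_kernel_eq)
    then show ?thesis
      using h(2)[OF x] F(2)[OF x] Fc[OF x] mod_hom_closed[OF GM x] mod_hom_closed[OF f x]
      by (simp add: mod_hom_minus[OF lmM lmN p(1)] N.M.minus_zero_right)
  qed
  then show "\<exists>h\<in>mod_hom A (C i) N. \<forall>x\<in>carrier (C (Suc i)). h (d i x) = f x"
    by (intro bexI[OF _ mod_hom_compose[OF h(1) p(1)]]) blast
qed

lemma ext_vanish_summand: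
  fixes M N :: "('k, 'a) std_module"
  assumes v: "ext_vanish i M" and s: "summand A N M" and lm: "left_module A M" "left_module A N"
  shows "ext_vanish i N"
proof (rule ext_vanishI)
  from s obtain a b where a: "a \<in> mod_hom A N M" and b: "b \<in> mod_hom A M N"
    and ba: "\<And>x. x \<in> carrier N \<Longrightarrow> b (a x) = x"
    by (auto simp: summand_def)
  fix f assume f: "f \<in> mod_hom A (C (Suc i)) N"
    and z: "\<And>x. x \<in> carrier (C (Suc (Suc i))) \<Longrightarrow> f (d (Suc i) x) = \<zero>\<^bsub>N\<^esub>"
  obtain h where h: "h \<in> mod_hom A (C i) M" "\<And>x. x \<in> carrier (C (Suc i)) \<Longrightarrow> h (d i x) = a (f x)"
    using ext_vanishD[OF v mod_hom_compose[OF f a]] z mod_hom_zero[OF lm(2,1) a] by auto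
  show "\<exists>h\<in>mod_hom A (C i) N. \<forall>x\<in>carrier (C (Suc i)). h (d i x) = f x"
    using h(2) ba mod_hom_closed[OF f] by (intro bexI[OF _ mod_hom_compose[OF h(1) b]]) simp
qed

lemma ext_vanish_direct_sum:
  assumes "ext_vanish i M" "ext_vanish i N" shows "ext_vanish i (direct_sum M N)"
proof (rule ext_vanishI)
  fix f assume f: "f \<in> mod_hom A (C (Suc i)) (direct_sum M N)"
    and z: "\<And>x. x \<in> carrier (C (Suc (Suc i))) \<Longrightarrow> f (d (Suc i) x) = \<zero>\<^bsub>direct_sum M N\<^esub>"
  obtain h where h: "h \<in> mod_hom A (C i) M" "\<And>x. x \<in> carrier (C (Suc i)) \<Longrightarrow> h (d i x) = dfst (f x)"
    using ext_vanishD[OF assms(1) mod_hom_compose[OF f mod_hom_dfst]] z by auto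
  obtain k where k: "k \<in> mod_hom A (C i) N" "\<And>x. x \<in> carrier (C (Suc i)) \<Longrightarrow> k (d i x) = dsnd (f x)"
    using ext_vanishD[OF assms(2) mod_hom_compose[OF f mod_hom_dsnd]] z by auto
  show "\<exists>h\<in>mod_hom A (C i) (direct_sum M N). \<forall>x\<in>carrier (C (Suc i)). h (d i x) = f x"
    using h(2) k(2) by (intro bexI[OF _ mod_hom_dpair[OF h(1) k(1)]]) simp
qed

text \<open>A cocycle factors through the image of the differential, by exactness, and extends from
  there, by injectivity. In degree \<open>0\<close> this may fail, as \<open>Hom\<close> need not vanish.\<close>

lemma ext_vanish_injective:
  assumes J: "injective_module A J" shows "ext_vanish (Suc i) J"
proof (rule ext_vanishI)
  have lmJ: "left_module A J" by (rule injective_left_module[OF J])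
  fix f assume f: "f \<in> mod_hom A (C (Suc (Suc i))) J"
    and z: "\<And>x. x \<in> carrier (C (Suc (Suc (Suc i)))) \<Longrightarrow> f (d (Suc (Suc i)) x) = \<zero>\<^bsub>J\<^esub>"
  let ?U = "d (Suc i) ` carrier (C (Suc (Suc i)))" let ?I = "(C (Suc i))\<lparr>carrier := ?U\<rparr>"
  have U: "submodule ?U A (C (Suc i))" by (rule submodule_image[OF lmC lmC d submodule_carrier[OF lmC]])
  have "d (Suc i) \<in> mod_hom A (C (Suc (Suc i))) ?I" by (rule mod_hom_into_sub[OF d]) blast
  moreover have "f x = \<zero>\<^bsub>J\<^esub>" if "x \<in> carrier (C (Suc (Suc i)))" "d (Suc i) x = \<zero>\<^bsub>?I\<^esub>" for x
  proof -
    have "x \<in> d (Suc (Suc i)) ` carrier (C (Suc (Suc (Suc i))))" using exact that by simp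
    then show ?thesis using z by blast
  qed
  ultimately obtain h where h: "h \<in> mod_hom A ?I J" "\<forall>x\<in>carrier (C (Suc (Suc i))). h (d (Suc i) x) = f x"
    using mod_hom_factor[OF lmC lmJ left_module_submodule[OF lmC U] f, of "d (Suc i)"] by auto
  obtain k where k: "k \<in> mod_hom A (C (Suc i)) J" "\<And>x. x \<in> ?U \<Longrightarrow> k x = h x"
    using injective_extend[OF J projective_fg[OF C] U h(1)] by blast
  have "\<forall>x\<in>carrier (C (Suc (Suc i))). k (d (Suc i) x) = f x" using k(2) h(2) by simp
  then show "\<exists>h\<in>mod_hom A (C (Suc i)) J. \<forall>x\<in>carrier (C (Suc (Suc i))). h (d (Suc i) x) = f x"
    using k(1) by blast
qed

end

lemma (in fin_dim_algebra) ex_shifted_resolution: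
  fixes L :: "('k, 'a) std_module"
  assumes B: "rank_one_free B b" and L: "fg_module A L"
  obtains C d p where "shifted_resolution K A C d" "p \<in> mod_hom A (C (Suc 0)) L"
    "p ` carrier (C (Suc 0)) = carrier L"
    "a_kernel (C (Suc 0)) L p = d (Suc 0) ` carrier (C (Suc (Suc 0)))"
proof -
  \<comment> \<open>A state is a projective module with the submodule that the next term has to cover; the new
    submodule is the kernel of the covering map.\<close>
  define good where "good z \<longleftrightarrow> projective_module A (fst z) \<and> submodule (snd z) A (fst z)"
    for z :: "('k, 'a) std_module \<times> (nat \<Rightarrow> 'k) set"
  define R where "R z w \<longleftrightarrow> (\<exists>g\<in>mod_hom A (fst w) (fst z). g ` carrier (fst w) = snd z \<and>
    snd w = a_kernel (fst w) (fst z) g)" for z w :: "('k, 'a) std_module \<times> (nat \<Rightarrow> 'k) set"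
  have cover: "\<exists>P g. projective_module A P \<and> g \<in> mod_hom A P M \<and> g ` carrier P = carrier M"
    if "fg_module A M" for M :: "('k, 'a) std_module"
    using ex_free_cover[OF B that] projective_finite_power projective_rank_one_free[OF B] by metis
  obtain P p where P: "projective_module A P" and p: "p \<in> mod_hom A P L" "p ` carrier P = carrier L"
    using cover[OF L] by blast
  have lmP: "left_module A P" by (rule projective_left_module[OF P])
  have lmL: "left_module A L" by (rule fg_left_module[OF L])
  have step: "\<exists>w. good w \<and> R z w" if z: "good z" for z
  proof -
    have z1: "projective_module A (fst z)" and z2: "submodule (snd z) A (fst z)" using z by (auto simp: good_def)
    have "fg_module A ((fst z)\<lparr>carrier := snd z\<rparr>)" by (rule fg_submodule[OF projective_fg[OF z1] z2])
    then obtain Q g where Q: "projective_module A Q" "g \<in> mod_hom A Q ((fst z)\<lparr>carrier := snd z\<rparr>)"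
      "g ` carrier Q = snd z" using cover by fastforce
    have g: "g \<in> mod_hom A Q (fst z)" by (rule mod_hom_sub_incl[OF Q(2) z2])
    have "submodule (a_kernel Q (fst z) g) A Q"
      by (rule submodule_kernel[OF projective_left_module[OF Q(1)] projective_left_module[OF z1] g])
    then show ?thesis
      using Q(1,3) g by (intro exI[of _ "(Q, a_kernel Q (fst z) g)"]) (auto simp: good_def R_def)
  qed
  define z0 where "z0 = (P, a_kernel P L p)"
  have z0: "good z0" using P submodule_kernel[OF lmP lmL p(1)] by (simp add: good_def z0_def)
  have "\<exists>s. \<forall>i. (good (s i) \<and> (i = 0 \<longrightarrow> s i = z0)) \<and> R (s i) (s (Suc i))"
  proof (rule dependent_nat_choice, goal_cases)
    case 1 show ?case using z0 by (intro exI[of _ z0]) simp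
  next
    case (2 z i) then show ?case using step[of z] by blast
  qed
  then obtain s where s: "\<And>i. good (s i)" "s 0 = z0" "\<And>i. R (s i) (s (Suc i))" by blast
  have "\<exists>g. \<forall>i. g i \<in> mod_hom A (fst (s (Suc i))) (fst (s i)) \<and>
      g i ` carrier (fst (s (Suc i))) = snd (s i) \<and>
      snd (s (Suc i)) = a_kernel (fst (s (Suc i))) (fst (s i)) (g i)"
    by (intro choice allI) (use s(3) in \<open>unfold R_def Bex_def, blast\<close>)
  then obtain g where g: "\<And>i. g i \<in> mod_hom A (fst (s (Suc i))) (fst (s i))"
    "\<And>i. g i ` carrier (fst (s (Suc i))) = snd (s i)"
    "\<And>i. snd (s (Suc i)) = a_kernel (fst (s (Suc i))) (fst (s i)) (g i)" by blast
  define Zero where "Zero = P\<lparr>carrier := {\<zero>\<^bsub>P\<^esub>}\<rparr>"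
  have Zero: "projective_module A Zero" unfolding Zero_def by (rule projective_zero[OF projective_fg[OF P]])
  define C where "C = case_nat Zero (\<lambda>i. fst (s i))"
  define d where "d = case_nat (\<lambda>_. \<zero>\<^bsub>Zero\<^esub>) g"
  have CS [simp]: "C (Suc i) = fst (s i)" "C 0 = Zero" and dS [simp]: "d (Suc i) = g i" "d 0 = (\<lambda>_. \<zero>\<^bsub>Zero\<^esub>)" for i
    by (simp_all add: C_def d_def)
  have "shifted_resolution K A C d"
  proof (intro shifted_resolution.intro shifted_resolution_axioms.intro fin_dim_algebra_axioms)
    show "projective_module A (C i)" for i
      using Zero s(1) by (cases i) (auto simp: good_def)
    show "d i \<in> mod_hom A (C (Suc i)) (C i)" for i
      using g(1) mod_hom_zero_map[OF projective_left_module[OF Zero]] by (cases i) auto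
    show "carrier (C 0) = {\<zero>\<^bsub>C 0\<^esub>}" by (simp add: Zero_def)
    show "d i (d (Suc i) x) = \<zero>\<^bsub>C i\<^esub>" if "x \<in> carrier (C (Suc (Suc i)))" for i x
    proof (cases i)
      case (Suc j)
      have "g i x \<in> snd (s i)" using that g(2)[of i] by auto
      then show ?thesis using Suc g(3)[of j] by (simp add: a_kernel_eq)
    qed simp
    show "x \<in> d (Suc (Suc i)) ` carrier (C (Suc (Suc (Suc i))))"
      if "x \<in> carrier (C (Suc (Suc i)))" "d (Suc i) x = \<zero>\<^bsub>C (Suc i)\<^esub>" for i x
      using that g(3)[of i] g(2)[of "Suc i"] by (simp add: a_kernel_eq)
  qed
  then show ?thesis
    using that[of C d p] p g(2)[of 0] s(2) by (simp add: z0_def)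
qed

section \<open>Modules of small projective dimension embed in projective-injective modules\<close>

text \<open>The injective resolution \<open>0 \<rightarrow> B \<rightarrow> J 0 \<rightarrow> J 1 \<rightarrow> \<cdots>\<close> of a copy \<open>B\<close> of the regular module,
  with \<open>B\<close> realised as a submodule of \<open>J 0\<close>.\<close>

locale dominant_coresolution = fin_dim_algebra K A
  for K :: "'k ring" (structure) and A :: "('k, 'a) module" (structure) +
  fixes n :: nat and J :: "nat \<Rightarrow> ('k, 'a) std_module" and \<delta> :: "nat \<Rightarrow> (nat \<Rightarrow> 'k) \<Rightarrow> nat \<Rightarrow> 'k"
    and B :: "('k, 'a) std_module" and b :: "nat \<Rightarrow> 'k"
  assumes J_injective: "injective_module A (J i)"
    and J_projective: "i \<le> n \<Longrightarrow> projective_module A (J i)"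
    and \<delta>: "\<delta> i \<in> mod_hom A (J i) (J (Suc i))"
    and \<delta>_exact: "\<delta> i ` carrier (J i) = a_kernel (J (Suc i)) (J (Suc (Suc i))) (\<delta> (Suc i))"
    and B_def: "B = (J 0)\<lparr>carrier := a_kernel (J 0) (J (Suc 0)) (\<delta> 0)\<rparr>"
    and B_free: "rank_one_free B b"
begin

text \<open>Let \<open>C\<close> resolve a module without nonzero maps to \<open>J 0, \<dots>, J n\<close>. Then all extensions of it by these
  \<open>J j\<close> vanish. Shifting dimensions along the injective resolution gives vanishing for \<open>B\<close> in degrees
  up to \<open>n\<close>, hence for all projective modules. Each step of a projective resolution of \<open>M\<close> costs one
  degree.\<close>

lemma ext_vanish_of_pd_le:
  assumes S: "shifted_resolution K A C d"
    and torsion: "\<And>j. j \<le> n \<Longrightarrow> shifted_resolution.ext_vanish A C d 0 (J j)"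
  shows "pd_le l M \<Longrightarrow> i + l \<le> n \<Longrightarrow> shifted_resolution.ext_vanish A C d i M"
proof -
  interpret S: shifted_resolution K A C d by (rule S)
  let ?Z = "\<lambda>j. (J j)\<lparr>carrier := a_kernel (J j) (J (Suc j)) (\<delta> j)\<rparr>"
  have lmJ: "left_module A (J j)" for j by (rule injective_left_module[OF J_injective])
  have ker: "submodule (a_kernel (J j) (J (Suc j)) (\<delta> j)) A (J j)" for j
    by (rule submodule_kernel[OF lmJ lmJ \<delta>])
  have fgZ: "fg_module A (?Z j)" for j by (rule fg_submodule[OF injective_fg[OF J_injective] ker])
  have Z: "S.ext_vanish i (?Z j)" if "i + j \<le> n" for i j
    using that
  proof (induction i arbitrary: j)
    case 0
    then show ?case using S.ext_vanish_0_submodule[OF torsion lmJ ker] by simp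
  next
    case (Suc i)
    have \<delta>Z: "\<delta> j \<in> mod_hom A (J j) (?Z (Suc j))" "\<delta> j ` carrier (J j) = carrier (?Z (Suc j))"
      using \<delta>_exact[of j] by (auto intro: mod_hom_into_sub[OF \<delta>])
    have "S.ext_vanish (Suc i) ((J j)\<lparr>carrier := a_kernel (J j) (?Z (Suc j)) (\<delta> j)\<rparr>)"
      by (rule S.ext_vanish_kernel[OF injective_fg[OF J_injective] fgZ \<delta>Z S.ext_vanish_injective[OF J_injective] Suc.IH])
        (use Suc.prems in simp)
    then show ?case by (simp add: a_kernel_eq)
  qed
  have vB: "S.ext_vanish i B" if "i \<le> n" for i using Z[of i 0] that by (simp add: B_def)
  have vF: "S.ext_vanish i F" if "i \<le> n" "finite_power B F" for i F
    using that(2) by induction (use vB that(1) in \<open>auto intro: S.ext_vanish_direct_sum\<close>)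
  have vP: "S.ext_vanish i P" if P: "projective_module A P" and "i \<le> n" for i P
  proof -
    obtain F where F: "finite_power B F" "summand A P F" by (rule projective_summand_of_free[OF B_free P])
    have "projective_module A F" by (rule projective_finite_power[OF F(1) projective_rank_one_free[OF B_free]])
    then show ?thesis
      using S.ext_vanish_summand[OF vF[OF that(2) F(1)] F(2)] P projective_left_module by blast
  qed
  show "pd_le l M \<Longrightarrow> i + l \<le> n \<Longrightarrow> S.ext_vanish i M"
  proof (induction l arbitrary: i M)
    case 0
    then show ?case using vP by simp
  next
    case (Suc l)
    from Suc.prems(1) obtain P and Y :: "('k, 'a) std_module" and g
      where P: "projective_module A P" and Y: "fg_module A Y"
        and g: "g \<in> mod_hom A P Y" "g ` carrier P = carrier Y" and s: "summand A M Y"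
        and k: "pd_le l (P\<lparr>carrier := a_kernel P Y g\<rparr>)" by auto
    have "S.ext_vanish i P" using vP[OF P] Suc.prems(2) by simp
    moreover have "S.ext_vanish (Suc i) (P\<lparr>carrier := a_kernel P Y g\<rparr>)"
      using Suc.IH[OF k] Suc.prems(2) by simp
    ultimately have "S.ext_vanish i Y" by (rule S.ext_vanish_cokernel[OF projective_fg[OF P] Y g])
    then show ?case
      using S.ext_vanish_summand s fg_left_module[OF Y] fg_left_module[OF pd_le_fg[OF Suc.prems(1)]] by blast
  qed
qed

text \<open>Otherwise the preceding lemma, applied to a resolution of \<open>L\<close> and in degree \<open>0\<close>, says that
  there are no nonzero maps from \<open>L\<close> to \<open>M\<close>, contrary to the inclusion.\<close>

lemma ex_nonzero_hom_to_coresolution: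
  fixes M :: "('k, 'a) std_module"
  assumes M: "pd_le l M" "l \<le> n" and L: "submodule L A M" "L \<noteq> {\<zero>\<^bsub>M\<^esub>}"
  shows "\<exists>j\<le>n. \<exists>f\<in>mod_hom A (M\<lparr>carrier := L\<rparr>) (J j). \<exists>x\<in>L. f x \<noteq> \<zero>\<^bsub>J j\<^esub>"
proof (rule ccontr)
  assume "\<not> ?thesis"
  then have none: "f x = \<zero>\<^bsub>J j\<^esub>" if "j \<le> n" "f \<in> mod_hom A (M\<lparr>carrier := L\<rparr>) (J j)" "x \<in> L" for j f x
    using that by blast
  have fgM: "fg_module A M" by (rule pd_le_fg[OF M(1)])
  have lmM: "left_module A M" by (rule fg_left_module[OF fgM])
  let ?L = "M\<lparr>carrier := L\<rparr>"
  have fgL: "fg_module A ?L" by (rule fg_submodule[OF fgM L(1)])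
  have lmL: "left_module A ?L" by (rule fg_left_module[OF fgL])
  obtain C d p where S: "shifted_resolution K A C d" and p: "p \<in> mod_hom A (C (Suc 0)) ?L"
    "p ` carrier (C (Suc 0)) = carrier ?L"
    and k: "a_kernel (C (Suc 0)) ?L p = d (Suc 0) ` carrier (C (Suc (Suc 0)))"
    by (rule ex_shifted_resolution[OF B_free fgL])
  interpret S: shifted_resolution K A C d by (rule S)
  have torsion: "S.ext_vanish 0 (J j)" if j: "j \<le> n" for j
  proof (rule S.ext_vanish_0I[OF injective_left_module[OF J_injective]])
    fix f x assume f: "f \<in> mod_hom A (C (Suc 0)) (J j)"
      and z: "\<And>x. x \<in> carrier (C (Suc (Suc 0))) \<Longrightarrow> f (d (Suc 0) x) = \<zero>\<^bsub>J j\<^esub>"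
      and x: "x \<in> carrier (C (Suc 0))"
    have "f y = \<zero>\<^bsub>J j\<^esub>" if "y \<in> carrier (C (Suc 0))" "p y = \<zero>\<^bsub>?L\<^esub>" for y
    proof -
      have "y \<in> a_kernel (C (Suc 0)) ?L p" using that by (simp add: a_kernel_eq)
      then show ?thesis using k z by auto
    qed
    then obtain h where h: "h \<in> mod_hom A ?L (J j)" "\<forall>x\<in>carrier (C (Suc 0)). h (p x) = f x"
      using mod_hom_factor[OF S.lmC injective_left_module[OF J_injective] lmL f p] by blast
    have "h (p x) = \<zero>\<^bsub>J j\<^esub>" using none[OF j h(1)] mod_hom_closed[OF p(1) x] by simp
    then show "f x = \<zero>\<^bsub>J j\<^esub>" using h(2) x by simp
  qed
  have "S.ext_vanish 0 M" by (rule ext_vanish_of_pd_le[OF S torsion M(1)]) (use M(2) in auto)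
  moreover have "p (d (Suc 0) x) = \<zero>\<^bsub>M\<^esub>" if "x \<in> carrier (C (Suc (Suc 0)))" for x
  proof -
    have "d (Suc 0) x \<in> a_kernel (C (Suc 0)) ?L p" using k that by blast
    then show ?thesis by (simp add: a_kernel_eq)
  qed
  ultimately have "p x = \<zero>\<^bsub>M\<^esub>" if "x \<in> carrier (C (Suc 0))" for x
    using S.ext_vanish_0D[OF _ lmM mod_hom_sub_incl[OF p(1) L(1)] _ that] by blast
  then have "L \<subseteq> {\<zero>\<^bsub>M\<^esub>}" using p(2) by auto
  then show False using L submodule_facts(2)[OF L(1)] by blast
qed

text \<open>Among the maps from \<open>M\<close> to projective-injective modules, one with kernel of minimal length is
  injective. Otherwise the kernel has a nonzero map to some \<open>J j\<close>; as \<open>J j\<close> is injective, this map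
  extends to \<open>M\<close>, and adding it as a further component makes the kernel smaller.\<close>

theorem embeds_in_projective_injective:
  fixes M :: "('k, 'a) std_module"
  assumes M: "pd_le l M" "l \<le> n"
  obtains I \<epsilon> where "projective_module A I" "injective_module A I" "\<epsilon> \<in> mod_hom A M I" "inj_on \<epsilon> (carrier M)"
proof -
  have fgM: "fg_module A M" by (rule pd_le_fg[OF M(1)])
  have lmM: "left_module A M" by (rule fg_left_module[OF fgM])
  obtain \<mu> :: "(nat \<Rightarrow> 'k) set \<Rightarrow> nat"
    where \<mu>: "\<forall>U V. submodule U A M \<and> submodule V A M \<and> U \<subset> V \<longrightarrow> \<mu> U < \<mu> V"
    using length_function[OF fgM] by blast
  define good where "good z \<longleftrightarrow> projective_module A (fst z) \<and> injective_module A (fst z) \<and> snd z \<in> mod_hom A M (fst z)" for z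
  define ker where "ker z = a_kernel M (fst z) (snd z)" for z :: "('k, 'a) std_module \<times> ((nat \<Rightarrow> 'k) \<Rightarrow> nat \<Rightarrow> 'k)"
  have ker: "submodule (ker z) A M" if "good z" for z
    using that unfolding good_def ker_def
    by (intro submodule_kernel[OF lmM]) (auto intro: projective_left_module)
  have "good (J 0, \<lambda>_. \<zero>\<^bsub>J 0\<^esub>)"
    using J_injective J_projective mod_hom_zero_map[OF injective_left_module[OF J_injective]] by (simp add: good_def)
  then obtain z where z: "good z" and min: "\<And>w. good w \<Longrightarrow> \<mu> (ker z) \<le> \<mu> (ker w)"
    using ex_has_least_nat[of good _ "\<lambda>z. \<mu> (ker z)"] by blast
  obtain I \<epsilon> where zz: "z = (I, \<epsilon>)" by fastforce
  have I: "projective_module A I" "injective_module A I" and \<epsilon>: "\<epsilon> \<in> mod_hom A M I"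
    using z zz by (auto simp: good_def)
  have "ker z = {\<zero>\<^bsub>M\<^esub>}"
  proof (rule ccontr)
    assume ne: "ker z \<noteq> {\<zero>\<^bsub>M\<^esub>}"
    obtain j f x where j: "j \<le> n" and f: "f \<in> mod_hom A (M\<lparr>carrier := ker z\<rparr>) (J j)"
      and x: "x \<in> ker z" "f x \<noteq> \<zero>\<^bsub>J j\<^esub>"
      using ex_nonzero_hom_to_coresolution[OF M ker[OF z] ne] by blast
    obtain F where F: "F \<in> mod_hom A M (J j)" "\<And>x. x \<in> ker z \<Longrightarrow> F x = f x"
      using injective_extend[OF J_injective fgM ker[OF z] f] by blast
    define w where "w = (direct_sum I (J j), \<lambda>x. dpair (\<epsilon> x) (F x))"
    have w: "good w"
      using projective_direct_sum[OF I(1) J_projective[OF j]] injective_direct_sum[OF I(2) J_injective]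
        mod_hom_dpair[OF \<epsilon> F(1)] by (simp add: good_def w_def)
    have "ker w \<subseteq> ker z" by (auto simp: ker_def w_def zz a_kernel_eq)
    moreover have "x \<notin> ker w" using x F(2) by (simp add: ker_def w_def a_kernel_eq)
    ultimately have "ker w \<subset> ker z" using x(1) by blast
    then have "\<mu> (ker w) < \<mu> (ker z)" using \<mu> ker[OF z] ker[OF w] by blast
    then show False using min[OF w] by simp
  qed
  then have "inj_on \<epsilon> (carrier M)"
    unfolding inj_on_mod_hom_iff[OF lmM projective_left_module[OF I(1)] \<epsilon>]
    by (auto simp: ker_def zz a_kernel_eq)
  then show ?thesis using that I \<epsilon> by blast
qed

end

section \<open>Indecomposable modules as summands of syzygies\<close>

context fin_dim_algebra
begin

text \<open>
  Let \<open>q : I \<rightarrow> N\<close> be the cokernel of \<open>\<epsilon>\<close>. An endomorphism \<open>c\<close> of \<open>I\<close> that preserves \<open>M\<close> induces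
  endomorphisms of \<open>M\<close> and of \<open>N\<close>. Suppose that every indecomposable \<open>Y\<close> admits a surjection
  \<open>g\<close> from a projective module \<open>P\<close> such that \<open>M\<close> is not a summand of the kernel of \<open>g\<close>. Then each map \<open>\<alpha>\<close> from \<open>I\<close> to a submodule of \<open>N\<close> that
  kills \<open>M\<close> is \<open>q c\<close> for a \<open>c\<close> that induces a non-automorphism of \<open>M\<close>. For an indecomposable
  submodule, lift \<open>\<alpha>\<close> to \<open>P\<close> and lift \<open>g\<close> to a map back to \<open>I\<close>: on \<open>M\<close> the composite factors through the
  kernel of \<open>g\<close>. Direct sums are no problem because sums of non-automorphisms are
  non-automorphisms. Applied to \<open>\<alpha> = q\<close>, this yields \<open>c\<close> such that \<open>1 - c\<close> maps \<open>I\<close> to \<open>M\<close>. As \<open>c\<close>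
  induces a non-automorphism of \<open>M\<close>, the map \<open>1 - c\<close> is invertible on \<open>M\<close>, and \<open>M\<close> is a summand
  of \<open>I\<close>.
\<close>

lemma summand_of_syzygy:
  fixes M :: "('k, 'a) std_module"
  assumes fgM: "fg_module A M" and indM: "indecomposable_module A M"
    and I: "projective_module A I" and \<epsilon>: "\<epsilon> \<in> mod_hom A M I" "inj_on \<epsilon> (carrier M)"
    and nI: "\<not> summand A M I"
  shows "\<exists>Y :: ('k, 'a) std_module. fg_module A Y \<and> indecomposable_module A Y \<and>
    (\<forall>P g. projective_module A P \<and> g \<in> mod_hom A P Y \<and> g ` carrier P = carrier Y \<longrightarrow>
      summand A M (P\<lparr>carrier := a_kernel P Y g\<rparr>))"
proof (rule ccontr)
  assume neg: "\<not> ?thesis"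
  have lmM: "left_module A M" by (rule fg_left_module[OF fgM])
  have fgI: "fg_module A I" by (rule projective_fg[OF I])
  have lmI: "left_module A I" by (rule fg_left_module[OF fgI])
  interpret M: left_module A M by (rule lmM)
  interpret I: left_module A I by (rule lmI)
  let ?E = "\<epsilon> ` carrier M" let ?IE = "I\<lparr>carrier := ?E\<rparr>"
  have E: "submodule ?E A I" by (rule submodule_image[OF lmM lmI \<epsilon>(1) submodule_carrier[OF lmM]])
  obtain N :: "('k, 'a) std_module" and q where lmN: "left_module A N" and q: "q \<in> mod_hom A I N"
    "q ` carrier I = carrier N" and q0: "\<And>x. x \<in> carrier I \<Longrightarrow> q x = \<zero>\<^bsub>N\<^esub> \<longleftrightarrow> x \<in> ?E"
    using ex_quotient_module[OF lmI E] by blast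
  interpret N: left_module A N by (rule lmN)
  have fgN: "fg_module A N" by (rule fg_module_image[OF fgI lmN q])
  note \<epsilon>c = mod_hom_closed[OF \<epsilon>(1)] and qc = mod_hom_closed[OF q(1)]
  define \<psi> where "\<psi> = inv_into (carrier M) \<epsilon>"
  have \<epsilon>E: "\<epsilon> \<in> mod_hom A M ?IE" by (rule mod_hom_into_sub[OF \<epsilon>(1)]) blast
  have \<psi>: "\<psi> \<in> mod_hom A ?IE M"
    unfolding \<psi>_def by (rule mod_hom_inv[OF lmM \<epsilon>E]) (simp add: bij_betw_def \<epsilon>(2))
  have \<psi>\<epsilon>: "\<psi> (\<epsilon> x) = x" if "x \<in> carrier M" for x
    unfolding \<psi>_def by (rule inv_into_f_f[OF \<epsilon>(2) that])
  have \<epsilon>\<psi>: "\<epsilon> (\<psi> y) = y" if "y \<in> ?E" for y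
    unfolding \<psi>_def by (rule f_inv_into_f[OF that])
  define Prop where "Prop U \<longleftrightarrow> (\<forall>\<alpha>\<in>mod_hom A I (N\<lparr>carrier := U\<rparr>). (\<forall>x\<in>carrier M. \<alpha> (\<epsilon> x) = \<zero>\<^bsub>N\<^esub>) \<longrightarrow>
    (\<exists>c\<in>mod_hom A I I. \<exists>c'\<in>mod_hom A M M. (\<forall>x\<in>carrier M. c (\<epsilon> x) = \<epsilon> (c' x)) \<and>
      (\<forall>y\<in>carrier I. q (c y) = \<alpha> y) \<and> \<not> bij_betw c' (carrier M) (carrier M)))" for U
  have "Prop (carrier N)"
    using fgN submodule_carrier[OF lmN]
  proof (induction rule: submodule_decomposition_induct)
    case zero
    have nb: "\<not> bij_betw (\<lambda>_. \<zero>\<^bsub>M\<^esub>) (carrier M) (carrier M)"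
    proof
      assume "bij_betw (\<lambda>_. \<zero>\<^bsub>M\<^esub>) (carrier M) (carrier M)"
      then have "carrier M = {\<zero>\<^bsub>M\<^esub>}" unfolding bij_betw_def by (metis M.M.zero_closed image_constant)
      then show False using indM by (simp add: indecomposable_module_def)
    qed
    show ?case
      unfolding Prop_def
    proof (intro ballI impI)
      fix \<alpha> assume \<alpha>: "\<alpha> \<in> mod_hom A I (N\<lparr>carrier := {\<zero>\<^bsub>N\<^esub>}\<rparr>)"
      have "q \<zero>\<^bsub>I\<^esub> = \<alpha> y" if "y \<in> carrier I" for y
        using mod_hom_closed[OF \<alpha> that] mod_hom_zero[OF lmI lmN q(1)] by simp
      then show "\<exists>c\<in>mod_hom A I I. \<exists>c'\<in>mod_hom A M M. (\<forall>x\<in>carrier M. c (\<epsilon> x) = \<epsilon> (c' x)) \<and>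
        (\<forall>y\<in>carrier I. q (c y) = \<alpha> y) \<and> \<not> bij_betw c' (carrier M) (carrier M)"
        using nb mod_hom_zero[OF lmM lmI \<epsilon>(1)]
        by (intro bexI[OF bexI[OF _ mod_hom_zero_map[OF lmM]] mod_hom_zero_map[OF lmI]]) simp
    qed
  next
    case (indecomposable U)
    let ?Y = "N\<lparr>carrier := U\<rparr>"
    have fgY: "fg_module A ?Y" by (rule fg_submodule[OF fgN indecomposable(1)])
    have lmY: "left_module A ?Y" by (rule fg_left_module[OF fgY])
    from neg fgY indecomposable(2) obtain P g where P: "projective_module A P"
      and g: "g \<in> mod_hom A P ?Y" "g ` carrier P = carrier ?Y"
      and ns: "\<not> summand A M (P\<lparr>carrier := a_kernel P ?Y g\<rparr>)" by blast
    have lmP: "left_module A P" by (rule projective_left_module[OF P])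
    let ?K = "P\<lparr>carrier := a_kernel P ?Y g\<rparr>"
    have ker: "submodule (a_kernel P ?Y g) A P" by (rule submodule_kernel[OF lmP lmY g(1)])
    have gN: "g \<in> mod_hom A P N" by (rule mod_hom_sub_incl[OF g(1) indecomposable(1)])
    obtain b where b: "b \<in> mod_hom A P I" "\<And>x. x \<in> carrier P \<Longrightarrow> q (b x) = g x"
      using projective_lift[OF P fgI fgN q gN] by blast
    note bc = mod_hom_closed[OF b(1)]
    show ?case
      unfolding Prop_def
    proof (intro ballI impI)
      fix \<alpha> assume \<alpha>: "\<alpha> \<in> mod_hom A I ?Y" and \<alpha>0: "\<forall>x\<in>carrier M. \<alpha> (\<epsilon> x) = \<zero>\<^bsub>N\<^esub>"
      obtain a where a: "a \<in> mod_hom A I P" "\<And>x. x \<in> carrier I \<Longrightarrow> g (a x) = \<alpha> x"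
        using projective_lift[OF I projective_fg[OF P] fgY g \<alpha>] by blast
      note ac = mod_hom_closed[OF a(1)]
      have a\<epsilon>: "(\<lambda>x. a (\<epsilon> x)) \<in> mod_hom A M ?K"
        by (rule mod_hom_into_sub[OF mod_hom_compose[OF \<epsilon>(1) a(1)]])
          (use a(2) \<alpha>0 \<epsilon>c ac in \<open>simp add: a_kernel_eq\<close>)
      have bE: "b u \<in> ?E" if "u \<in> carrier ?K" for u
      proof -
        have u: "u \<in> carrier P" "g u = \<zero>\<^bsub>N\<^esub>" using that by (simp_all add: a_kernel_eq)
        then show ?thesis using q0[OF bc[OF u(1)]] b(2)[OF u(1)] by simp
      qed
      have bK: "b \<in> mod_hom A ?K ?IE"
        by (rule mod_hom_into_sub[OF mod_hom_from_sub[OF b(1) ker]]) (rule bE)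
      define c' where "c' x = \<psi> (b (a (\<epsilon> x)))" for x
      have c': "c' \<in> mod_hom A M M"
        unfolding c'_def by (rule mod_hom_compose[OF a\<epsilon> mod_hom_compose[OF bK \<psi>]])
      have "\<not> bij_betw c' (carrier M) (carrier M)"
        using summand_of_bij_comp[OF lmM a\<epsilon> mod_hom_compose[OF bK \<psi>]] ns unfolding c'_def by blast
      moreover have "b (a (\<epsilon> x)) = \<epsilon> (c' x)" if "x \<in> carrier M" for x
        unfolding c'_def by (rule \<epsilon>\<psi>[OF bE[OF mod_hom_closed[OF a\<epsilon> that]], symmetric])
      moreover have "q (b (a y)) = \<alpha> y" if "y \<in> carrier I" for y
        using b(2) a(2) ac that by simp
      ultimately show "\<exists>c\<in>mod_hom A I I. \<exists>c'\<in>mod_hom A M M. (\<forall>x\<in>carrier M. c (\<epsilon> x) = \<epsilon> (c' x)) \<and>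
        (\<forall>y\<in>carrier I. q (c y) = \<alpha> y) \<and> \<not> bij_betw c' (carrier M) (carrier M)"
        by (intro bexI[OF bexI[OF _ c'] mod_hom_compose[OF a(1) b(1)]]) blast
    qed
  next
    case (sum U P Q p r)
    have lmP: "left_module A (N\<lparr>carrier := P\<rparr>)" and lmQ: "left_module A (N\<lparr>carrier := Q\<rparr>)"
      and lmU: "left_module A (N\<lparr>carrier := U\<rparr>)"
      by (rule left_module_submodule[OF lmN sum(1)] left_module_submodule[OF lmN sum(2)]
        left_module_submodule[OF lmN sum(3)])+
    show ?case
      unfolding Prop_def
    proof (intro ballI impI)
      fix \<alpha> assume \<alpha>: "\<alpha> \<in> mod_hom A I (N\<lparr>carrier := U\<rparr>)" and \<alpha>0: "\<forall>x\<in>carrier M. \<alpha> (\<epsilon> x) = \<zero>\<^bsub>N\<^esub>"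
      have p0: "\<forall>x\<in>carrier M. p (\<alpha> (\<epsilon> x)) = \<zero>\<^bsub>N\<^esub>" and r0: "\<forall>x\<in>carrier M. r (\<alpha> (\<epsilon> x)) = \<zero>\<^bsub>N\<^esub>"
        using \<alpha>0 mod_hom_zero[OF lmU lmP sum(6)] mod_hom_zero[OF lmU lmQ sum(7)] by simp_all
      obtain c c' where c: "c \<in> mod_hom A I I" "c' \<in> mod_hom A M M" "\<And>x. x \<in> carrier M \<Longrightarrow> c (\<epsilon> x) = \<epsilon> (c' x)"
        "\<And>y. y \<in> carrier I \<Longrightarrow> q (c y) = p (\<alpha> y)" "\<not> bij_betw c' (carrier M) (carrier M)"
        using sum(9)[unfolded Prop_def, rule_format, OF mod_hom_compose[OF \<alpha> sum(6)]] p0 by blast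
      obtain e e' where e: "e \<in> mod_hom A I I" "e' \<in> mod_hom A M M" "\<And>x. x \<in> carrier M \<Longrightarrow> e (\<epsilon> x) = \<epsilon> (e' x)"
        "\<And>y. y \<in> carrier I \<Longrightarrow> q (e y) = r (\<alpha> y)" "\<not> bij_betw e' (carrier M) (carrier M)"
        using sum(10)[unfolded Prop_def, rule_format, OF mod_hom_compose[OF \<alpha> sum(7)]] r0 by blast
      have "\<not> bij_betw (\<lambda>x. c' x \<oplus>\<^bsub>M\<^esub> e' x) (carrier M) (carrier M)"
        using indecomposable_local[OF fgM indM c(2) e(2)] c(5) e(5) by blast
      moreover have "c (\<epsilon> x) \<oplus>\<^bsub>I\<^esub> e (\<epsilon> x) = \<epsilon> (c' x \<oplus>\<^bsub>M\<^esub> e' x)" if "x \<in> carrier M" for x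
        using that c(3) e(3) mod_hom_add[OF \<epsilon>(1) mod_hom_closed[OF c(2) that] mod_hom_closed[OF e(2) that]] by simp
      moreover have "q (c y \<oplus>\<^bsub>I\<^esub> e y) = \<alpha> y" if y: "y \<in> carrier I" for y
      proof -
        have "\<alpha> y = p (\<alpha> y) \<oplus>\<^bsub>N\<^esub> r (\<alpha> y)" using sum(8)[of "\<alpha> y"] mod_hom_closed[OF \<alpha> y] by simp
        then show ?thesis
          using mod_hom_add[OF q(1) mod_hom_closed[OF c(1) y] mod_hom_closed[OF e(1) y]] c(4)[OF y] e(4)[OF y] by simp
      qed
      ultimately show "\<exists>c\<in>mod_hom A I I. \<exists>c'\<in>mod_hom A M M. (\<forall>x\<in>carrier M. c (\<epsilon> x) = \<epsilon> (c' x)) \<and>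
        (\<forall>y\<in>carrier I. q (c y) = \<alpha> y) \<and> \<not> bij_betw c' (carrier M) (carrier M)"
        by (intro bexI[OF bexI[OF _ mod_hom_plus[OF lmM c(2) e(2)]] mod_hom_plus[OF lmI c(1) e(1)]]) blast
    qed
  qed
  moreover have "q \<in> mod_hom A I (N\<lparr>carrier := carrier N\<rparr>)" by (rule mod_hom_into_sub[OF q(1) qc])
  moreover have "\<forall>x\<in>carrier M. q (\<epsilon> x) = \<zero>\<^bsub>N\<^esub>" using q0 \<epsilon>c by blast
  ultimately obtain c c' where c: "c \<in> mod_hom A I I" "c' \<in> mod_hom A M M"
    "\<And>x. x \<in> carrier M \<Longrightarrow> c (\<epsilon> x) = \<epsilon> (c' x)" "\<And>y. y \<in> carrier I \<Longrightarrow> q (c y) = q y"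
    "\<not> bij_betw c' (carrier M) (carrier M)"
    unfolding Prop_def by blast
  have "(\<lambda>y. y \<ominus>\<^bsub>I\<^esub> c y) \<in> mod_hom A I ?IE"
  proof (rule mod_hom_into_sub[OF mod_hom_diff[OF lmI mod_hom_id c(1)]])
    fix y assume y: "y \<in> carrier I"
    have cy: "c y \<in> carrier I" by (rule mod_hom_closed[OF c(1) y])
    have "q (y \<ominus>\<^bsub>I\<^esub> c y) = \<zero>\<^bsub>N\<^esub>"
      using y cy c(4)[OF y] qc by (simp add: mod_hom_minus[OF lmI lmN q(1)] N.M.minus_eq_zero_iff)
    then show "y \<ominus>\<^bsub>I\<^esub> c y \<in> ?E" using q0 y cy by simp
  qed
  note h = mod_hom_compose[OF this \<psi>]
  have one: "c' x \<oplus>\<^bsub>M\<^esub> \<psi> (\<epsilon> x \<ominus>\<^bsub>I\<^esub> c (\<epsilon> x)) = x" if x: "x \<in> carrier M" for x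
  proof -
    have cx: "c' x \<in> carrier M" by (rule mod_hom_closed[OF c(2) x])
    have "\<epsilon> x \<ominus>\<^bsub>I\<^esub> c (\<epsilon> x) = \<epsilon> (x \<ominus>\<^bsub>M\<^esub> c' x)"
      using c(3)[OF x] mod_hom_minus[OF lmM lmI \<epsilon>(1) x cx] by simp
    then show ?thesis using \<psi>\<epsilon>[of "x \<ominus>\<^bsub>M\<^esub> c' x"] x cx by (simp add: M.M.add_minus_cancel)
  qed
  have "bij_betw (\<lambda>x. c' x \<oplus>\<^bsub>M\<^esub> \<psi> (\<epsilon> x \<ominus>\<^bsub>I\<^esub> c (\<epsilon> x))) (carrier M) (carrier M)"
    by (subst bij_betw_cong[OF one]) (use bij_betw_id[of "carrier M"] in \<open>simp_all add: id_def\<close>)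
  then have "bij_betw (\<lambda>x. \<psi> (\<epsilon> x \<ominus>\<^bsub>I\<^esub> c (\<epsilon> x))) (carrier M) (carrier M)"
    using indecomposable_local[OF fgM indM c(2) mod_hom_compose[OF \<epsilon>(1) h]] c(5) by blast
  then show False using summand_of_bij_comp[OF lmM \<epsilon>(1) h] nI by blast
qed

section \<open>Finiteness up to isomorphism\<close>

definition finite_up_to_iso :: "('k, 'a) std_module set \<Rightarrow> bool"
  where "finite_up_to_iso G \<longleftrightarrow> (\<exists>F :: ('k, 'a) std_module set. finite F \<and> (\<forall>N\<in>F. fg_module A N) \<and>
    (\<forall>M\<in>G. \<exists>N\<in>F. mod_isomorphic A N M))"

lemma finite_up_to_iso_iff:
  assumes G: "\<And>M. M \<in> G \<Longrightarrow> fg_module A M"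
  shows "finite_up_to_iso G \<longleftrightarrow> finite (G // mod_iso_rel A)"
proof
  assume "finite_up_to_iso G"
  then obtain F :: "('k, 'a) std_module set" where F: "finite F" "\<forall>N\<in>F. fg_module A N"
    "\<forall>M\<in>G. \<exists>N\<in>F. mod_isomorphic A N M" unfolding finite_up_to_iso_def by blast
  have "G // mod_iso_rel A \<subseteq> (\<lambda>N. mod_iso_rel A `` {N}) ` F"
  proof
    fix S assume "S \<in> G // mod_iso_rel A"
    then obtain M where M: "M \<in> G" "S = mod_iso_rel A `` {M}" by (auto simp: quotient_def)
    then obtain N where N: "N \<in> F" "mod_isomorphic A N M" using F(3) by blast
    have fgs: "fg_module A N" "fg_module A M" using N M F(2) G by blast+
    have MN: "mod_isomorphic A M N" by (rule mod_isomorphic_sym[OF fg_left_module[OF fgs(1)] N(2)])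
    have "mod_iso_rel A `` {M} = mod_iso_rel A `` {N}"
      using fgs N(2) MN mod_isomorphic_trans[OF N(2)] mod_isomorphic_trans[OF MN]
      by (auto simp: mod_iso_rel_def)
    then show "S \<in> (\<lambda>N. mod_iso_rel A `` {N}) ` F" using M(2) N(1) by blast
  qed
  then show "finite (G // mod_iso_rel A)" using F(1) finite_subset by blast
next
  assume fin: "finite (G // mod_iso_rel A)"
  let ?F = "(\<lambda>S. SOME M. M \<in> S) ` (G // mod_iso_rel A)"
  have rep: "(M, SOME N. N \<in> mod_iso_rel A `` {M}) \<in> mod_iso_rel A" if "M \<in> G" for M
  proof -
    have "M \<in> mod_iso_rel A `` {M}" using G[OF that] mod_isomorphic_refl by (auto simp: mod_iso_rel_def)
    then have "(SOME N. N \<in> mod_iso_rel A `` {M}) \<in> mod_iso_rel A `` {M}" by (rule someI)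
    then show ?thesis by blast
  qed
  have "fg_module A N" if "N \<in> ?F" for N
  proof -
    from that obtain M where M: "M \<in> G" "N = (SOME N. N \<in> mod_iso_rel A `` {M})" by (auto simp: quotient_def)
    then have "(M, N) \<in> mod_iso_rel A" using rep by simp
    then show ?thesis by (simp add: mod_iso_rel_def)
  qed
  moreover have "\<exists>N\<in>?F. mod_isomorphic A N M" if "M \<in> G" for M
  proof (rule bexI)
    show "mod_isomorphic A (SOME N. N \<in> mod_iso_rel A `` {M}) M"
      by (rule mod_isomorphic_sym[OF fg_left_module[OF G[OF that]]])
        (use rep[OF that] in \<open>unfold mod_iso_rel_def, blast\<close>)
    show "(SOME N. N \<in> mod_iso_rel A `` {M}) \<in> ?F" by (intro imageI quotientI that)
  qed
  ultimately show "finite_up_to_iso G"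
    unfolding finite_up_to_iso_def using fin by (intro exI[of _ ?F]) blast
qed

lemma finite_up_to_iso_subset: "finite_up_to_iso G \<Longrightarrow> H \<subseteq> G \<Longrightarrow> finite_up_to_iso H"
  unfolding finite_up_to_iso_def by blast

lemma finite_up_to_iso_Un:
  assumes "finite_up_to_iso G" "finite_up_to_iso H" shows "finite_up_to_iso (G \<union> H)"
proof -
  from assms(1) obtain F :: "('k, 'a) std_module set" where F: "finite F" "\<forall>N\<in>F. fg_module A N"
    "\<forall>M\<in>G. \<exists>N\<in>F. mod_isomorphic A N M" unfolding finite_up_to_iso_def by blast
  from assms(2) obtain E :: "('k, 'a) std_module set" where E: "finite E" "\<forall>N\<in>E. fg_module A N"
    "\<forall>M\<in>H. \<exists>N\<in>E. mod_isomorphic A N M" unfolding finite_up_to_iso_def by blast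
  show ?thesis
    unfolding finite_up_to_iso_def using F E by (intro exI[of _ "F \<union> E"]) blast
qed

lemma finite_up_to_iso_UN:
  "finite F \<Longrightarrow> (\<And>N. N \<in> F \<Longrightarrow> finite_up_to_iso (G N)) \<Longrightarrow> finite_up_to_iso (\<Union>N\<in>F. G N)"
proof (induction F rule: finite_induct)
  case empty
  show ?case unfolding finite_up_to_iso_def by (intro exI[of _ "{}"]) simp
next
  case (insert N F)
  then show ?case by (simp add: finite_up_to_iso_Un)
qed

lemma finite_up_to_iso_summands:
  fixes Y :: "('k, 'a) std_module"
  assumes "fg_module A Y" shows "finite_up_to_iso {M \<in> indec_modules A. summand A M Y}"
proof -
  obtain F :: "('k, 'a) std_module set" where F: "finite F" "\<forall>N\<in>F. fg_module A N"
    "\<forall>M :: ('k, 'a) std_module. fg_module A M \<and> indecomposable_module A M \<and> summand A M Y \<longrightarrow>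
      (\<exists>N\<in>F. mod_isomorphic A N M)"
    using finitely_many_indecomposable_summands[OF assms] by blast
  then show ?thesis
    unfolding finite_up_to_iso_def indec_modules_def by (intro exI[of _ F]) blast
qed

lemma finite_up_to_iso_projectives:
  assumes B: "rank_one_free B b"
  shows "finite_up_to_iso {M \<in> indec_modules A. projective_module A M}"
proof -
  have pB: "projective_module A B" by (rule projective_rank_one_free[OF B])
  have "summand A M B" if M: "fg_module A M" "indecomposable_module A M" and F: "finite_power B F" "summand A M F"
    for M F :: "('k, 'a) std_module"
    using F
  proof induction
    case (step P)
    have lmP: "left_module A P" by (rule projective_left_module[OF projective_finite_power[OF step(1) pB]])
    have lmB: "left_module A B" by (rule projective_left_module[OF pB])
    interpret P: left_module A P by (rule lmP)
    interpret B: left_module A B by (rule lmB)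
    have "summand A M P \<or> summand A M B"
      by (rule indecomposable_summand_split[OF M step.prems mod_hom_dfst
            mod_hom_dpair[OF mod_hom_id mod_hom_zero_map[OF lmB]] mod_hom_dsnd
            mod_hom_dpair[OF mod_hom_zero_map[OF lmP] mod_hom_id]]) simp
    then show ?case using step.IH by blast
  qed
  then have "summand A M B" if "fg_module A M" "indecomposable_module A M" "projective_module A M" for M
    using that projective_summand_of_free[OF B that(3)] by metis
  then have "{M \<in> indec_modules A. projective_module A M} \<subseteq> {M \<in> indec_modules A. summand A M B}"
    by (auto simp: indec_modules_def)
  then show ?thesis
    using finite_up_to_iso_subset[OF finite_up_to_iso_summands[OF projective_fg[OF pB]]] by blast
qed

end

context dominant_coresolution
begin

text \<open>The new modules \<open>M\<close> are summands of the syzygies \<open>\<Omega> N\<close> of the representatives \<open>N\<close> of the modules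
  counted before. The module \<open>Y\<close> found for \<open>M\<close> is only isomorphic to some \<open>N\<close>; its syzygy is formed
  with the surjection chosen for \<open>N\<close>, so that it equals \<open>\<Omega> N\<close>.\<close>

lemma finite_up_to_iso_step:
  assumes d: "Suc d \<le> n" and fin: "finite_up_to_iso {M \<in> indec_modules A. \<not> pd_le (Suc d) M}"
  shows "finite_up_to_iso {M \<in> indec_modules A. \<not> pd_le d M}"
proof -
  from fin obtain F :: "('k, 'a) std_module set" where F: "finite F" "\<forall>N\<in>F. fg_module A N"
    "\<forall>M\<in>{M \<in> indec_modules A. \<not> pd_le (Suc d) M}. \<exists>N\<in>F. mod_isomorphic A N M"
    unfolding finite_up_to_iso_def by blast
  have cover: "\<exists>P g. projective_module A P \<and> g \<in> mod_hom A P N \<and> g ` carrier P = carrier N"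
    if "fg_module A N" for N :: "('k, 'a) std_module"
    using ex_free_cover[OF B_free that] projective_finite_power projective_rank_one_free[OF B_free] by metis
  then obtain P g where Pg: "\<And>N. fg_module A N \<Longrightarrow> projective_module A (P N)"
    "\<And>N. fg_module A N \<Longrightarrow> g N \<in> mod_hom A (P N) N"
    "\<And>N. fg_module A N \<Longrightarrow> g N ` carrier (P N) = carrier (N :: ('k, 'a) std_module)" by metis
  define \<Omega> where "\<Omega> N = (P N)\<lparr>carrier := a_kernel (P N) N (g N)\<rparr>" for N
  have fg\<Omega>: "fg_module A (\<Omega> N)" if "fg_module A N" for N
    unfolding \<Omega>_def
    by (intro fg_submodule submodule_kernel[OF _ _ Pg(2)] projective_left_module fg_left_module projective_fg Pg that)
  let ?G = "(\<Union>N\<in>F. {M \<in> indec_modules A. summand A M (\<Omega> N)})"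
  have "M \<in> ?G" if M: "M \<in> indec_modules A" "pd_le (Suc d) M" "\<not> pd_le d M" for M
  proof -
    have fgM: "fg_module A M" and indM: "indecomposable_module A M" using M(1) by (auto simp: indec_modules_def)
    obtain I \<epsilon> where I: "projective_module A I" "injective_module A I"
      and \<epsilon>: "\<epsilon> \<in> mod_hom A M I" "inj_on \<epsilon> (carrier M)"
      by (rule embeds_in_projective_injective[OF M(2) d])
    have "\<not> summand A M I" using M(3) pd_le_summand[OF pd_le_projective[OF I(1)] fgM] by blast
    from summand_of_syzygy[OF fgM indM I(1) \<epsilon> this]
    obtain Y :: "('k, 'a) std_module" where Y: "fg_module A Y" "indecomposable_module A Y"
      and s: "\<And>P g. projective_module A P \<Longrightarrow> g \<in> mod_hom A P Y \<Longrightarrow> g ` carrier P = carrier Y \<Longrightarrow>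
        summand A M (P\<lparr>carrier := a_kernel P Y g\<rparr>)" by blast
    have "\<not> pd_le (Suc d) Y"
    proof
      assume "pd_le (Suc d) Y"
      then have "pd_le d (\<Omega> Y)" unfolding \<Omega>_def by (rule pd_le_kernel[OF _ Pg[OF Y(1)]])
      then show False using M(3) pd_le_summand[OF _ fgM] s[OF Pg[OF Y(1)]] unfolding \<Omega>_def by blast
    qed
    then obtain N where N: "N \<in> F" "mod_isomorphic A N Y" using F(3) Y by (auto simp: indec_modules_def)
    have fgN: "fg_module A N" using F(2) N(1) by blast
    from N(2) obtain \<phi> where \<phi>: "\<phi> \<in> mod_hom A N Y" "bij_betw \<phi> (carrier N) (carrier Y)"
      unfolding mod_isomorphic_def by blast
    have lm: "left_module A N" "left_module A Y" using fgN Y(1) by (auto intro: fg_left_module)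
    have "(\<lambda>x. \<phi> (g N x)) ` carrier (P N) = \<phi> ` (g N ` carrier (P N))" by blast
    then have surj: "(\<lambda>x. \<phi> (g N x)) ` carrier (P N) = carrier Y"
      using Pg(3)[OF fgN] \<phi>(2) by (simp add: bij_betw_def)
    have "\<phi> y = \<zero>\<^bsub>Y\<^esub> \<longleftrightarrow> y = \<zero>\<^bsub>N\<^esub>" if "y \<in> carrier N" for y
      using inj_on_mod_hom_iff[OF lm \<phi>(1)] bij_betw_imp_inj_on[OF \<phi>(2)] that mod_hom_zero[OF lm \<phi>(1)] by blast
    then have "a_kernel (P N) Y (\<lambda>x. \<phi> (g N x)) = a_kernel (P N) N (g N)"
      using mod_hom_closed[OF Pg(2)[OF fgN]] by (auto simp: a_kernel_eq)
    then have "summand A M (\<Omega> N)"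
      using s[OF Pg(1)[OF fgN] mod_hom_compose[OF Pg(2)[OF fgN] \<phi>(1)] surj] by (simp add: \<Omega>_def)
    then show ?thesis using N(1) M(1) by blast
  qed
  then have "{M \<in> indec_modules A. \<not> pd_le d M} \<subseteq> {M \<in> indec_modules A. \<not> pd_le (Suc d) M} \<union> ?G" by blast
  moreover have "finite_up_to_iso ?G"
    using F(1,2) fg\<Omega> by (intro finite_up_to_iso_UN finite_up_to_iso_summands) blast+
  ultimately show ?thesis using finite_up_to_iso_subset[OF finite_up_to_iso_Un[OF fin]] by blast
qed

theorem finite_up_to_iso_indec_modules:
  assumes "finite_up_to_iso {M \<in> indec_modules A. \<not> pd_le n M}"
  shows "finite_up_to_iso (indec_modules A)"
proof -
  have "finite_up_to_iso {M \<in> indec_modules A. \<not> pd_le 0 M}"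
  proof (induction rule: inc_induct[OF le0[of n]])
    case 1 show ?case by (rule assms)
  next
    case (2 d) then show ?case by (intro finite_up_to_iso_step[of d]) auto
  qed
  from finite_up_to_iso_Un[OF this finite_up_to_iso_projectives[OF B_free]]
  show ?thesis by (rule finite_up_to_iso_subset) auto
qed

end

theorem theorem1:
  fixes n :: nat and K :: "'k ring" and \<Lambda> :: "('k, 'a) module"
  assumes "n \<ge> 1"
    and "n_Auslander_algebra n K \<Lambda>"
  shows "representation_finite \<Lambda> \<longleftrightarrow>
    finite ({M \<in> indec_modules \<Lambda>. proj_dim \<Lambda> M = enat (n + 1)} // mod_iso_rel \<Lambda>)"
proof
  assume "representation_finite \<Lambda>"
  then show "finite ({M \<in> indec_modules \<Lambda>. proj_dim \<Lambda> M = enat (n + 1)} // mod_iso_rel \<Lambda>)"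
    unfolding representation_finite_def by (rule rev_finite_subset) (auto simp: quotient_def)
next
  assume fin: "finite ({M \<in> indec_modules \<Lambda>. proj_dim \<Lambda> M = enat (n + 1)} // mod_iso_rel \<Lambda>)"
  have gl: "gl_dim \<Lambda> \<le> enat (n + 1)" and dom: "dom_dim \<Lambda> \<ge> enat (n + 1)"
    using assms(2) by (auto simp: n_Auslander_algebra_def)
  interpret fin_dim_algebra K \<Lambda> using assms(2) by (simp add: n_Auslander_algebra_def)
  have "enat n < dom_dim \<Lambda>" using dom by (rule less_le_trans[rotated]) simp
  then obtain l J e \<delta> where l: "enat n < enat l" and r: "minimal_injective_resolution \<Lambda> (regular_module \<Lambda>) J e \<delta>"
    and Jp: "\<forall>i<l. projective_module \<Lambda> (J i)"
    unfolding dom_dim_def less_Sup_iff by blast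
  have Ji: "\<And>i. injective_module \<Lambda> (J i)" and e: "e \<in> mod_hom \<Lambda> (regular_module \<Lambda>) (J 0)"
    "inj_on e (carrier (regular_module \<Lambda>))" and \<delta>: "\<And>i. \<delta> i \<in> mod_hom \<Lambda> (J i) (J (Suc i))"
    and eim: "e ` carrier (regular_module \<Lambda>) = a_kernel (J 0) (J (Suc 0)) (\<delta> 0)"
    and ex: "\<And>i. \<delta> i ` carrier (J i) = a_kernel (J (Suc i)) (J (Suc (Suc i))) (\<delta> (Suc i))"
    using r unfolding minimal_injective_resolution_def by auto
  let ?B = "(J 0)\<lparr>carrier := a_kernel (J 0) (J (Suc 0)) (\<delta> 0)\<rparr>"
  have "rank_one_free ?B (e \<one>\<^bsub>\<Lambda>\<^esub>)"
    using rank_one_free_image_of_regular[OF injective_fg[OF Ji] e] by (simp add: eim)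
  then interpret dominant_coresolution K \<Lambda> n J \<delta> ?B "e \<one>\<^bsub>\<Lambda>\<^esub>"
    by unfold_locales (use Ji Jp l \<delta> ex in auto)
  have "proj_dim \<Lambda> M = enat (n + 1)" if M: "M \<in> indec_modules \<Lambda>" "\<not> pd_le n M" for M
  proof -
    have fgM: "fg_module \<Lambda> M" using M(1) by (simp add: indec_modules_def)
    have "proj_dim \<Lambda> M \<le> gl_dim \<Lambda>" unfolding gl_dim_def using fgM by (intro Sup_upper) blast
    then have "proj_dim \<Lambda> M \<le> enat (n + 1)" using gl by (rule order_trans)
    moreover have "\<not> proj_dim \<Lambda> M \<le> enat n" using proj_dim_pd_le[OF fgM] M(2) by blast
    ultimately show ?thesis by (cases "proj_dim \<Lambda> M") auto
  qed
  then have "{M \<in> indec_modules \<Lambda>. \<not> pd_le n M} \<subseteq> {M \<in> indec_modules \<Lambda>. proj_dim \<Lambda> M = enat (n + 1)}" by blast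
  moreover have "finite_up_to_iso {M \<in> indec_modules \<Lambda>. proj_dim \<Lambda> M = enat (n + 1)}"
    using fin by (subst finite_up_to_iso_iff) (auto simp: indec_modules_def)
  ultimately have "finite_up_to_iso (indec_modules \<Lambda>)"
    by (intro finite_up_to_iso_indec_modules) (rule finite_up_to_iso_subset)
  then show "representation_finite \<Lambda>"
    unfolding representation_finite_def by (subst (asm) finite_up_to_iso_iff) (auto simp: indec_modules_def)
qed

end
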